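(* Let $P \subset \mathbb{R}^n$ be a polytope with non-empty interior that is a local maximizer of the isotropic constant $K \mapsto L_K$ in the class of convex bodies in $\mathbb{R}^n$. If $P$ has a simplicial vertex, then $P$ is a simplex.
   Context: A convex body $K\subset\mathbb{R}^n$ is a compact convex set with non-empty interior. Its covariance matrix is $A_K = \mathbb{E}[XX^{\mathsf T}] - \mathbb{E}[X]\mathbb{E}[X]^{\mathsf T}$, where $X$ is uniformly distributed on $K$, and its isotropic constant $L_K>0$ is defined by $L_K^{2n} = \det A_K/(\mathrm{vol}\, K)^2$ (an affine invariant). A polytope is the convex hull of finitely many points. A vertex $v$ of a polytope $P$ is called simplicial if every facet $F$ of $P$ with $v \in F$ is a simplex. A body $P$ is a local maximizer of the isotropic constant in a class of convex bodies if it belongs to the class and there is a neighbourhood $U$ of $P$ with respect to the Hausdorff metric such that $L_K \le L_P$ for all $K \in U$ in the class. *)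

theory Defs
  imports "HOL-Analysis.Analysis"
begin

definition convex_body :: "'a::euclidean_space set \<Rightarrow> bool" where
  "convex_body K \<longleftrightarrow> compact K \<and> convex K \<and> interior K \<noteq> {}"

abbreviation uniform_on :: "(real ^ 'n) set \<Rightarrow> (real ^ 'n) measure" where
  "uniform_on K \<equiv> uniform_measure lborel K"

text \<open>The matrix $x x^{\mathsf T}$: a column times a row, with inner dimension fixed to 1.\<close>

definition self_outer :: "real ^ 'n \<Rightarrow> real ^ 'n ^ 'n" where
  "self_outer x = (columnvector x :: real ^ 1 ^ 'n) ** rowvector x"

definition covariance_matrix :: "(real ^ 'n) set \<Rightarrow> real ^ 'n ^ 'n" where
  "covariance_matrix K =
     (LINT x|uniform_on K. self_outer x) - self_outer (LINT x|uniform_on K. x)"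

definition isotropic_constant :: "(real ^ 'n) set \<Rightarrow> real" where
  "isotropic_constant K =
     root (2 * CARD('n)) (det (covariance_matrix K) / (measure lborel K)\<^sup>2)"

text \<open>The Hausdorff distance is only meaningful for nonempty bounded sets: otherwise a
  supremum below may be over an empty or unbounded set of reals.\<close>

definition hausdorff_distance :: "'a::metric_space set \<Rightarrow> 'a set \<Rightarrow> real" where
  "hausdorff_distance S T = max (SUP x\<in>S. infdist x T) (SUP y\<in>T. infdist y S)"

definition local_maximizer_in ::
    "('a::metric_space set \<Rightarrow> real) \<Rightarrow> 'a set set \<Rightarrow> 'a set \<Rightarrow> bool" where
  "local_maximizer_in f \<C> P \<longleftrightarrow>
     P \<in> \<C> \<and> (\<exists>\<epsilon>>0. \<forall>K\<in>\<C>. hausdorff_distance K P < \<epsilon> \<longrightarrow> f K \<le> f P)"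

definition simplicial_vertex :: "'a::euclidean_space \<Rightarrow> 'a set \<Rightarrow> bool" where
  "simplicial_vertex v P \<longleftrightarrow>
     v extreme_point_of P \<and> (\<forall>F. F facet_of P \<and> v \<in> F \<longrightarrow> (\<exists>k. k simplex F))"

end

theory Submission
  imports Defs
begin

text \<open>
  Translate \<open>P\<close> to have centroid 0, let \<open>A\<close> be its covariance matrix and measure lengths and angles with the
  form \<open>Q x y = x \<bullet> A\<inverse> y\<close>. Gluing a thin simplex onto a simplicial facet, or cutting off a thin slab
  along it, changes \<open>det A / vol\<^sup>2\<close> to first order by an integral of \<open>Q x x - (n + 2)\<close>. Since neither change
  increases it, the vertices \<open>w\<close> of a simplicial facet satisfy \<open>Q w S + Q w w = (n + 1) (n + 2)\<close>, where \<open>S\<close>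
  is the sum of the vertices. Comparing two adjacent facets \<open>R \<union> {a}\<close> and \<open>R \<union> {b}\<close> at the simplicial
  vertex \<open>v\<close>, one sees that \<open>a\<close> and \<open>b\<close> are mirror images in the hyperplane spanned by \<open>R\<close> and the origin;
  hence all facets at \<open>v\<close> are permuted by this reflection.

  Now move a vertex \<open>w\<close> in the direction \<open>u = a - b\<close> and keep the others. If the facets at \<open>w\<close> that are not
  parallel to \<open>u\<close> come in mirror pairs, then every chord of \<open>P\<close> in the direction \<open>u\<close> is merely translated. So
  the volume is constant, and \<open>det A\<close> becomes a quadratic polynomial in the time, whose leading coefficient
  is positive unless the displacement is an affine function on \<open>P\<close>. Hence all vertices except \<open>w\<close> lie in a
  hyperplane parallel to \<open>u\<close>. With \<open>w = v\<close> this makes \<open>P\<close> a pyramid whose base is parallel to \<open>u\<close>, so the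
  argument applies to every \<open>w \<in> R\<close>, and no vertices other than \<open>R\<close>, \<open>a\<close> and \<open>b\<close> are possible.
\<close>

section \<open>Volume scaling under affine maps\<close>

text \<open>The origin of \<open>n + 2\<close>: to first order, adding volume \<open>\<tau>\<close>
  to a body of volume \<open>m\<close> with centroid 0 changes log det A by
  \<open>\<tau> / m\<close> times the mean of \<open>Q x x - n\<close> over the added part, and the
  logarithm of the squared volume by \<open>2 * \<tau> / m\<close>. Simplicial facets are special
  because the mean of \<open>Q x x\<close> over a thin simplex is an explicit function of its
  vertices. The reflection is at first known only for two adjacent facets. It spreads because the
  same equations hold at every facet at \<open>v\<close>: the vertex across a ridge is determined by
  the ridge and the opposite vertex, through orthogonality and equal length. So neighbours of
  mirrored facets are mirrored, and the facets at \<open>v\<close> are connected through ridges.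
  This is a symmetry of the facets at \<open>v\<close>, not of \<open>P\<close>, which is why a
  single vertex is moved instead of the whole body. For that motion the quadratic term decides: one
  of the two signs of the time makes the linear term nonnegative.\<close>

lemma emeasure_lborel_open_neq_0:
  fixes S :: "'a::euclidean_space set"
  assumes "open S" "S \<noteq> {}"
  shows "emeasure lborel S \<noteq> 0"
  using open_not_negligible[OF assms] assms
  by (metis borel_open negligible_iff_null_sets null_setsI null_sets_completionI sets_lborel)

text \<open>The change of variables theorems of \<open>HOL-Analysis\<close> are restricted to well-ordered index types. The scaling
  factor is therefore obtained from the uniqueness of translation invariant measures; its value as a
  determinant is never needed.\<close>

lemma distr_lborel_linear:
  fixes h :: "'a::euclidean_space \<Rightarrow> 'a"
  assumes h: "linear h" "inj h"
  obtains m :: real where "m > 0" "distr lborel borel h = density lborel (\<lambda>_. ennreal m)"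
proof -
  obtain h' where h': "linear h'" "\<And>x. h' (h x) = x" "\<And>x. h (h' x) = x"
    using linear_injective_isomorphism[OF h] by auto
  have [measurable]: "h \<in> borel_measurable borel" "h' \<in> borel_measurable borel"
    using h h' by (auto intro!: borel_measurable_continuous_onI linear_continuous_on simp: linear_conv_bounded_linear)
  define \<mu> where "\<mu> = distr lborel borel h"
  have [simp]: "sets \<mu> = sets borel" "space \<mu> = UNIV" by (auto simp: \<mu>_def)
  have [measurable_cong]: "sets \<mu> = sets borel" by simp
  have em: "emeasure \<mu> A = emeasure lborel (h -` A)" if "A \<in> sets borel" for A
    using that by (simp add: \<mu>_def emeasure_distr)
  have tr: "(\<integral>\<^sup>+x. f (x + y) \<partial>\<mu>) = (\<integral>\<^sup>+x. f x \<partial>\<mu>)" if [measurable]: "f \<in> borel_measurable borel" for f y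
  proof -
    have "(\<integral>\<^sup>+x. f (x + y) \<partial>\<mu>) = (\<integral>\<^sup>+x. f (h x + y) \<partial>lborel)"
      by (simp add: \<mu>_def nn_integral_distr)
    also have "\<dots> = (\<integral>\<^sup>+x. f (h (h' y + x)) \<partial>lborel)"
      by (simp add: h' linear_add[OF h(1)] add.commute)
    also have "\<dots> = (\<integral>\<^sup>+x. f (h x) \<partial>distr lborel borel ((+) (h' y)))"
      by (simp add: nn_integral_distr)
    also have "\<dots> = (\<integral>\<^sup>+x. f x \<partial>\<mu>)"
      by (simp add: lborel_distr_plus \<mu>_def nn_integral_distr)
    finally show ?thesis .
  qed
  have trl: "(\<integral>\<^sup>+x. f (x + y) \<partial>lborel) = (\<integral>\<^sup>+x. f x \<partial>(lborel::'a measure))" if [measurable]: "f \<in> borel_measurable borel" for f y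
  proof -
    have "(\<integral>\<^sup>+x. f (x + y) \<partial>lborel) = (\<integral>\<^sup>+x. f x \<partial>distr lborel borel ((+) y))"
      by (simp add: nn_integral_distr add.commute)
    then show ?thesis by (simp add: lborel_distr_plus)
  qed
  have bdd: "emeasure lborel (h -` S) < \<infinity>" if "bounded S" for S
  proof -
    have "h -` S = h' ` S"
    proof safe
      fix x assume "h x \<in> S" then show "x \<in> h' ` S" by (intro image_eqI[of _ _ "h x"]) (simp_all add: h')
    qed (simp add: h')
    then have "bounded (h -` S)"
      using that bounded_linear_image[of S h'] h'(1) linear_conv_bounded_linear by metis
    then show ?thesis by (rule emeasure_bounded_finite)
  qed
  have sf: "sigma_finite_measure \<mu>"
  proof
    let ?A = "range (\<lambda>n::nat. ball (0::'a) (real n))"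
    have "\<Union>?A = UNIV" using reals_Archimedean2[of "norm _"] by (auto)
    moreover have "emeasure \<mu> a \<noteq> \<infinity>" if "a \<in> ?A" for a
      using that bdd[of a] em[of a] by auto
    ultimately show "\<exists>A. countable A \<and> A \<subseteq> sets \<mu> \<and> \<Union>A = space \<mu> \<and> (\<forall>a\<in>A. emeasure \<mu> a \<noteq> \<infinity>)"
      by (intro exI[of _ ?A]) auto
  qed
  interpret pair_sigma_finite \<mu> "lborel :: 'a measure"
    using sf by (simp add: pair_sigma_finite_def lborel.sigma_finite_measure_axioms)
  define g :: "'a \<Rightarrow> ennreal" where "g = indicator (ball 0 1)"
  have [measurable]: "ball (0::'a) 1 \<in> sets borel" by simp
  have [measurable]: "g \<in> borel_measurable borel" unfolding g_def by measurable
  define b where "b = emeasure lborel (ball (0::'a) 1)"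
  have b: "b \<noteq> 0" "b < \<infinity>"
    unfolding b_def using emeasure_bounded_finite[of "ball (0::'a) 1"] emeasure_lborel_open_neq_0[of "ball (0::'a) 1"]
    by auto
  define c where "c = emeasure lborel (h -` (ball 0 1))"
  have gc: "(\<integral>\<^sup>+x. g (-x) \<partial>\<mu>) = c"
  proof -
    have "(\<integral>\<^sup>+x. g (-x) \<partial>\<mu>) = (\<integral>\<^sup>+x. indicator (ball 0 1) x \<partial>\<mu>)"
      by (intro nn_integral_cong) (auto simp: g_def indicator_def)
    then show ?thesis by (simp add: em c_def)
  qed
  \<comment> \<open>Uniqueness of Haar measure: both sides equal the double integral of
    \<open>indicator A x * g (y - x)\<close> over \<open>\<mu>\<close> and Lebesgue measure.
    Integrating over \<open>y\<close> first gives the left side; translating \<open>x\<close> by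
    \<open>y\<close> before integrating over \<open>y\<close> gives the right side.\<close>
  have key: "emeasure \<mu> A * b = emeasure lborel A * c" if [measurable]: "A \<in> sets borel" for A
  proof -
    have "emeasure \<mu> A * b = (\<integral>\<^sup>+x. indicator A x * b \<partial>\<mu>)"
      by (simp add: nn_integral_multc)
    also have "\<dots> = (\<integral>\<^sup>+x. (\<integral>\<^sup>+y. indicator A x * g (y - x) \<partial>lborel) \<partial>\<mu>)"
    proof (rule nn_integral_cong)
      fix x
      have "(\<integral>\<^sup>+y. g (y + (- x)) \<partial>lborel) = b"
        by (subst trl, measurable) (simp add: g_def b_def)
      then show "indicator A x * b = (\<integral>\<^sup>+y. indicator A x * g (y - x) \<partial>lborel)"
        by (simp add: nn_integral_cmult)
    qed
    also have "\<dots> = (\<integral>\<^sup>+y. (\<integral>\<^sup>+x. indicator A x * g (y - x) \<partial>\<mu>) \<partial>lborel)"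
      by (rule Fubini'[symmetric]) measurable
    also have "\<dots> = (\<integral>\<^sup>+y. (\<integral>\<^sup>+x. indicator A (x + y) * g (- x) \<partial>\<mu>) \<partial>lborel)"
    proof (rule nn_integral_cong)
      fix y
      show "(\<integral>\<^sup>+x. indicator A x * g (y - x) \<partial>\<mu>) = (\<integral>\<^sup>+x. indicator A (x + y) * g (- x) \<partial>\<mu>)"
        by (subst tr[of "\<lambda>x. indicator A x * g (y - x)" y, symmetric]) (simp_all add: algebra_simps)
    qed
    also have "\<dots> = (\<integral>\<^sup>+x. (\<integral>\<^sup>+y. indicator A (x + y) * g (- x) \<partial>lborel) \<partial>\<mu>)"
      by (rule Fubini') measurable
    also have "\<dots> = (\<integral>\<^sup>+x. emeasure lborel A * g (- x) \<partial>\<mu>)"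
    proof (rule nn_integral_cong)
      fix x
      have "(\<integral>\<^sup>+y. indicator A (y + x) \<partial>lborel) = emeasure lborel A"
        by (subst trl) (simp_all)
      then show "(\<integral>\<^sup>+y. indicator A (x + y) * g (- x) \<partial>lborel) = emeasure lborel A * g (- x)"
        by (simp add: nn_integral_multc add.commute)
    qed
    also have "\<dots> = emeasure lborel A * c"
      by (simp add: nn_integral_cmult gc)
    finally show ?thesis .
  qed
  have c: "c < \<infinity>" unfolding c_def by (rule bdd) simp
  have c0: "c \<noteq> 0"
  proof
    assume "c = 0"
    have op: "open (h -` ball 0 1)"
      using h by (intro open_vimage linear_continuous_on) (auto simp: linear_conv_bounded_linear)
    moreover have "0 \<in> h -` ball 0 1" using linear_0[OF h(1)] by simp
    ultimately show False using emeasure_lborel_open_neq_0[OF op] \<open>c = 0\<close> unfolding c_def by blast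
  qed
  define m where "m = enn2real (c / b)"
  have cb: "ennreal m = c / b"
    unfolding m_def using b c by (auto simp add: ennreal_enn2real_if ennreal_divide_eq_top_iff)
  have "m > 0"
    unfolding m_def using b c c0
    by (simp add: enn2real_positive_iff ennreal_divide_eq_top_iff less_top[symmetric] zero_less_iff_neq_zero ennreal_divide_eq_0_iff)
  moreover have "\<mu> = density lborel (\<lambda>_. ennreal m)"
  proof (rule measure_eqI)
    fix A assume "A \<in> sets \<mu>"
    then have [measurable]: "A \<in> sets borel" by simp
    have "emeasure \<mu> A = emeasure \<mu> A * b / b"
      using b by (simp add: ennreal_mult_divide_eq)
    also have "\<dots> = emeasure lborel A * ennreal m"
      by (simp add: key cb ennreal_times_divide)
    finally show "emeasure \<mu> A = emeasure (density lborel (\<lambda>_. ennreal m)) A"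
      by (simp add: emeasure_density nn_integral_cmult mult.commute)
  qed simp
  ultimately show ?thesis using that by (simp add: \<mu>_def)
qed


text \<open>One factor \<open>J\<close> serves all sets, integrands and translations. It can
  therefore be calibrated with the integrand 1 on a convenient set and then be used for any other
  integrand.\<close>

lemma set_integral_affine_image:
  fixes h :: "'a::euclidean_space \<Rightarrow> 'a"
  assumes h: "linear h" "inj h"
  obtains J :: real where "J > 0"
    "\<And>c S f. S \<in> sets borel \<Longrightarrow> f \<in> borel_measurable borel \<Longrightarrow>
       (LINT x:(\<lambda>x. c + h x) ` S|lborel. f x) = J * (LINT x:S|lborel. (f (c + h x) :: real))"
    "\<And>c S. S \<in> sets borel \<Longrightarrow> (\<lambda>x. c + h x) ` S \<in> sets borel"
proof -
  obtain m :: real where m: "m > 0" "distr lborel borel h = density lborel (\<lambda>_. ennreal m)"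
    using distr_lborel_linear[OF h] .
  obtain h' where h': "linear h'" "\<And>x. h' (h x) = x" "\<And>x. h (h' x) = x"
    using linear_injective_isomorphism[OF h] by auto
  have [measurable]: "h \<in> borel_measurable borel" "h' \<in> borel_measurable borel"
    using h h' by (auto intro!: borel_measurable_continuous_onI linear_continuous_on simp: linear_conv_bounded_linear)
  have im: "(\<lambda>x. c + h x) ` S = (\<lambda>x. h' (x - c)) -` S" for c S
  proof safe
    fix x assume "h' (x - c) \<in> S" then show "x \<in> (\<lambda>x. c + h x) ` S"
      by (intro image_eqI[of _ _ "h' (x - c)"]) (simp_all add: h')
  qed (simp add: h')
  have ib: "(\<lambda>x. c + h x) ` S \<in> sets borel" if "S \<in> sets borel" for c S
  proof -
    have "(\<lambda>x. h' (x - c)) \<in> borel_measurable borel" by measurable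
    from measurable_sets[OF this that] show ?thesis by (simp add: im)
  qed
  \<comment> \<open>\<open>m\<close> is the factor by which preimages under \<open>h\<close> scale,
    so images scale by its reciprocal.\<close>
  show thesis
  proof (rule that[of "1/m"])
    show "1 / m > 0" using m by simp
    fix c :: 'a and S :: "'a set" and f :: "'a \<Rightarrow> real"
    assume S[measurable]: "S \<in> sets borel" and f[measurable]: "f \<in> borel_measurable borel"
    let ?S = "(\<lambda>x. c + h x) ` S"
    have [measurable]: "?S \<in> sets borel" by (rule ib[OF S])
    have ind: "indicator ?S (c + h x) = (indicator S x :: real)" for x
      by (simp add: im indicator_def h')
    have "(LINT x:?S|lborel. f x) = (\<integral>x. indicator ?S x * f x \<partial>distr lborel borel ((+) c))"
      by (simp add: lborel_distr_plus set_lebesgue_integral_def)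
    also have "\<dots> = (\<integral>x. indicator ?S (c + x) * f (c + x) \<partial>lborel)"
      by (subst integral_distr) simp_all
    also have "\<dots> = (1/m) * (\<integral>x. indicator ?S (c + x) * f (c + x) \<partial>density lborel (\<lambda>_. ennreal m))"
      using m by (subst integral_density) (simp_all)
    also have "\<dots> = (1/m) * (\<integral>x. indicator ?S (c + h x) * f (c + h x) \<partial>lborel)"
      by (subst m(2)[symmetric], subst integral_distr) simp_all
    also have "\<dots> = (1/m) * (LINT x:S|lborel. f (c + h x))"
      by (simp add: ind set_lebesgue_integral_def)
    finally show "(LINT x:?S|lborel. f x) = 1 / m * (LINT x:S|lborel. f (c + h x))" .
  qed (rule ib)
qed

lemma set_integral_const_one:
  "(LINT x:S|lborel. (1::real)) = measure lborel (S :: 'a::euclidean_space set)"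
  by (simp add: set_lebesgue_integral_def)

lemma set_integrable_continuous_bounded:
  fixes f :: "'a::euclidean_space \<Rightarrow> 'b::{banach, second_countable_topology}"
  assumes "bounded S" "S \<in> sets borel" "continuous_on UNIV f"
  shows "set_integrable lborel S f"
proof -
  obtain a where a: "S \<subseteq> cbox (-a) a" using bounded_subset_cbox_symmetric[OF assms(1)] by blast
  have "set_integrable lborel (cbox (-a) a) f"
    unfolding set_integrable_def using assms(3) continuous_on_subset
    by (intro borel_integrable_compact) auto
  from set_integrable_subset[OF this] a assms(2) show ?thesis by simp
qed

text \<open>The shear \<open>h\<close> is conjugate to \<open>h \<circ> h\<close> by the map \<open>D\<close> that doubles \<open>u\<close>, so its volume factor \<open>J\<close> satisfies
  \<open>J = J\<^sup>2\<close>.\<close>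

lemma set_integral_shear:
  fixes u w :: "'a::euclidean_space"
  assumes wu: "w \<bullet> u = 0" and S: "S \<in> sets borel" and f: "f \<in> borel_measurable borel"
  shows "(LINT x:(\<lambda>x. x + (w \<bullet> x + k) *\<^sub>R u) ` S|lborel. f x) = (LINT x:S|lborel. (f (x + (w \<bullet> x + k) *\<^sub>R u) :: real))"
    and "(\<lambda>x. x + (w \<bullet> x + k) *\<^sub>R u) ` S \<in> sets borel"
proof -
  define h where "h = (\<lambda>x. x + (w \<bullet> x) *\<^sub>R u)"
  \<comment> \<open>If \<open>u = 0\<close>, division by zero makes \<open>D\<close> the identity,
    and the argument goes through unchanged.\<close>
  define D where "D = (\<lambda>x. x + (u \<bullet> x / (u \<bullet> u)) *\<^sub>R u)"
  have h: "linear h" unfolding h_def by (rule linearI) (simp_all add: inner_add_right scaleR_add_left algebra_simps)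
  have D: "linear D" unfolding D_def by (rule linearI) (simp_all add: inner_add_right add_divide_distrib algebra_simps)
  have wh: "w \<bullet> h x = w \<bullet> x" for x by (simp add: h_def wu inner_add_right)
  have ih: "inj h"
  proof (rule injI)
    fix x y assume e: "h x = h y"
    then have "w \<bullet> x = w \<bullet> y" using wh by metis
    with e show "x = y" by (simp add: h_def)
  qed
  have iD: "inj D"
  proof (rule injI)
    fix x y assume e: "D x = D y"
    have uD: "u \<bullet> D x = 2 * (u \<bullet> x)" for x by (simp add: D_def inner_add_right)
    have "u \<bullet> x = u \<bullet> y" using e uD by (metis mult_left_cancel zero_neq_numeral)
    with e show "x = y" by (simp add: D_def)
  qed
  have comm: "D (h x) = h (h (D x))" for x
    by (cases "u = 0") (simp_all add: D_def h_def wu inner_add_right inner_commute[of u w] add_divide_distrib algebra_simps scaleR_add_left[symmetric] del: scaleR_add_left)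
  obtain J where J: "J > 0"
    "\<And>c S f. S \<in> sets borel \<Longrightarrow> f \<in> borel_measurable borel \<Longrightarrow>
       (LINT x:(\<lambda>x. c + h x) ` S|lborel. f x) = J * (LINT x:S|lborel. (f (c + h x) :: real))"
    "\<And>c S. S \<in> sets borel \<Longrightarrow> (\<lambda>x. c + h x) ` S \<in> sets borel"
    using set_integral_affine_image[OF h ih] by blast
  obtain K where K: "K > 0"
    "\<And>c S f. S \<in> sets borel \<Longrightarrow> f \<in> borel_measurable borel \<Longrightarrow>
       (LINT x:(\<lambda>x. c + D x) ` S|lborel. f x) = K * (LINT x:S|lborel. (f (c + D x) :: real))"
    "\<And>c S. S \<in> sets borel \<Longrightarrow> (\<lambda>x. c + D x) ` S \<in> sets borel"
    using set_integral_affine_image[OF D iD] by blast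
  have mJ: "measure lborel (h ` S) = J * measure lborel S" "h ` S \<in> sets borel" if "S \<in> sets borel" for S
    using J(2)[of S "\<lambda>_. 1" 0] J(3)[of S 0] that by (simp_all add: set_integral_const_one)
  have mK: "measure lborel (D ` S) = K * measure lborel S" "D ` S \<in> sets borel" if "S \<in> sets borel" for S
    using K(2)[of S "\<lambda>_. 1" 0] K(3)[of S 0] that by (simp_all add: set_integral_const_one)
  let ?B = "ball (0::'a) 1"
  have B: "?B \<in> sets borel" by simp
  have "D ` h ` ?B = h ` h ` D ` ?B" by (simp add: image_image comm)
  then have "K * (J * measure lborel ?B) = J * (J * (K * measure lborel ?B))"
    using mJ mK B by metis
  moreover have "measure lborel ?B > 0" using content_ball_pos[of 1] by simp
  ultimately have J1: "J = 1" using J(1) K(1) by simp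
  have eq: "(\<lambda>x. x + (w \<bullet> x + k) *\<^sub>R u) = (\<lambda>x. k *\<^sub>R u + h x)"
    by (auto simp: h_def algebra_simps)
  show "(LINT x:(\<lambda>x. x + (w \<bullet> x + k) *\<^sub>R u) ` S|lborel. f x) = (LINT x:S|lborel. (f (x + (w \<bullet> x + k) *\<^sub>R u) :: real))"
    using J(2)[OF S f, of "k *\<^sub>R u"] unfolding eq fun_cong[OF eq] by (simp add: J1)
  show "(\<lambda>x. x + (w \<bullet> x + k) *\<^sub>R u) ` S \<in> sets borel"
    unfolding eq by (rule J(3)[OF S])
qed

section \<open>Second moments of a simplex\<close>

lemma null_hyperplane_lborel:
  fixes a :: "'a::euclidean_space"
  assumes "a \<noteq> 0"
  shows "AE x in lborel. a \<bullet> x \<noteq> b"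
proof -
  have "negligible {x. a \<bullet> x = b}" using assms by (rule negligible_hyperplane[OF disjI1])
  then have "{x. a \<bullet> x = b} \<in> null_sets lborel"
    by (simp add: negligible_iff_null_sets null_sets_completion_iff closed_hyperplane borel_closed)
  from AE_not_in[OF this] show ?thesis by simp
qed

lemma set_integral_sum_fun:
  fixes f :: "'i \<Rightarrow> 'a \<Rightarrow> real"
  assumes "\<And>i. i \<in> I \<Longrightarrow> set_integrable M A (f i)"
  shows "(LINT x:A|M. (\<Sum>i\<in>I. f i x)) = (\<Sum>i\<in>I. (LINT x:A|M. f i x))"
    and "set_integrable M A (\<lambda>x. \<Sum>i\<in>I. f i x)"
  using assms unfolding set_lebesgue_integral_def set_integrable_def
  by (simp_all add: sum_distrib_left)

definition corner_simplex :: "(real^'n) set" where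
  "corner_simplex = {y. (\<forall>i. 0 \<le> y$i) \<and> (\<Sum>i\<in>UNIV. y$i) \<le> 1}"

lemma corner_simplex_hull: "corner_simplex = convex hull (insert 0 (Basis :: (real^'n) set))"
proof -
  have "(\<Sum>i\<in>Basis. x \<bullet> i) = (\<Sum>i\<in>UNIV. x$i)" for x :: "real^'n"
    by (simp add: Basis_vec_def axis_eq_axis sum.UNION_disjoint inner_axis UNION_singleton_eq_range sum.reindex inj_on_def)
  then show ?thesis
    unfolding std_simplex corner_simplex_def by (auto simp: Basis_vec_def inner_axis)
qed

lemma compact_corner_simplex: "compact (corner_simplex :: (real^'n) set)"
  unfolding corner_simplex_hull by (intro finite_imp_compact_convex_hull) simp

lemma measure_corner_simplex_pos: "0 < measure lborel (corner_simplex :: (real^'n) set)"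
  by (simp add: corner_simplex_hull content_std_simplex)

text \<open>With the slack coordinate \<open>1 - s y\<close>, the moments are determined by two symmetries: \<open>r k\<close> swaps \<open>y$k\<close> with
  the slack, and \<open>h k\<close> maps the simplex onto its half on which \<open>y$k\<close> is at most the slack.\<close>

lemma corner_simplex_moments:
  fixes i j :: "'n::finite"
  defines "v \<equiv> measure lborel (corner_simplex :: (real^'n) set)"
  defines "n \<equiv> real CARD('n)"
  shows "(LINT y:corner_simplex|lborel. y$i) = v / (n+1)"
    and "(LINT y:corner_simplex|lborel. y$i * y$j) = (if i = j then 2 else 1) * v / ((n+1)*(n+2))"
proof -
  let ?D = "corner_simplex :: (real^'n) set"
  define s :: "real^'n \<Rightarrow> real" where "s y = (\<Sum>i\<in>UNIV. y$i)" for y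
  have sadd: "s (x + y) = s x + s y" "s (x - y) = s x - s y" "s (c *\<^sub>R y) = c * s y" for x y c
    by (simp_all add: s_def sum.distrib sum_subtractf sum_distrib_left)
  have sax: "s (axis k c) = c" for k c
    by (simp add: s_def axis_def if_distrib sum.If_cases)
  have cs [continuous_intros]: "continuous_on A s" for A
    unfolding s_def by (intro continuous_intros)
  have D: "?D \<in> sets borel" "bounded ?D"
    using compact_corner_simplex by (auto intro: borel_compact compact_imp_bounded)
  have si: "set_integrable lborel ?D f" if "continuous_on UNIV f" for f :: "real^'n \<Rightarrow> real"
    using set_integrable_continuous_bounded[OF D(2,1) that] .
  have bm: "f \<in> borel_measurable borel" if "continuous_on UNIV f" for f :: "real^'n \<Rightarrow> real"
    using that by (rule borel_measurable_continuous_onI)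
  have vpos: "v > 0" unfolding v_def by (rule measure_corner_simplex_pos)
  define hr :: "'n \<Rightarrow> real^'n \<Rightarrow> real^'n" where "hr k y = y - (s y + y$k) *\<^sub>R axis k 1" for k y
  define r :: "'n \<Rightarrow> real^'n \<Rightarrow> real^'n" where "r k y = axis k 1 + hr k y" for k y
  have r_comp: "r k y $ l = (if l = k then 1 - s y else y $ l)" for k y l
    by (simp add: r_def hr_def axis_def)
  have s_r: "s (r k y) = 1 - y$k" for k y
    by (simp add: r_def hr_def sadd sax)
  have rr: "r k (r k y) = y" for k y
    by (simp add: vec_eq_iff r_comp s_r)
  have rD: "r k y \<in> ?D" if "y \<in> ?D" for k y
    using that by (auto simp: corner_simplex_def r_comp s_r s_def[symmetric])
  have rDi: "r k ` ?D = ?D" for k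
  proof safe
    fix y assume "y \<in> ?D" then show "y \<in> r k ` ?D"
      by (intro image_eqI[of _ _ "r k y"]) (simp_all add: rr rD)
  qed (rule rD)
  have lhr: "linear (hr k)" for k
    unfolding hr_def by (rule linearI) (simp_all add: sadd algebra_simps)
  have ihr: "inj (hr k)" for k
  proof (rule injI)
    fix x y assume "hr k x = hr k y"
    then have "r k (r k x) = r k (r k y)" by (simp add: r_def)
    then show "x = y" by (simp add: rr)
  qed
  have r_int: "(LINT x:r k ` S|lborel. f x) = (LINT x:S|lborel. (f (r k x) :: real))" "r k ` S \<in> sets borel"
    if "S \<in> sets borel" "f \<in> borel_measurable borel" for k S f
  proof -
    obtain J where J: "J > 0"
      "\<And>c S f. S \<in> sets borel \<Longrightarrow> f \<in> borel_measurable borel \<Longrightarrow>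
         (LINT x:(\<lambda>x. c + hr k x) ` S|lborel. f x) = J * (LINT x:S|lborel. (f (c + hr k x) :: real))"
      "\<And>c S. S \<in> sets borel \<Longrightarrow> (\<lambda>x. c + hr k x) ` S \<in> sets borel"
      using set_integral_affine_image[OF lhr ihr] by blast
    note J' = J(2)[where c = "axis k 1", folded r_def] J(3)[where c = "axis k 1", folded r_def]
    have "v = J * v"
      using J'(1)[OF D(1), of "\<lambda>_. 1"] by (simp add: rDi set_integral_const_one v_def)
    then have "J = 1" using vpos by simp
    then show "(LINT x:r k ` S|lborel. f x) = (LINT x:S|lborel. f (r k x))"
      using J'(1)[OF that] by simp
    show "r k ` S \<in> sets borel" using J'(2)[OF that(1)] by simp
  qed
  have r_inv: "(LINT x:?D|lborel. f x) = (LINT x:?D|lborel. (f (r k x) :: real))"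
    if "continuous_on UNIV f" for k f
    using r_int(1)[OF D(1) bm[OF that], of k] by (simp add: rDi)
  define h :: "'n \<Rightarrow> real^'n \<Rightarrow> real^'n" where "h k y = y - (y$k / 2) *\<^sub>R axis k 1" for k y
  have h_comp: "h k y $ l = (if l = k then y$k / 2 else y $ l)" for k y l
    by (simp add: h_def axis_def)
  have s_h: "s (h k y) = s y - y$k / 2" for k y
    by (simp add: h_def sadd sax)
  have lh: "linear (h k)" for k
    unfolding h_def by (rule linearI) (simp_all add: algebra_simps add_divide_distrib)
  have ih: "inj (h k)" for k
  proof (rule injI)
    fix x y assume e: "h k x = h k y"
    show "x = y" unfolding vec_eq_iff
    proof
      fix l show "x $ l = y $ l" using arg_cong[OF e, of "\<lambda>z. z $ l"] by (simp add: h_comp split: if_splits)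
    qed
  qed
  define H where "H k = {y\<in>?D. y$k \<le> 1 - s y}" for k
  have hD: "h k ` ?D = H k" for k
  proof safe
    fix y assume "y \<in> ?D"
    then have "\<And>l. 0 \<le> y$l" "s y \<le> 1" by (auto simp: corner_simplex_def s_def)
    then show "h k y \<in> H k"
      unfolding H_def corner_simplex_def mem_Collect_eq s_def[symmetric] s_h using \<open>0 \<le> y$k\<close>
      by (simp add: h_comp) (smt (verit) field_sum_of_halves)
  next
    fix y assume y: "y \<in> H k"
    have "h k (y + (y$k) *\<^sub>R axis k 1) = y" by (simp add: vec_eq_iff h_comp axis_def)
    moreover have "y + (y$k) *\<^sub>R axis k 1 \<in> ?D"
      using y unfolding H_def corner_simplex_def mem_Collect_eq s_def[symmetric]
      by (simp add: sadd sax) (simp add: axis_def)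
    ultimately show "y \<in> h k ` ?D" by (metis image_eqI)
  qed
  \<comment> \<open>The half \<open>H k\<close> and its image under \<open>r k\<close> contribute
    equally to the integral of an invariant function. The factor of \<open>h k\<close> is found to
    be 1/2 by testing the integrand 1, and it cancels the 2 from the two halves.\<close>
  have bis: "(LINT x:?D|lborel. f x) = (LINT x:?D|lborel. f (h k x))"
    if f: "continuous_on UNIV f" and inv: "\<And>y. f (r k y) = f y" for k and f :: "real^'n \<Rightarrow> real"
  proof -
    obtain J where J: "J > 0"
      "\<And>c S f. S \<in> sets borel \<Longrightarrow> f \<in> borel_measurable borel \<Longrightarrow>
         (LINT x:(\<lambda>x. c + h k x) ` S|lborel. f x) = J * (LINT x:S|lborel. (f (c + h k x) :: real))"
      "\<And>c S. S \<in> sets borel \<Longrightarrow> (\<lambda>x. c + h k x) ` S \<in> sets borel"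
      using set_integral_affine_image[OF lh ih] by blast
    have HB: "H k \<in> sets borel" using J(3)[OF D(1), of 0] by (simp add: hD)
    have HB': "r k ` H k \<in> sets borel" by (rule r_int(2)[OF HB, of "\<lambda>_. 0"]) simp
    have un: "H k \<union> r k ` H k = ?D"
    proof safe
      fix y assume y: "y \<in> ?D" "y \<notin> r k ` H k"
      have "r k y \<notin> H k" using y(2) by (metis image_eqI rr)
      then have "1 - s y > y$k" using rD[OF y(1), of k] by (auto simp: H_def s_r r_comp)
      then show "y \<in> H k" using y(1) by (simp add: H_def)
    qed (auto simp: H_def rD)
    \<comment> \<open>The two halves overlap in the hyperplane \<open>s y + y$k = 1\<close>. Its
      normal is nonzero because its coordinate at \<open>k\<close> is 2.\<close>
    have "AE y in lborel. (\<Sum>l\<in>UNIV. axis l 1 :: real^'n) \<bullet> y + (axis k 1) \<bullet> y \<noteq> 1"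
    proof -
      have "((\<Sum>l\<in>UNIV. axis l 1 :: real^'n) + axis k 1) $ k = 2" by (simp add: axis_def)
      then have "(\<Sum>l\<in>UNIV. axis l 1 :: real^'n) + axis k 1 \<noteq> 0" by (metis zero_index zero_neq_numeral)
      from null_hyperplane_lborel[OF this, of 1] show ?thesis by (simp add: inner_add_left)
    qed
    moreover have "(\<Sum>l\<in>UNIV. axis l 1 :: real^'n) \<bullet> y + (axis k 1) \<bullet> y = s y + y$k" for y
      by (simp add: inner_sum_left inner_axis' s_def)
    ultimately have ae: "AE y in lborel. \<not> (y \<in> H k \<and> y \<in> r k ` H k)"
    proof (elim AE_mp, intro AE_I2 impI notI, elim conjE imageE)
      fix y z assume *: "(\<Sum>l\<in>UNIV. axis l 1 :: real^'n) \<bullet> y + (axis k 1) \<bullet> y \<noteq> 1" "y \<in> H k" "y = r k z" "z \<in> H k"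
        and "\<And>y. (\<Sum>l\<in>UNIV. axis l 1 :: real^'n) \<bullet> y + (axis k 1) \<bullet> y = s y + y$k"
      then have "s y + y$k \<noteq> 1" by simp
      moreover have "s y + y$k \<le> 1" using * by (simp add: H_def)
      moreover have "s y + y$k \<ge> 1" using * by (simp add: H_def s_r r_comp)
      ultimately show False by simp
    qed
    have split: "(LINT x:?D|lborel. f x) = 2 * (LINT x:H k|lborel. f x)"
      if f: "continuous_on UNIV f" and inv: "\<And>y. f (r k y) = f y" for f :: "real^'n \<Rightarrow> real"
    proof -
      have "(LINT x:?D|lborel. f x) = (LINT x:H k|lborel. f x) + (LINT x:r k ` H k|lborel. f x)"
        unfolding un[symmetric] using ae HB HB' un
        by (intro set_integral_Un_AE) (auto intro!: set_integrable_subset[OF si[OF f]])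
      then show ?thesis using r_int(1)[OF HB bm[OF f], of k] by (simp add: inv)
    qed
    have JJ: "(LINT x:H k|lborel. f x) = J * (LINT x:?D|lborel. f (h k x))"
      if f: "continuous_on UNIV f" for f :: "real^'n \<Rightarrow> real"
      using J(2)[OF D(1) bm[OF f], of 0] by (simp add: hD)
    have "v = 2 * measure lborel (H k)" "measure lborel (H k) = J * v"
      using split[of "\<lambda>_. 1"] JJ[of "\<lambda>_. 1"] unfolding set_integral_const_one v_def by simp_all
    then have "v * (2 * J - 1) = 0" by algebra
    then have "2 * J = 1" using vpos by (metis less_irrefl mult_eq_0_iff right_minus_eq)
    then show ?thesis using split[OF f inv] JJ[OF f] by simp
  qed
  \<comment> \<open>First moment of the slack, and mixed moments of the slack with a coordinate. By
    symmetry they stand for all first moments and for all off-diagonal second moments.\<close>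
  define l where "l = (LINT y:?D|lborel. 1 - s y)"
  define c where "c k = (LINT y:?D|lborel. (1 - s y) * y$k)" for k
  have f1: "(LINT y:?D|lborel. y$k) = l" for k
    using r_inv[of "\<lambda>y. y$k" k] by (simp add: r_comp l_def continuous_intros)
  have "v = (LINT y:?D|lborel. (1 - s y) + (\<Sum>k\<in>UNIV. y$k))"
    by (simp add: s_def set_integral_const_one v_def)
  also have "\<dots> = l + (\<Sum>k\<in>UNIV. (LINT y:?D|lborel. y$k))"
    unfolding l_def
    by (subst set_integral_add, auto intro!: si continuous_intros, subst set_integral_sum_fun(1), auto intro!: si continuous_intros)
  finally have lv: "(n + 1) * l = v" by (simp add: f1 n_def algebra_simps)
  then show "(LINT y:corner_simplex|lborel. y$i) = v / (n+1)"
    by (simp add: f1 n_def field_simps)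
  have off: "(LINT y:?D|lborel. y$k * y$m) = c m" if "k \<noteq> m" for k m
    using r_inv[of "\<lambda>y. y$k * y$m" k] that by (simp add: r_comp c_def continuous_intros)
  have ceq: "c k = c m" for k m
    using off[of k m] off[of m k] by (cases "k = m") (simp_all add: mult.commute)
  \<comment> \<open>Slack times \<open>y$k\<close> is invariant under \<open>r k\<close>. Pulled
    back by \<open>h k\<close> it becomes \<open>(1 - s y + y$k / 2) * (y$k / 2)\<close>, so half of
    \<open>c k\<close> equals a quarter of the diagonal moment.\<close>
  have diag: "(LINT y:?D|lborel. y$k * y$k) = 2 * c k" for k
  proof -
    have "c k = (LINT y:?D|lborel. (1 - s (h k y)) * h k y $ k)"
      unfolding c_def by (rule bis) (auto intro!: continuous_intros simp: r_comp s_r)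
    also have "\<dots> = (LINT y:?D|lborel. (1/2) * ((1 - s y) * y$k) + (1/4) * (y$k * y$k))"
      by (simp add: h_comp s_h algebra_simps)
    also have "\<dots> = (1/2) * c k + (1/4) * (LINT y:?D|lborel. y$k * y$k)"
      unfolding c_def by (subst set_integral_add) (auto intro!: si continuous_intros)
    finally show ?thesis by simp
  qed
  \<comment> \<open>The coordinates and the slack add up to 1. Multiplying this by
    \<open>y$i\<close> and integrating leaves one equation for the single unknown
    \<open>c i\<close>.\<close>
  have "y$i = (1 - s y) * y$i + (\<Sum>k\<in>UNIV. y$i * y$k)" for y
    by (simp add: s_def sum_distrib_left[symmetric] left_diff_distrib)
  then have "l = (LINT y:?D|lborel. (1 - s y) * y$i + (\<Sum>k\<in>UNIV. y$i * y$k))"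
    using f1[of i] by presburger
  also have "\<dots> = c i + (\<Sum>k\<in>UNIV. (LINT y:?D|lborel. y$i * y$k))"
    unfolding c_def
    by (subst set_integral_add, auto intro!: si continuous_intros, subst set_integral_sum_fun(1), auto intro!: si continuous_intros)
  also have "(\<Sum>k\<in>UNIV. (LINT y:?D|lborel. y$i * y$k)) = (\<Sum>k\<in>UNIV. c i + (if k = i then c i else 0))"
    by (intro sum.cong refl) (auto simp: diag off intro: ceq)
  also have "\<dots> = (n + 1) * c i"
    by (simp add: sum.distrib n_def algebra_simps)
  finally have "l = (n + 2) * c i" by (simp add: algebra_simps)
  with lv have cv: "v = (n+1)*(n+2) * c i" by simp
  have "n \<ge> 0" by (simp add: n_def)
  then have "c i = v / ((n+1)*(n+2))" using cv by (simp only: nonzero_eq_divide_eq) (simp add: mult.commute nonzero_eq_divide_eq)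
  then show "(LINT y:corner_simplex|lborel. y$i * y$j) = (if i = j then 2 else 1) * v / ((n+1)*(n+2))"
    using off[of i j] diag[of i] ceq[of i j] by (cases "i = j") simp_all
qed


text \<open>\<open>L\<close> maps the corner simplex onto the simplex with vertices \<open>c\<close>
  and \<open>w i\<close>. With the slack as a further coordinate, all second moments are
  proportional to 1 off the diagonal and 2 on it; this splits the integral into \<open>q\<close> at
  the sum of all vertices and the sum of \<open>q\<close> over the vertices.\<close>

lemma corner_simplex_quadratic:
  fixes q :: "real^'n \<Rightarrow> real^'n \<Rightarrow> real" and w :: "'n \<Rightarrow> real^'n" and c :: "real^'n"
  assumes q: "bilinear q" and sym: "\<And>x y. q x y = q y x"
  defines "v \<equiv> measure lborel (corner_simplex :: (real^'n) set)"
  defines "n \<equiv> real CARD('n)"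
  defines "L \<equiv> \<lambda>y. c + (\<Sum>i\<in>UNIV. y$i *\<^sub>R (w i - c))"
  shows "(LINT y:corner_simplex|lborel. q (L y) (L y)) =
    v / ((n+1)*(n+2)) * (q (c + sum w UNIV) (c + sum w UNIV) + q c c + (\<Sum>i\<in>UNIV. q (w i) (w i)))"
proof -
  let ?D = "corner_simplex :: (real^'n) set"
  define d where "d i = w i - c" for i :: 'n
  have n: "n \<ge> 0" by (simp add: n_def)
  have D: "?D \<in> sets borel" "bounded ?D"
    using compact_corner_simplex by (auto intro: borel_compact compact_imp_bounded)
  have si: "set_integrable lborel ?D f" if "continuous_on UNIV f" for f :: "real^'n \<Rightarrow> real"
    using set_integrable_continuous_bounded[OF D(2,1) that] .
  have qs: "q (x + y) z = q x z + q y z" "q z (x + y) = q z x + q z y"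
       "q (t *\<^sub>R x) z = t * q x z" "q z (t *\<^sub>R x) = t * q z x"
       "q (x - y) z = q x z - q y z" "q z (x - y) = q z x - q z y" for x y z t
    using q bilinear_ladd[OF q] bilinear_radd[OF q] bilinear_lmul[OF q] bilinear_rmul[OF q]
      bilinear_lsub[OF q] bilinear_rsub[OF q] by auto
  have qsum: "q (sum f A) z = (\<Sum>i\<in>A. q (f i) z)" "q z (sum f A) = (\<Sum>i\<in>A. q z (f i))" for f :: "'n \<Rightarrow> real^'n" and A z
    using q by (auto simp: bilinear_def intro!: linear_sum)
  have exp: "q (L y) (L y) = q c c + ((\<Sum>i\<in>UNIV. (2 * q c (d i)) * y$i) + (\<Sum>i\<in>UNIV. \<Sum>j\<in>UNIV. q (d i) (d j) * (y$i * y$j)))" for y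
  proof -
    let ?X = "\<Sum>i\<in>UNIV. y$i *\<^sub>R d i"
    have "q (L y) (L y) = q c c + (2 * q c ?X + q ?X ?X)"
      unfolding L_def d_def[symmetric] using sym[of ?X c] by (simp only: qs)
    also have "2 * q c ?X = (\<Sum>i\<in>UNIV. (2 * q c (d i)) * y$i)"
      by (simp only: qsum qs sum_distrib_left) (simp add: mult_ac)
    also have "q ?X ?X = (\<Sum>i\<in>UNIV. \<Sum>j\<in>UNIV. q (d i) (d j) * (y$i * y$j))"
      by (simp only: qsum qs sum_distrib_left) (subst sum.swap, simp add: mult_ac)
    finally show ?thesis .
  qed
  have i1: "(LINT y:?D|lborel. (\<Sum>i\<in>UNIV. (2 * q c (d i)) * y$i)) = (\<Sum>i\<in>UNIV. 2 * q c (d i)) * (v / (n+1))"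
  proof -
    have "(LINT y:?D|lborel. (\<Sum>i\<in>UNIV. (2 * q c (d i)) * y$i)) = (\<Sum>i\<in>UNIV. (LINT y:?D|lborel. (2 * q c (d i)) * y$i))"
      by (rule set_integral_sum_fun(1)) (intro si continuous_intros)
    then show ?thesis
      by (simp only: set_integral_mult_right corner_simplex_moments(1) v_def n_def sum_distrib_right)
  qed
  have i2: "(LINT y:?D|lborel. (\<Sum>i\<in>UNIV. \<Sum>j\<in>UNIV. q (d i) (d j) * (y$i * y$j))) =
      (\<Sum>i\<in>UNIV. \<Sum>j\<in>UNIV. q (d i) (d j) * ((if i = j then 2 else 1) * v / ((n+1)*(n+2))))"
  proof -
    have "(LINT y:?D|lborel. (\<Sum>i\<in>UNIV. \<Sum>j\<in>UNIV. q (d i) (d j) * (y$i * y$j))) =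
        (\<Sum>i\<in>UNIV. (LINT y:?D|lborel. \<Sum>j\<in>UNIV. q (d i) (d j) * (y$i * y$j)))"
      by (rule set_integral_sum_fun(1)) (intro si continuous_intros)
    also have "\<dots> = (\<Sum>i\<in>UNIV. \<Sum>j\<in>UNIV. (LINT y:?D|lborel. q (d i) (d j) * (y$i * y$j)))"
      by (intro sum.cong refl set_integral_sum_fun(1) si continuous_intros)
    finally show ?thesis
      by (simp only: set_integral_mult_right corner_simplex_moments(2) v_def n_def)
  qed
  have "(LINT y:?D|lborel. q (L y) (L y)) = (LINT y:?D|lborel. q c c) +
     ((LINT y:?D|lborel. (\<Sum>i\<in>UNIV. (2 * q c (d i)) * y$i)) + (LINT y:?D|lborel. (\<Sum>i\<in>UNIV. \<Sum>j\<in>UNIV. q (d i) (d j) * (y$i * y$j))))"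
    unfolding exp
    by (rule trans[OF set_integral_add(2)], (intro si continuous_intros)+,
        rule arg_cong2[where f = "(+)"], rule refl, rule set_integral_add(2), (intro si continuous_intros)+)
  also have "(LINT y:?D|lborel. q c c) = v * q c c"
    by (simp add: set_lebesgue_integral_def v_def)
  also note i1
  also note i2
  also have "(\<Sum>i\<in>UNIV. \<Sum>j\<in>UNIV. q (d i) (d j) * ((if i = j then 2 else 1) * v / ((n+1)*(n+2)))) =
      v / ((n+1)*(n+2)) * (q (sum d UNIV) (sum d UNIV) + (\<Sum>i\<in>UNIV. q (d i) (d i)))"
  proof -
    have "(\<Sum>j\<in>UNIV. q (d i) (d j) * ((if i = j then 2 else 1) * v / ((n+1)*(n+2)))) =
        v / ((n+1)*(n+2)) * (q (d i) (sum d UNIV) + q (d i) (d i))" for i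
    proof -
      have "(\<Sum>j\<in>UNIV. q (d i) (d j) * ((if i = j then 2 else 1) * v / ((n+1)*(n+2)))) =
        (\<Sum>j\<in>UNIV. v / ((n+1)*(n+2)) * (q (d i) (d j) + (if i = j then q (d i) (d j) else 0)))"
        by (intro sum.cong refl) auto
      also have "\<dots> = v / ((n+1)*(n+2)) * (q (d i) (sum d UNIV) + q (d i) (d i))"
        by (simp only: sum_distrib_left[symmetric] sum.distrib qsum) simp
      finally show ?thesis .
    qed
    then show ?thesis by (simp only: sum_distrib_left[symmetric] sum.distrib qsum(1)[of d UNIV "sum d UNIV"])
  qed
  also have "(\<Sum>i\<in>UNIV. 2 * q c (d i)) = 2 * q c (sum d UNIV)"
    by (simp add: qsum sum_distrib_left)
  finally have main: "(LINT y:?D|lborel. q (L y) (L y)) = v * q c c + (2 * q c (sum d UNIV) * (v / (n+1))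
     + v / ((n+1)*(n+2)) * (q (sum d UNIV) (sum d UNIV) + (\<Sum>i\<in>UNIV. q (d i) (d i))))"
    by (simp only:)
  have w: "sum w UNIV = sum d UNIV + n *\<^sub>R c" 
    by (simp add: d_def sum_subtractf n_def sum_constant_scaleR del: sum_constant)
  have ww: "(\<Sum>i\<in>UNIV. q (w i) (w i)) = (\<Sum>i\<in>UNIV. q (d i) (d i)) + 2 * q c (sum d UNIV) + n * q c c"
  proof -
    have "q (w i) (w i) = q (d i) (d i) + 2 * q c (d i) + q c c" for i
      using sym[of "w i" c] by (simp add: d_def qs)
    then show ?thesis by (simp add: sum.distrib qsum(2) sum_distrib_left n_def)
  qed
  have nz: "n + 1 \<noteq> 0" "n + 2 \<noteq> 0" using n by auto
  define k where "k = v / ((n+1)*(n+2))"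
  have k: "v = k * ((n+1)*(n+2))" "v / (n+1) = k * (n+2)" using nz by (simp_all add: k_def)
  show ?thesis
    unfolding main k_def[symmetric] w ww k(2) unfolding k(1)
    using sym[of "sum d UNIV" c] by (simp add: qs algebra_simps)
qed

text \<open>The volume factor of the affine map is absorbed into \<open>measure lborel T\<close>, so
  that no determinant appears.\<close>

lemma set_integral_simplex_quadratic:
  fixes q :: "real^'n \<Rightarrow> real^'n \<Rightarrow> real" and w :: "'n \<Rightarrow> real^'n"
  assumes q: "bilinear q" "\<And>x y. q x y = q y x"
    and ind: "independent (range (\<lambda>i. w i - c))" "inj w"
  defines "T \<equiv> convex hull (insert c (range w))"
  defines "n \<equiv> real CARD('n)"
  shows "(LINT x:T|lborel. q x x) =
    measure lborel T / ((n+1)*(n+2)) * (q (c + sum w UNIV) (c + sum w UNIV) + q c c + (\<Sum>i\<in>UNIV. q (w i) (w i)))"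
    and "measure lborel T > 0"
proof -
  define h where "h y = (\<Sum>i\<in>UNIV. y$i *\<^sub>R (w i - c))" for y :: "real^'n"
  have h: "linear h" unfolding h_def
    by (rule linearI) (simp_all add: sum.distrib scaleR_add_left scaleR_sum_right)
  have "inj h"
  proof (rule linear_injective_0[THEN iffD2, OF h], intro allI impI)
    fix y assume y: "h y = 0"
    have inj: "inj (\<lambda>i. w i - c)" using ind(2) by (auto simp: inj_def)
    let ?f = "\<lambda>i. w i - c"
    have "(\<Sum>x\<in>range ?f. (y $ inv ?f x) *\<^sub>R x) = 0"
      using y by (subst sum.reindex[OF inj]) (simp add: h_def inv_f_f[OF inj] o_def)
    then have "\<forall>x\<in>range ?f. y $ inv ?f x = 0"
      using ind(1) independentD[of "range ?f" "range ?f" "\<lambda>x. y $ inv ?f x"] by auto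
    then show "y = 0" by (simp add: vec_eq_iff inv_f_f[OF inj])
  qed
  then obtain J where J: "J > 0"
    "\<And>c S f. S \<in> sets borel \<Longrightarrow> f \<in> borel_measurable borel \<Longrightarrow>
       (LINT x:(\<lambda>x. c + h x) ` S|lborel. f x) = J * (LINT x:S|lborel. (f (c + h x) :: real))"
    using set_integral_affine_image[OF h] by metis
  have hax: "h (axis i 1) = w i - c" for i
    unfolding h_def axis_def by (simp add: if_distrib[of "\<lambda>t. t *\<^sub>R _"] cong: if_cong)
  have "(\<lambda>x. c + h x) ` corner_simplex = (+) c ` (convex hull (h ` insert 0 Basis))"
    unfolding corner_simplex_hull using convex_hull_linear_image[OF h] by (metis image_image)
  also have "h ` insert 0 Basis = insert 0 (range (\<lambda>i. w i - c))"
    by (auto simp: linear_0[OF h] Basis_vec_def hax image_iff)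
  also have "(+) c ` (convex hull (insert 0 (range (\<lambda>i. w i - c)))) = convex hull ((+) c ` insert 0 (range (\<lambda>i. w i - c)))"
    by (rule convex_hull_translation[symmetric])
  also have "(+) c ` insert 0 (range (\<lambda>i. w i - c)) = insert c (range w)"
    by (auto simp: image_iff)
  finally have T: "(\<lambda>x. c + h x) ` corner_simplex = T" unfolding T_def .
  have D: "corner_simplex \<in> sets (borel :: (real^'n) measure)"
    using compact_corner_simplex by (auto intro: borel_compact)
  have mT: "measure lborel T = J * measure lborel (corner_simplex :: (real^'n) set)"
    using J(2)[OF D, of "\<lambda>_. 1" c] by (simp only: T set_integral_const_one) simp
  then show "measure lborel T > 0" using J(1) measure_corner_simplex_pos[where 'n='n] by simp
  have cont: "continuous_on UNIV (\<lambda>x. q x x)"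
    using q(1) unfolding bilinear_conv_bounded_bilinear
    by (intro bounded_bilinear.continuous_on[of q]) (auto intro: continuous_intros)
  have "(LINT x:T|lborel. q x x) = J * (LINT y:corner_simplex|lborel. q (c + h y) (c + h y))"
    using J(2)[OF D borel_measurable_continuous_onI[OF cont], of c] unfolding T .
  then show "(LINT x:T|lborel. q x x) =
    measure lborel T / ((n+1)*(n+2)) * (q (c + sum w UNIV) (c + sum w UNIV) + q c c + (\<Sum>i\<in>UNIV. q (w i) (w i)))"
    using corner_simplex_quadratic[OF q, of c w] by (simp add: h_def mT n_def)
qed

section \<open>Determinants and covariance matrices\<close>

lemma matrix_add_rdistrib_real:
  fixes A B :: "real^'m^'k" and C :: "real^'n^'m"
  shows "(A + B) ** C = A ** C + B ** C"
  by (simp add: matrix_matrix_mult_def vec_eq_iff sum.distrib distrib_right)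

text \<open>An orthogonal change of basis turns \<open>v\<close> into a multiple of a basis vector.
  Then only one column of the identity is altered, and \<open>cramer_lemma\<close> evaluates the
  determinant.\<close>

lemma det_rank_one_update:
  fixes u v :: "real^'n"
  shows "det (mat 1 + (\<chi> i j. u$i * v$j)) = 1 + v \<bullet> u"
proof (cases "v = 0")
  case True
  then have "mat 1 + (\<chi> i j. u$i * v$j) = (mat 1 :: real^'n^'n)" by (simp add: vec_eq_iff)
  with True show ?thesis by (simp only: det_I) simp
next
  case False
  obtain k :: 'n where True by simp
  have "norm (v /\<^sub>R norm v) = 1" using False by simp
  then obtain F where F: "orthogonal_matrix F" "F *v (axis k 1) = v /\<^sub>R norm v"
    using orthogonal_matrix_exists_basis by blast
  define u' where "u' = transpose F *v u"
  have FF: "transpose F ** F = mat 1" using F(1) by (simp add: orthogonal_matrix_def)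
  have v: "v = norm v *\<^sub>R (F *v axis k 1)" using F(2) False by simp
  have "transpose F *v v = norm v *\<^sub>R (transpose F *v (F *v axis k 1))"
    by (subst v) (simp add: matrix_vector_mult_scaleR)
  also have "\<dots> = norm v *\<^sub>R axis k 1" by (simp add: matrix_vector_mul_assoc FF)
  finally have v': "transpose F *v v = norm v *\<^sub>R axis k 1" .
  have "transpose F ** (mat 1 + (\<chi> i j. u$i * v$j)) ** F
      = mat 1 + (\<chi> i j. u'$i * (transpose F *v v)$j)"
  proof -
    have "transpose F ** (\<chi> i j. u$i * v$j) ** F = (\<chi> i j. u'$i * (transpose F *v v)$j)"
      by (simp add: vec_eq_iff matrix_matrix_mult_def matrix_vector_mult_def transpose_def u'_def
          sum_distrib_left sum_distrib_right mult_ac)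
    then show ?thesis
      by (simp add: matrix_add_ldistrib matrix_add_rdistrib_real FF)
  qed
  also have "\<dots> = (\<chi> i j. if j = k then (mat 1 *v (axis k 1 + norm v *\<^sub>R u'))$i else mat 1$i$j)"
    unfolding v' matrix_vector_mul_lid by (auto simp: vec_eq_iff axis_def mat_def)
  finally have "det (transpose F ** (mat 1 + (\<chi> i j. u$i * v$j)) ** F) = (axis k 1 + norm v *\<^sub>R u')$k * det (mat 1 :: real^'n^'n)"
    by (simp only: cramer_lemma)
  moreover have "det F * det F = 1"
    using FF by (metis det_I det_mul det_transpose)
  moreover have "(axis k 1 + norm v *\<^sub>R u')$k = 1 + norm v * u'$k"
    by simp
  ultimately have "det F * det (mat 1 + (\<chi> i j. u$i * v$j)) * det F = 1 + norm v * u'$k" "det F * det F = 1"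
    by (simp_all only: det_mul det_transpose det_I mult_1_right)
  then have "det (mat 1 + (\<chi> i j. u$i * v$j)) = 1 + norm v * u'$k" by algebra
  also have "norm v * u'$k = (norm v *\<^sub>R axis k 1) \<bullet> u'"
    by (simp add: inner_axis')
  also have "\<dots> = v \<bullet> u"
    unfolding v'[symmetric] u'_def
    by (metis (no_types) F(1) dot_lmul_matrix matrix_vector_mul_assoc matrix_vector_mul_lid orthogonal_matrix_def transpose_matrix_vector)
  finally show ?thesis .
qed

text \<open>A permutation other than the identity moves at least two indices. After one factor of
  its Leibniz product is differentiated, an off-diagonal zero of the identity matrix remains, so
  only \<open>id\<close> contributes.\<close>

lemma det_has_derivative_mat_1:
  "((\<lambda>X. det (mat 1 + X)) has_derivative (\<lambda>Y. trace Y)) (at (0 :: real^'n^'n))"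
proof -
  let ?U = "UNIV :: 'n set"
  have "((\<lambda>X. \<Sum>p\<in>{p. p permutes ?U}. of_int (sign p) * (\<Prod>i\<in>?U. (mat 1 + X)$i$p i)) has_derivative
     (\<lambda>Y. \<Sum>p\<in>{p. p permutes ?U}. of_int (sign p) * (\<Sum>i\<in>?U. Y$i$p i * (\<Prod>j\<in>?U - {i}. (mat 1 + 0)$j$p j)))) (at (0 :: real^'n^'n))"
  proof (intro has_derivative_sum has_derivative_mult_right has_derivative_prod)
    fix p :: "'n \<Rightarrow> 'n" and i
    have "bounded_linear (\<lambda>X :: real^'n^'n. X$i$p i)"
      using bounded_linear_compose[OF bounded_linear_vec_nth[of "p i"] bounded_linear_vec_nth[of i]] by simp
    then have "((\<lambda>X :: real^'n^'n. (mat 1)$i$p i + X$i$p i) has_derivative (\<lambda>Y. 0 + Y$i$p i)) (at 0)"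
      by (intro has_derivative_add has_derivative_const bounded_linear_imp_has_derivative)
    then show "((\<lambda>X :: real^'n^'n. (mat 1 + X)$i$p i) has_derivative (\<lambda>Y. Y$i$p i)) (at 0)"
      by simp
  qed
  moreover have "(\<Sum>p\<in>{p. p permutes ?U}. of_int (sign p) * (\<Sum>i\<in>?U. Y$i$p i * (\<Prod>j\<in>?U - {i}. (mat 1 + 0)$j$p j))) = trace Y" (is "?l = _")
    for Y :: "real^'n^'n"
  proof -
    have "(\<Prod>j\<in>?U - {i}. (mat 1 + 0 :: real^'n^'n)$j$p j) = (if p = id then 1 else 0)" if p: "p permutes ?U" for p i
    proof (cases "p = id")
      case True then show ?thesis by (simp add: mat_def)
    next
      case False
      have "\<exists>j. j \<noteq> i \<and> p j \<noteq> j"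
      proof (rule ccontr)
        assume *: "\<not> ?thesis"
        then have "\<And>j. j \<noteq> i \<Longrightarrow> p j = j" by auto
        moreover from this have "p i = i" using permutes_inj[OF p] by (metis injD)
        ultimately have "p = id" by (metis ext id_apply)
        with False show False by simp
      qed
      then obtain j where j: "j \<noteq> i" "p j \<noteq> j" by blast
      then show ?thesis using False by (auto intro!: prod_zero bexI[of _ j] simp: mat_def)
    qed
    then have "?l = (\<Sum>p\<in>{p. p permutes ?U}. if p = id then (\<Sum>i\<in>?U. Y$i$i) else 0)"
      by (intro sum.cong refl) auto
    also have "\<dots> = trace Y" by (simp add: trace_def permutes_id finite_permutations)
    finally show ?thesis .
  qed
  ultimately show ?thesis unfolding det_def by simp
qed

text \<open>Reduces to the identity matrix by \<open>A + X = A ** (mat 1 + B ** X)\<close>.\<close>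

lemma det_has_derivative:
  fixes A B :: "real^'n^'n"
  assumes "A ** B = mat 1"
  shows "((\<lambda>X. det (A + X)) has_derivative (\<lambda>Y. det A * trace (B ** Y))) (at 0)"
proof -
  have "linear ((**) B)" 
    by (rule linearI) (simp_all add: matrix_matrix_mult_def vec_eq_iff sum.distrib distrib_left sum_distrib_left mult_ac)
  then have bl: "bounded_linear ((**) B)" by (simp add: linear_conv_bounded_linear)
  have "((\<lambda>X. det (mat 1 + B ** X)) has_derivative (\<lambda>Y. trace (B ** Y))) (at 0)"
    using diff_chain_at[OF bounded_linear_imp_has_derivative[OF bl], of "\<lambda>X. det (mat 1 + X)" trace 0] det_has_derivative_mat_1
    by (simp add: o_def linear_0[OF \<open>linear ((**) B)\<close>])
  then have "((\<lambda>X. det A * det (mat 1 + B ** X)) has_derivative (\<lambda>Y. det A * trace (B ** Y))) (at 0)"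
    by (rule has_derivative_mult_right)
  moreover have "det A * det (mat 1 + B ** X) = det (A + X)" for X
    by (simp add: det_mul[symmetric] matrix_add_ldistrib matrix_mul_assoc assms)
  ultimately show ?thesis by simp
qed

text \<open>The segment from the identity to \<open>A\<close> consists of positive definite, hence
  invertible, matrices. So the determinant cannot reach 0 on the way from 1 to
  \<open>det A\<close>.\<close>

lemma symmetric_pos_def_det_pos:
  fixes A :: "real^'n^'n"
  assumes "\<And>x. x \<noteq> 0 \<Longrightarrow> x \<bullet> (A *v x) > 0"
  shows "det A > 0"
proof (rule ccontr)
  assume "\<not> det A > 0"
  define f where "f t = det ((1 - t) *\<^sub>R mat 1 + t *\<^sub>R A)" for t :: real
  have "continuous_on {0..1} f"
    unfolding f_def det_def by (intro continuous_intros)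
  moreover have "f 0 = 1" "f 1 = det A" by (simp_all add: f_def)
  ultimately obtain t where t: "0 \<le> t" "t \<le> 1" "f t = 0"
    using IVT2'[of f 1 0 0] \<open>\<not> det A > 0\<close> by auto
  define M where "M = (1 - t) *\<^sub>R mat 1 + t *\<^sub>R A"
  have "\<not> invertible M" using t(3) by (simp add: invertible_det_nz M_def f_def)
  then obtain x where x: "x \<noteq> 0" "M *v x = 0"
    using invertible_left_inverse matrix_left_invertible_ker by blast
  have "x \<bullet> (M *v x) = (1 - t) * (x \<bullet> x) + t * (x \<bullet> (A *v x))"
    by (simp add: M_def matrix_vector_mult_add_rdistrib scaleR_matrix_vector_assoc[symmetric] inner_add_right)
  moreover have "x \<bullet> x > 0" using x by simp
  ultimately have "x \<bullet> (M *v x) > 0" using t assms[OF x(1)]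
    by (cases "t = 0") (auto intro!: add_nonneg_pos)
  with x show False by simp
qed

lemma set_integral_abs_bound:
  fixes f :: "'a::euclidean_space \<Rightarrow> real"
  assumes "set_integrable lborel T f" "T \<in> sets borel" "emeasure lborel T < \<infinity>" "\<And>x. x \<in> T \<Longrightarrow> \<bar>f x\<bar> \<le> C"
  shows "\<bar>LINT x:T|lborel. f x\<bar> \<le> C * measure lborel T"
proof -
  have "set_integrable lborel T (\<lambda>x. C)"
    using assms(2,3) unfolding set_integrable_def by (intro integrable_scaleR_left) (simp add: integrable_indicator_iff)
  have "\<bar>LINT x:T|lborel. f x\<bar> \<le> (LINT x:T|lborel. \<bar>f x\<bar>)"
    unfolding set_lebesgue_integral_def
    using integral_abs_bound[of lborel "\<lambda>x. indicator T x *\<^sub>R f x"] by (simp add: abs_mult)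
  also have "\<dots> \<le> (LINT x:T|lborel. C)"
    using assms(1,4) \<open>set_integrable lborel T (\<lambda>x. C)\<close> by (intro set_integral_mono set_integrable_abs) auto
  also have "\<dots> = C * measure lborel T"
    by (simp add: set_lebesgue_integral_def)
  finally show ?thesis .
qed

lemma integral_uniform_on:
  fixes f :: "real^'n \<Rightarrow> 'b::{banach, second_countable_topology}"
  assumes "K \<in> sets borel" "measure lborel K > 0" "f \<in> borel_measurable borel"
  shows "(LINT x|uniform_on K. f x) = (1 / measure lborel K) *\<^sub>R (LINT x:K|lborel. f x)"
proof -
  have "emeasure lborel K \<noteq> top"
    using assms(2) by (auto simp: measure_def)
  then have fin: "emeasure lborel K = ennreal (measure lborel K)"
    by (rule emeasure_eq_ennreal_measure)
  have ind: "indicator K x / ennreal (measure lborel K) = ennreal (indicator K x / measure lborel K)" for x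
    using assms(2) divide_ennreal[of 1 "measure lborel K"] by (cases "x \<in> K") simp_all
  have u: "uniform_on K = density lborel (\<lambda>x. ennreal (indicator K x / measure lborel K))"
    unfolding uniform_measure_def fin ind ..
  have "(LINT x|uniform_on K. f x) = (LINT x|lborel. (indicator K x / measure lborel K) *\<^sub>R f x)"
    unfolding u
  proof (rule integral_density)
    have "indicator K \<in> borel_measurable (lborel :: (real^'n) measure)"
      using assms(1) by (intro borel_measurable_indicator) simp
    then show "(\<lambda>x. indicator K x / measure lborel K) \<in> borel_measurable lborel"
      by (intro borel_measurable_divide borel_measurable_const)
  qed (use assms in auto)
  also have "\<dots> = (LINT x|lborel. (1 / measure lborel K) *\<^sub>R (indicator K x *\<^sub>R f x))"
    by (intro Bochner_Integration.integral_cong) auto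
  also have "\<dots> = (1 / measure lborel K) *\<^sub>R (LINT x:K|lborel. f x)"
    unfolding set_lebesgue_integral_def by (rule integral_scaleR_right)
  finally show ?thesis .
qed

lemma covariance_matrix_entry:
  fixes K :: "(real^'n) set"
  assumes K: "K \<in> sets borel" "bounded K" "measure lborel K > 0"
  shows "covariance_matrix K $ i $ j = (LINT x:K|lborel. x$i * x$j) / measure lborel K
     - (LINT x:K|lborel. x$i) / measure lborel K * ((LINT x:K|lborel. x$j) / measure lborel K)"
proof -
  have so: "self_outer x $ i $ j = x$i * x$j" for x :: "real^'n" and i j
    by (simp add: self_outer_def matrix_matrix_mult_def columnvector_def rowvector_def)
  have so': "self_outer = (\<lambda>x :: real^'n. \<chi> i j. x$i * x$j)"
    by (simp add: fun_eq_iff vec_eq_iff so)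
  have c1: "continuous_on UNIV (self_outer :: real^'n \<Rightarrow> _)"
    unfolding so' by (intro continuous_intros)
  have s1: "integrable lborel (\<lambda>x. indicator K x *\<^sub>R self_outer x)"
    using set_integrable_continuous_bounded[OF K(2,1) c1] by (simp add: set_integrable_def)
  have s2: "integrable lborel (\<lambda>x. indicator K x *\<^sub>R x)"
    using set_integrable_continuous_bounded[OF K(2,1) continuous_on_id] by (simp add: set_integrable_def)
  have e1: "(LINT x:K|lborel. self_outer x) $ i $ j = (LINT x:K|lborel. x$i * x$j)"
    unfolding set_lebesgue_integral_def
    using integral_bounded_linear[OF bounded_linear_compose[OF bounded_linear_vec_nth[of j] bounded_linear_vec_nth[of i]] s1]
    by (simp add: so)
  have e2: "(LINT x:K|lborel. x) $ i = (LINT x:K|lborel. x$i)" for i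
    unfolding set_lebesgue_integral_def
    using integral_bounded_linear[OF bounded_linear_vec_nth[of i] s2] by simp
  show ?thesis
    unfolding covariance_matrix_def
    by (simp add: integral_uniform_on[OF K(1,3)] borel_measurable_continuous_onI[OF c1] so e1 e2)
qed

section \<open>First variation\<close>

lemma hausdorff_distance_le:
  assumes "S \<noteq> {}" "T \<noteq> {}"
    and "\<And>x. x \<in> S \<Longrightarrow> \<exists>y\<in>T. dist x y \<le> d" "\<And>y. y \<in> T \<Longrightarrow> \<exists>x\<in>S. dist y x \<le> d"
  shows "hausdorff_distance S T \<le> d"
  unfolding hausdorff_distance_def
  using assms by (intro max.boundedI cSUP_least) (meson infdist_le2)+

lemma set_integral_quadratic:
  fixes M :: "real^'n^'n"
  assumes T: "T \<in> sets borel" "bounded T"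
  shows "(LINT y:T|lborel. y \<bullet> (M *v y)) = (\<Sum>i\<in>UNIV. \<Sum>j\<in>UNIV. M$i$j * (LINT y:T|lborel. y$j * y$i))"
proof -
  have si: "set_integrable lborel T f" if "continuous_on UNIV f" for f :: "real^'n \<Rightarrow> real"
    using set_integrable_continuous_bounded[OF T(2,1) that] .
  have "(LINT y:T|lborel. y \<bullet> (M *v y)) = (LINT y:T|lborel. \<Sum>i\<in>UNIV. \<Sum>j\<in>UNIV. M$i$j * (y$j * y$i))"
    by (simp add: inner_vec_def matrix_vector_mult_def sum_distrib_left mult_ac)
  also have "\<dots> = (\<Sum>i\<in>UNIV. (LINT y:T|lborel. \<Sum>j\<in>UNIV. M$i$j * (y$j * y$i)))"
    by (rule set_integral_sum_fun(1)) (intro si continuous_intros)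
  also have "\<dots> = (\<Sum>i\<in>UNIV. \<Sum>j\<in>UNIV. (LINT y:T|lborel. M$i$j * (y$j * y$i)))"
    by (intro sum.cong refl set_integral_sum_fun(1) si continuous_intros)
  finally show ?thesis by (simp only: set_integral_mult_right)
qed

lemma set_integral_inner_square_pos:
  fixes P :: "(real^'n) set"
  assumes P: "P \<in> sets borel" "bounded P" "measure lborel P > 0" and x: "x \<noteq> 0"
  shows "(LINT y:P|lborel. (x \<bullet> y - k)\<^sup>2) > 0"
proof (rule ccontr)
  assume neg: "\<not> ?thesis"
  have int: "integrable lborel (\<lambda>y. indicator P y *\<^sub>R (x \<bullet> y - k)\<^sup>2)"
    unfolding set_integrable_def[symmetric]
    by (intro set_integrable_continuous_bounded[OF P(2,1)] continuous_intros)
  have "(LINT y:P|lborel. (x \<bullet> y - k)\<^sup>2) \<ge> 0"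
    unfolding set_lebesgue_integral_def by (rule Bochner_Integration.integral_nonneg) simp
  then have "(\<integral>y. indicator P y *\<^sub>R (x \<bullet> y - k)\<^sup>2 \<partial>lborel) = 0"
    using neg unfolding set_lebesgue_integral_def by linarith
  then have "AE y in lborel. indicator P y *\<^sub>R (x \<bullet> y - k)\<^sup>2 = 0"
    using integral_nonneg_eq_0_iff_AE[OF int] by simp
  then have "AE y in lborel. y \<notin> P"
    using null_hyperplane_lborel[OF x, of k] by eventually_elim (auto simp: indicator_def split: if_splits)
  then have "measure lborel P = 0"
    using P(1) AE_iff_null_sets[of P lborel] by (simp add: measure_eq_0_null_sets)
  with P(3) show False by simp
qed

text \<open>The quadratic form of the covariance matrix is the mean of
  \<open>(x \<bullet> y)\<^sup>2\<close>, which vanishes only on a hyperplane.\<close>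

lemma covariance_matrix_pos_def:
  fixes P :: "(real^'n) set"
  assumes P: "P \<in> sets borel" "bounded P" "measure lborel P > 0"
    and mean: "\<And>i. (LINT x:P|lborel. x$i) = 0" and x: "x \<noteq> 0"
  shows "x \<bullet> (covariance_matrix P *v x) > 0"
proof -
  let ?m = "measure lborel P"
  have "x \<bullet> (covariance_matrix P *v x) = (\<Sum>i\<in>UNIV. \<Sum>j\<in>UNIV. (x$i * x$j) * (LINT y:P|lborel. y$j * y$i)) / ?m"
    by (simp add: inner_vec_def matrix_vector_mult_def covariance_matrix_entry[OF P] mean sum_distrib_left sum_divide_distrib mult_ac)
  also have "(\<Sum>i\<in>UNIV. \<Sum>j\<in>UNIV. (x$i * x$j) * (LINT y:P|lborel. y$j * y$i)) = (LINT y:P|lborel. (x \<bullet> y - 0)\<^sup>2)"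
  proof -
    have "y \<bullet> ((\<chi> i j. x$i * x$j) *v y) = (x \<bullet> y - 0)\<^sup>2" for y
      by (simp add: inner_vec_def matrix_vector_mult_def power2_eq_square sum_product sum_distrib_left mult_ac)
    then show ?thesis using set_integral_quadratic[OF P(1,2), of "\<chi> i j. x$i * x$j"] by simp
  qed
  finally show ?thesis using set_integral_inner_square_pos[OF P x, of 0] P(3) by simp
qed

text \<open>\<open>root\<close> of positive index is strictly monotone on all reals, so no sign
  condition on the determinants arises.\<close>

lemma isotropic_constant_le_iff:
  fixes K P :: "(real^'n) set"
  shows "isotropic_constant K \<le> isotropic_constant P \<longleftrightarrow>
     det (covariance_matrix K) / (measure lborel K)\<^sup>2 \<le> det (covariance_matrix P) / (measure lborel P)\<^sup>2"
  unfolding isotropic_constant_def by (rule real_root_le_iff) simp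

text \<open>\<open>K k\<close> arises from \<open>P\<close> by adding (\<open>s = 1\<close>) or
  removing (\<open>s = -1\<close>) the small set \<open>T k\<close>. It is specified through its
  integrals alone, so one proof covers gluing and cutting. Because the centroid of \<open>P\<close>
  is 0, the shift of the centroid affects the covariance matrix only to second order in the volume
  of \<open>T k\<close>; the first order is \<open>s * (\<rho> - n)\<close> from the determinant
  against \<open>2 * s\<close> from the squared volume.\<close>

lemma first_variation:
  fixes P :: "(real^'n) set" and K T :: "nat \<Rightarrow> (real^'n) set"
  assumes P: "P \<in> sets borel" "bounded P" "measure lborel P > 0"
    and mean: "\<And>i. (LINT x:P|lborel. x$i) = 0"
    and B: "covariance_matrix P ** B = mat 1" "B ** covariance_matrix P = mat 1"
    and s: "s = 1 \<or> s = (-1::real)"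
    and K: "\<And>k. K k \<in> sets borel" "\<And>k. bounded (K k)"
    and T: "\<And>k. T k \<in> sets borel" "\<And>k. T k \<subseteq> cball 0 R" "\<And>k. measure lborel (T k) > 0"
      "(\<lambda>k. measure lborel (T k)) \<longlonglongrightarrow> 0"
    and KT: "\<And>k f. continuous_on UNIV f \<Longrightarrow>
      (LINT x:K k|lborel. f x) = (LINT x:P|lborel. f x) + s * (LINT x:T k|lborel. (f x :: real))"
    and max: "\<forall>\<^sub>F k in sequentially. isotropic_constant (K k) \<le> isotropic_constant P"
    and \<rho>: "(\<lambda>k. (LINT x:T k|lborel. x \<bullet> (B *v x)) / measure lborel (T k)) \<longlonglongrightarrow> \<rho>"
  shows "s * (\<rho> - (real CARD('n) + 2)) \<le> 0"
proof -
  define A where "A = covariance_matrix P"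
  define m where "m = measure lborel P"
  define \<tau> where "\<tau> k = measure lborel (T k)" for k
  define e where "e k i = (LINT x:T k|lborel. x$i) / \<tau> k" for k i
  define E where "E k i j = (LINT x:T k|lborel. x$i * x$j) / \<tau> k" for k i j
  define \<mu> where "\<mu> k = m + s * \<tau> k" for k
  define X where "X k = covariance_matrix (K k) - A" for k
  define n where "n = real CARD('n)"
  have m: "m > 0" using P(3) by (simp add: m_def)
  have \<tau>: "\<tau> k > 0" for k using T(3) by (simp add: \<tau>_def)
  have \<tau>0: "\<tau> \<longlonglongrightarrow> 0" using T(4) by (simp add: \<tau>_def[abs_def])
  have ss: "s * s = 1" using s by auto
  have \<mu>: "measure lborel (K k) = \<mu> k" for k
    using KT[of "\<lambda>_. 1" k] by (simp add: set_integral_const_one \<mu>_def m_def \<tau>_def)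
  have \<mu>lim: "\<mu> \<longlonglongrightarrow> m"
    unfolding \<mu>_def using tendsto_add[OF tendsto_const tendsto_mult[OF tendsto_const \<tau>0]] by simp
  have detA: "det A > 0"
    unfolding A_def by (rule symmetric_pos_def_det_pos) (rule covariance_matrix_pos_def[OF P mean])
  have Tb: "bounded (T k)" for k using T(2) bounded_cball bounded_subset by blast
  have Tsi: "set_integrable lborel (T k) f" if "continuous_on UNIV f" for f :: "real^'n \<Rightarrow> real" and k
    using set_integrable_continuous_bounded[OF Tb T(1) that] .
  have Tf: "emeasure lborel (T k) < \<infinity>" for k using Tb emeasure_bounded_finite by blast
  have TR: "\<bar>x$i\<bar> \<le> R" "R \<ge> 0" if "x \<in> T k" for x i k
  proof -
    have "norm x \<le> R" using subsetD[OF T(2) that] by simp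
    then show "\<bar>x$i\<bar> \<le> R" "R \<ge> 0" using component_le_norm_cart[of x i] norm_ge_zero[of x] by linarith+
  qed
  have eR: "\<bar>e k i\<bar> \<le> R" for k i
  proof -
    have "\<bar>LINT x:T k|lborel. x$i\<bar> \<le> R * \<tau> k"
      unfolding \<tau>_def by (rule set_integral_abs_bound[OF Tsi T(1) Tf TR(1)]) (auto intro: continuous_intros)
    then show ?thesis using \<tau>[of k] by (simp add: e_def abs_div_pos[symmetric] pos_divide_le_eq)
  qed
  have ER: "\<bar>E k i j\<bar> \<le> R * R" for k i j
  proof -
    have "\<bar>LINT x:T k|lborel. x$i * x$j\<bar> \<le> R * R * \<tau> k"
      unfolding \<tau>_def
    proof (rule set_integral_abs_bound[OF Tsi T(1) Tf])
      fix x assume "x \<in> T k"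
      then show "\<bar>x$i * x$j\<bar> \<le> R * R" unfolding abs_mult using TR[of x k] by (intro mult_mono) auto
    qed (intro continuous_intros)
    then show ?thesis using \<tau>[of k] by (simp add: E_def abs_div_pos[symmetric] pos_divide_le_eq)
  qed
  have Aij: "(LINT x:P|lborel. x$i * x$j) = m * A$i$j" for i j
    using m by (simp add: A_def covariance_matrix_entry[OF P] mean m_def)
  have Xij: "X k $ i $ j = \<tau> k * (s / \<mu> k * (E k i j - A$i$j) - \<tau> k * (e k i * e k j) / (\<mu> k)\<^sup>2)"
    if "\<mu> k > 0" for k i j
  proof -
    have "covariance_matrix (K k) $ i $ j = (m * A$i$j + s * (\<tau> k * E k i j)) / \<mu> k
        - (s * (\<tau> k * e k i)) / \<mu> k * ((s * (\<tau> k * e k j)) / \<mu> k)"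
    proof -
      have c: "continuous_on UNIV (\<lambda>x :: real^'n. x$i * x$j)" "continuous_on UNIV (\<lambda>x :: real^'n. x$i)" for i j
        by (intro continuous_intros)+
      have "(LINT x:K k|lborel. x$i * x$j) = m * A$i$j + s * (\<tau> k * E k i j)"
        using \<tau>[of k] by (simp add: KT[OF c(1)] Aij E_def)
      moreover have "(LINT x:K k|lborel. x$i) = s * (\<tau> k * e k i)" for i
        using \<tau>[of k] by (simp add: KT[OF c(2)] mean e_def)
      ultimately show ?thesis
        using that by (subst covariance_matrix_entry[OF K]) (simp_all only: \<mu>)
    qed
    also have "(s * (\<tau> k * e k i)) / \<mu> k * ((s * (\<tau> k * e k j)) / \<mu> k) = \<tau> k * (\<tau> k * (e k i * e k j) / (\<mu> k)\<^sup>2)"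
      using ss by (simp add: power2_eq_square)
    also have "(m * A$i$j + s * (\<tau> k * E k i j)) / \<mu> k = A$i$j + \<tau> k * (s / \<mu> k * (E k i j - A$i$j))"
      using that by (simp add: field_simps \<mu>_def)
    finally show ?thesis by (simp add: X_def right_diff_distrib)
  qed
  have ev: "\<forall>\<^sub>F k in sequentially. \<mu> k > m / 2 \<and> \<tau> k < 1"
    using order_tendstoD(1)[OF \<mu>lim, of "m/2"] order_tendstoD(2)[OF \<tau>0, of 1] m
    by (auto intro: eventually_conj)
  define \<alpha> where "\<alpha> = (\<Sum>i\<in>UNIV. \<Sum>j\<in>UNIV. \<bar>A$i$j\<bar>)"
  \<comment> \<open>Bounds the entries of \<open>X k\<close> divided by \<open>\<tau> k\<close>,
    once \<open>\<mu> k > m / 2\<close> and \<open>\<tau> k < 1\<close>.\<close>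
  define D where "D = 2 / m * (R * R + \<alpha>) + R * R / (m/2)\<^sup>2"
  have A\<alpha>: "\<bar>A$i$j\<bar> \<le> \<alpha>" for i j
  proof -
    have "\<bar>A$i$j\<bar> \<le> (\<Sum>j\<in>UNIV. \<bar>A$i$j\<bar>)" by (rule member_le_sum) auto
    also have "\<dots> \<le> \<alpha>" unfolding \<alpha>_def by (rule member_le_sum) (auto intro: sum_nonneg)
    finally show ?thesis .
  qed
  have Xb: "norm (X k) \<le> (n * n * D) * \<tau> k" if k: "\<mu> k > m / 2" "\<tau> k < 1" for k
  proof -
    have \<mu>k: "\<mu> k > 0" using k m by linarith
    have "\<bar>X k $ i $ j\<bar> \<le> \<tau> k * D" for i j
    proof -
      have "\<bar>s / \<mu> k * (E k i j - A$i$j)\<bar> \<le> 2 / m * (R * R + \<alpha>)"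
        unfolding abs_mult
      proof (rule mult_mono)
        have "\<bar>s\<bar> = 1" using s by auto
        then show "\<bar>s / \<mu> k\<bar> \<le> 2 / m" using k m \<mu>k by (simp add: field_simps)
        show "\<bar>E k i j - A$i$j\<bar> \<le> R * R + \<alpha>" using ER[of k i j] A\<alpha>[of i j] by linarith
      qed (use m in auto)
      moreover have "\<bar>\<tau> k * (e k i * e k j) / (\<mu> k)\<^sup>2\<bar> \<le> R * R / (m/2)\<^sup>2"
      proof -
        have "R \<ge> 0" using eR[of k i] by linarith
        have "\<bar>\<tau> k * (e k i * e k j)\<bar> \<le> 1 * (R * R)"
          unfolding abs_mult using k(2) \<tau>[of k] eR \<open>R \<ge> 0\<close> by (intro mult_mono) auto
        moreover have "(m/2)\<^sup>2 \<le> (\<mu> k)\<^sup>2" using k m by (intro power_mono) auto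
        ultimately show ?thesis using m \<open>R \<ge> 0\<close> \<mu>k unfolding abs_divide
          by (intro frac_le) auto
      qed
      ultimately have "\<bar>s / \<mu> k * (E k i j - A$i$j) - \<tau> k * (e k i * e k j) / (\<mu> k)\<^sup>2\<bar> \<le> D"
        unfolding D_def by linarith
      then show ?thesis unfolding Xij[OF \<mu>k] abs_mult using \<tau>[of k] by (simp add: mult_left_mono)
    qed
    then have "(\<Sum>i\<in>UNIV. norm (X k $ i)) \<le> (\<Sum>i\<in>(UNIV::'n set). n * (\<tau> k * D))"
    proof (intro sum_mono)
      fix i
      assume "\<And>i j. \<bar>X k $ i $ j\<bar> \<le> \<tau> k * D"
      then have "(\<Sum>j\<in>UNIV. \<bar>X k $ i $ j\<bar>) \<le> (\<Sum>j\<in>(UNIV::'n set). \<tau> k * D)" by (intro sum_mono)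
      then show "norm (X k $ i) \<le> n * (\<tau> k * D)"
        using norm_le_l1_cart[of "X k $ i"] by (simp add: n_def)
    qed
    moreover have "norm (X k) \<le> (\<Sum>i\<in>UNIV. norm (X k $ i))"
      unfolding norm_vec_def[of "X k"] by (rule L2_set_le_sum) simp
    ultimately show ?thesis by (simp add: n_def mult_ac)
  qed
  have Xb': "\<forall>\<^sub>F k in sequentially. norm (X k) \<le> (n * n * D) * \<tau> k"
    using ev by eventually_elim (rule Xb, auto)
  have X0: "X \<longlonglongrightarrow> 0"
  proof (rule Lim_null_comparison[OF Xb'])
    show "(\<lambda>k. (n * n * D) * \<tau> k) \<longlonglongrightarrow> 0" using tendsto_mult_right_zero[OF \<tau>0] .
  qed
  define r where "r k = det (A + X k) - det A - det A * trace (B ** X k)" for k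
  have der: "((\<lambda>X. det (A + X)) has_derivative (\<lambda>Y. det A * trace (B ** Y))) (at 0)"
    by (rule det_has_derivative) (simp add: A_def B)
  have r0: "(\<lambda>k. r k / \<tau> k) \<longlonglongrightarrow> 0"
  proof (rule tendstoI)
    fix \<epsilon> :: real assume \<epsilon>: "\<epsilon> > 0"
    \<comment> \<open>The summand 1 makes \<open>C\<close> positive, since \<open>\<epsilon>\<close>
      is divided by it below.\<close>
    define C where "C = \<bar>n * n * D\<bar> + 1"
    have C: "C > 0" "n * n * D \<le> C" by (auto simp: C_def)
    from der[unfolded has_derivative_at_alt] \<epsilon> C obtain d where d: "d > 0"
      "\<And>Y. norm (Y - 0) < d \<Longrightarrow> norm (det (A + Y) - det (A + 0) - det A * trace (B ** (Y - 0))) \<le> (\<epsilon> / (2 * C)) * norm (Y - 0)"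
      by (metis divide_pos_pos mult_pos_pos zero_less_numeral)
    have "\<forall>\<^sub>F k in sequentially. norm (X k) < d"
      using order_tendstoD(2)[OF tendsto_norm_zero[OF X0] d(1)] .
    then show "\<forall>\<^sub>F k in sequentially. dist (r k / \<tau> k) 0 < \<epsilon>"
      using Xb'
    proof eventually_elim
      case (elim k)
      have "\<bar>r k\<bar> \<le> (\<epsilon> / (2 * C)) * norm (X k)" using d(2)[of "X k"] elim by (simp add: r_def)
      also have "\<dots> \<le> (\<epsilon> / (2 * C)) * (C * \<tau> k)"
        using elim(2) C \<epsilon> \<tau>[of k] by (intro mult_left_mono) (auto intro: order_trans mult_right_mono)
      also have "\<dots> = \<epsilon> / 2 * \<tau> k" using C by simp
      also have "\<dots> < \<epsilon> * \<tau> k" using \<epsilon> \<tau>[of k] by simp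
      finally show ?case using \<tau>[of k] by (simp add: abs_div_pos[symmetric] pos_divide_less_eq)
    qed
  qed
  define q where "q k = (LINT x:T k|lborel. x \<bullet> (B *v x)) / \<tau> k" for k
  have qE: "q k = (\<Sum>i\<in>UNIV. \<Sum>j\<in>UNIV. B$i$j * E k j i)" for k
    unfolding q_def E_def by (simp add: set_integral_quadratic[OF T(1) Tb] sum_divide_distrib)
  have BA: "(\<Sum>i\<in>UNIV. \<Sum>j\<in>UNIV. B$i$j * A$j$i) = n"
  proof -
    have "trace (B ** A) = n" using B(2) by (simp add: A_def n_def trace_I)
    then show ?thesis by (simp add: trace_def matrix_matrix_mult_def)
  qed
  define g where "g k = (\<Sum>i\<in>UNIV. \<Sum>j\<in>UNIV. B$i$j * (e k j * e k i))" for k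
  define \<beta> where "\<beta> = (\<Sum>i\<in>UNIV. \<Sum>j\<in>UNIV. \<bar>B$i$j\<bar> * (R * R))"
  have gb: "\<bar>g k\<bar> \<le> \<beta>" for k
    unfolding g_def \<beta>_def
  proof (intro order_trans[OF sum_abs] sum_mono)
    fix i j
    have "R \<ge> 0" using eR[of k i] by linarith
    then show "\<bar>B$i$j * (e k j * e k i)\<bar> \<le> \<bar>B$i$j\<bar> * (R * R)"
      unfolding abs_mult using eR by (intro mult_mono) auto
  qed
  have tr: "trace (B ** X k) / \<tau> k = s / \<mu> k * (q k - n) - \<tau> k * g k / (\<mu> k)\<^sup>2" if "\<mu> k > 0" for k
  proof -
    have "trace (B ** X k) = (\<Sum>i\<in>UNIV. \<Sum>j\<in>UNIV. B$i$j * X k $ j $ i)"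
      by (simp add: trace_def matrix_matrix_mult_def)
    also have "\<dots> = (\<Sum>i\<in>UNIV. \<Sum>j\<in>UNIV. \<tau> k * (s / \<mu> k * (B$i$j * E k j i - B$i$j * A$j$i) - \<tau> k / (\<mu> k)\<^sup>2 * (B$i$j * (e k j * e k i))))"
      by (intro sum.cong refl) (simp add: Xij[OF that] algebra_simps)
    also have "\<dots> = \<tau> k * (s / \<mu> k * (q k - n) - \<tau> k / (\<mu> k)\<^sup>2 * g k)"
      by (simp only: sum_distrib_left[symmetric] sum_subtractf qE BA g_def)
    finally show ?thesis using \<tau>[of k] by simp
  qed
  have lim1: "(\<lambda>k. s / \<mu> k * (q k - n) - \<tau> k * g k / (\<mu> k)\<^sup>2) \<longlonglongrightarrow> s / m * (\<rho> - n) - 0 / m\<^sup>2"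
  proof -
    have "q \<longlonglongrightarrow> \<rho>" using \<rho> by (simp add: q_def[abs_def] \<tau>_def)
    moreover have "(\<lambda>k. \<tau> k * g k) \<longlonglongrightarrow> 0"
    proof (rule Lim_null_comparison)
      show "\<forall>\<^sub>F k in sequentially. norm (\<tau> k * g k) \<le> \<beta> * \<tau> k"
        using gb \<tau> by (intro always_eventually allI) (simp add: abs_mult mult.commute less_imp_le mult_left_mono)
      show "(\<lambda>k. \<beta> * \<tau> k) \<longlonglongrightarrow> 0" using tendsto_mult_right_zero[OF \<tau>0] .
    qed
    ultimately show ?thesis using m \<mu>lim by (intro tendsto_intros) auto
  qed
  have lim2: "(\<lambda>k. (det (A + X k) - det A) / \<tau> k) \<longlonglongrightarrow> det A * (s / m * (\<rho> - n))"
  proof -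
    have "(\<lambda>k. det A * (s / \<mu> k * (q k - n) - \<tau> k * g k / (\<mu> k)\<^sup>2) + r k / \<tau> k) \<longlonglongrightarrow> det A * (s / m * (\<rho> - n)) + 0"
      using lim1 r0 by (intro tendsto_add tendsto_mult tendsto_const) auto
    moreover have "\<forall>\<^sub>F k in sequentially. det A * (s / \<mu> k * (q k - n) - \<tau> k * g k / (\<mu> k)\<^sup>2) + r k / \<tau> k = (det (A + X k) - det A) / \<tau> k"
      using ev
    proof eventually_elim
      case (elim k)
      then have "\<mu> k > 0" using m by linarith
      then show ?case unfolding tr[OF \<open>\<mu> k > 0\<close>, symmetric] using \<tau>[of k] by (simp add: r_def field_simps)
    qed
    ultimately show ?thesis by (simp add: tendsto_cong)
  qed
  have "(\<lambda>k. (det (A + X k) - det A) / \<tau> k * m\<^sup>2) \<longlonglongrightarrow> det A * (s / m * (\<rho> - n)) * m\<^sup>2"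
    by (intro tendsto_mult lim2 tendsto_const)
  moreover have "(\<lambda>k. det A * (2 * m * s + \<tau> k)) \<longlonglongrightarrow> det A * (2 * m * s + 0)"
    by (intro tendsto_intros \<tau>0)
  \<comment> \<open>The maximality inequality with denominators cleared and divided by
    \<open>\<tau> k\<close>. The square of \<open>\<mu> k\<close> exceeds that of \<open>m\<close>
    by \<open>\<tau> k * (2 * m * s + \<tau> k)\<close>.\<close>
  moreover have "\<forall>\<^sub>F k in sequentially. (det (A + X k) - det A) / \<tau> k * m\<^sup>2 \<le> det A * (2 * m * s + \<tau> k)"
    using ev max
  proof eventually_elim
    case (elim k)
    have \<mu>k: "\<mu> k > 0" using elim m by linarith
    have "det (A + X k) / (\<mu> k)\<^sup>2 \<le> det A / m\<^sup>2"
      using elim(2) unfolding isotropic_constant_le_iff by (simp add: \<mu> m_def[symmetric] X_def A_def)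
    then have "det (A + X k) * m\<^sup>2 \<le> det A * (\<mu> k)\<^sup>2"
      using \<mu>k m by (simp add: divide_simps split: if_splits)
    also have "(\<mu> k)\<^sup>2 = m\<^sup>2 + \<tau> k * (2 * m * s + \<tau> k)"
      using ss by (simp add: \<mu>_def power2_eq_square algebra_simps)
    finally have "(det (A + X k) - det A) * m\<^sup>2 \<le> \<tau> k * (det A * (2 * m * s + \<tau> k))"
      by (simp add: algebra_simps)
    then show ?case using \<tau>[of k] by (simp add: field_simps)
  qed
  ultimately have "det A * (s / m * (\<rho> - n)) * m\<^sup>2 \<le> det A * (2 * m * s + 0)"
    by (intro tendsto_le[OF sequentially_bot])
  moreover have "det A * (s / m * (\<rho> - n)) * m\<^sup>2 = (det A * m) * (s * (\<rho> - n))"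
    using m by (simp add: power2_eq_square)
  ultimately have "(det A * m) * (s * (\<rho> - (n + 2))) \<le> 0"
    by (simp add: algebra_simps)
  moreover have "0 < det A * m" using detA m by simp
  ultimately show ?thesis 
    unfolding n_def[symmetric] using mult_le_cancel_left_pos[of "det A * m" "s * (\<rho> - (n + 2))" 0] by simp
qed

section \<open>Second variation under shears\<close>

definition outer :: "real^'n \<Rightarrow> real^'n \<Rightarrow> real^'n^'n" where
  "outer a b = (\<chi> i j. a$i * b$j)"

lemma outer_matrix_mult: "outer a b ** C = outer a (transpose C *v b)"
  by (simp add: vec_eq_iff outer_def matrix_matrix_mult_def matrix_vector_mult_def transpose_def sum_distrib_left mult_ac)

lemma matrix_mult_outer: "C ** outer a b = outer (C *v a) b"
  by (simp add: vec_eq_iff outer_def matrix_matrix_mult_def matrix_vector_mult_def sum_distrib_left sum_distrib_right mult_ac)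

lemma outer_matrix_vector_mult: "outer a b *v x = (b \<bullet> x) *\<^sub>R a"
  by (simp add: vec_eq_iff outer_def matrix_vector_mult_def inner_vec_def sum_distrib_left sum_distrib_right mult_ac)

text \<open>The matrix on the left is \<open>M (A + s u u\<^sup>T) M\<^sup>T\<close> with \<open>M = I + t u \<eta>\<^sup>T\<close>.\<close>

lemma det_shear_conjugate:
  fixes A B :: "real^'n^'n" and u \<eta> :: "real^'n"
  assumes AB: "A ** B = mat 1" and sym: "transpose A = A" and nz: "1 + t * (\<eta> \<bullet> u) \<noteq> 0"
  shows "det (\<chi> i j. A$i$j + t * (u$i * (A *v \<eta>)$j + (A *v \<eta>)$i * u$j) + t\<^sup>2 * (\<eta> \<bullet> (A *v \<eta>) + g) * (u$i * u$j))
    = det A * ((1 + t * (\<eta> \<bullet> u))\<^sup>2 + t\<^sup>2 * g * (u \<bullet> (B *v u)))"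
proof -
  define \<delta> where "\<delta> = \<eta> \<bullet> u"
  define d where "d = 1 + t * \<delta>"
  have d: "d \<noteq> 0" using nz by (simp add: d_def \<delta>_def)
  \<comment> \<open>\<open>M\<close> maps \<open>u\<close> to \<open>d *\<^sub>R u\<close>, so
    conjugation multiplies the rank-one term by the square of \<open>d\<close>. This
    \<open>s\<close> makes the result carry exactly the coefficient
    \<open>t\<^sup>2 * g\<close>.\<close>
  define s where "s = t\<^sup>2 * g / d\<^sup>2"
  have sd: "t\<^sup>2 * g = s * d\<^sup>2" using d by (simp add: s_def)
  define c where "c = A *v \<eta>"
  define A' where "A' = A + outer (s *\<^sub>R u) u"
  define M where "M = mat 1 + outer (t *\<^sub>R u) \<eta>"
  have "transpose A' = A'"
    unfolding A'_def using sym by (simp add: vec_eq_iff transpose_def outer_def mult_ac)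
  moreover have A'\<eta>: "A' *v \<eta> = c + (s * \<delta>) *\<^sub>R u"
    by (simp add: A'_def matrix_vector_mult_add_rdistrib outer_matrix_vector_mult c_def \<delta>_def inner_commute mult.commute)
  ultimately have MA: "M ** A' = A' + outer (t *\<^sub>R u) (c + (s * \<delta>) *\<^sub>R u)"
    by (simp add: M_def matrix_add_rdistrib_real outer_matrix_mult)
  have tM: "transpose M = mat 1 + outer \<eta> (t *\<^sub>R u)"
    unfolding M_def by (simp add: vec_eq_iff transpose_def outer_def mat_def mult_ac)
  have "M ** A' ** transpose M = A' + outer (t *\<^sub>R u) (c + (s * \<delta>) *\<^sub>R u)
      + outer (c + (s * \<delta>) *\<^sub>R u + (\<eta> \<bullet> (c + (s * \<delta>) *\<^sub>R u)) *\<^sub>R (t *\<^sub>R u)) (t *\<^sub>R u)"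
    unfolding MA tM matrix_add_ldistrib matrix_mult_outer
    by (simp add: matrix_vector_mult_add_rdistrib outer_matrix_vector_mult A'\<eta> inner_commute)
  also have "\<dots> = (\<chi> i j. A$i$j + t * (u$i * c$j + c$i * u$j) + t\<^sup>2 * (\<eta> \<bullet> c + g) * (u$i * u$j))"
  proof -
    have e: "\<eta> \<bullet> (c + (s * \<delta>) *\<^sub>R u) = \<eta> \<bullet> c + s * \<delta> * \<delta>" by (simp add: inner_add_right \<delta>_def)
    have dd: "d\<^sup>2 = 1 + 2 * t * \<delta> + t\<^sup>2 * \<delta>\<^sup>2" by (simp add: d_def power2_eq_square algebra_simps)
    show ?thesis unfolding e
      by (simp add: vec_eq_iff A'_def outer_def distrib_left sd dd) (simp add: algebra_simps power2_eq_square)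
  qed
  finally have "det (\<chi> i j. A$i$j + t * (u$i * c$j + c$i * u$j) + t\<^sup>2 * (\<eta> \<bullet> c + g) * (u$i * u$j))
      = det M * det A' * det M"
    by (metis det_mul det_transpose)
  moreover have "det M = d"
    unfolding M_def outer_def det_rank_one_update by (simp add: d_def \<delta>_def)
  moreover have "det A' = det A * (1 + s * (u \<bullet> (B *v u)))"
  proof -
    have "A' = A ** (mat 1 + outer (s *\<^sub>R (B *v u)) u)"
      by (simp add: A'_def matrix_add_ldistrib matrix_mult_outer matrix_vector_mult_scaleR matrix_vector_mul_assoc AB)
    then show ?thesis
      unfolding outer_def by (simp only: det_mul det_rank_one_update) simp
  qed
  ultimately show ?thesis unfolding c_def[symmetric] \<delta>_def[symmetric] d_def[symmetric] sd
    by (simp add: algebra_simps power2_eq_square)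
qed

text \<open>The volume of \<open>K t\<close> is constant and its covariance matrix is quadratic in
  \<open>t\<close>. With \<open>\<eta>\<close> the coefficients of the least-squares affine
  approximation of \<open>\<beta>\<close> on \<open>P\<close> and \<open>g\<close> the mean square
  of its error, the determinant is \<open>det A\<close> times \<open>(1 + t * (\<eta> \<bullet>
  u))\<^sup>2 + t\<^sup>2 * g * (u \<bullet> (B *v u))\<close>. If \<open>g\<close> were positive,
  one sign of \<open>t\<close> would increase it, so the error vanishes almost everywhere.\<close>

lemma second_variation:
  fixes P :: "(real^'n) set" and K :: "real \<Rightarrow> (real^'n) set" and \<beta> :: "real^'n \<Rightarrow> real"
  assumes P: "P \<in> sets borel" "bounded P" "measure lborel P > 0"
    and mean: "\<And>i. (LINT x:P|lborel. x$i) = 0"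
    and \<beta>: "\<beta> \<in> borel_measurable borel" "\<And>x. \<bar>\<beta> x\<bar> \<le> 1" and u: "u \<noteq> 0" and t0: "t0 > 0"
    and K: "\<And>t. \<bar>t\<bar> < t0 \<Longrightarrow> K t \<in> sets borel" "\<And>t. \<bar>t\<bar> < t0 \<Longrightarrow> bounded (K t)"
    and KP: "\<And>t f. \<bar>t\<bar> < t0 \<Longrightarrow> continuous_on UNIV f \<Longrightarrow>
      (LINT x:K t|lborel. f x) = (LINT x:P|lborel. (f (x + (t * \<beta> x) *\<^sub>R u) :: real))"
    and max: "\<And>t. \<bar>t\<bar> < t0 \<Longrightarrow> isotropic_constant (K t) \<le> isotropic_constant P"
  shows "\<exists>\<eta> k. AE x in lborel. x \<in> P \<longrightarrow> \<beta> x = \<eta> \<bullet> x + k"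
proof -
  define A where "A = covariance_matrix P"
  define m where "m = measure lborel P"
  have m: "m > 0" using P(3) by (simp add: m_def)
  have pd: "x \<noteq> 0 \<Longrightarrow> x \<bullet> (A *v x) > 0" for x
    unfolding A_def by (rule covariance_matrix_pos_def[OF P mean])
  then have detA: "det A > 0" by (rule symmetric_pos_def_det_pos)
  then obtain B where B: "A ** B = mat 1" "B ** A = mat 1"
    using invertible_det_nz[of A] by (auto simp: invertible_def)
  have Bpd: "x \<bullet> (B *v x) > 0" if "x \<noteq> 0" for x
  proof -
    have AB: "A *v (B *v x) = x" by (simp add: matrix_vector_mul_assoc B)
    then have "B *v x \<noteq> 0" using that by auto
    from pd[OF this] show ?thesis by (simp add: AB inner_commute)
  qed
  have Aij: "(LINT x:P|lborel. x$i * x$j) = m * A$i$j" for i j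
    using m by (simp add: A_def covariance_matrix_entry[OF P] mean m_def)
  have sym: "transpose A = A"
    by (simp add: vec_eq_iff transpose_def A_def covariance_matrix_entry[OF P] mean mult.commute)
  have si: "set_integrable lborel P f" if "continuous_on UNIV f" for f :: "real^'n \<Rightarrow> real"
    using set_integrable_continuous_bounded[OF P(2,1) that] .
  have si1: "set_integrable lborel P (\<lambda>x. \<beta> x * f x)" if f: "set_integrable lborel P f" "f \<in> borel_measurable borel" for f :: "real^'n \<Rightarrow> real"
  proof (rule set_integrable_bound[OF f(1)])
    show "set_borel_measurable lborel P (\<lambda>x. \<beta> x * f x)"
      unfolding set_borel_measurable_def using P(1) \<beta>(1) f(2) by simp
    have "\<bar>\<beta> x * f x\<bar> \<le> \<bar>f x\<bar>" for x
      using mult_right_mono[OF \<beta>(2)[of x], of "\<bar>f x\<bar>"] by (simp add: abs_mult)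
    then show "AE x in lborel. x \<in> P \<longrightarrow> norm (\<beta> x * f x) \<le> norm (f x)" by simp
  qed
  have bm: "f \<in> borel_measurable borel" if "continuous_on UNIV f" for f :: "real^'n \<Rightarrow> real"
    using that by (rule borel_measurable_continuous_onI)
  have cn: "continuous_on UNIV (\<lambda>x :: real^'n. x$i)" for i by (intro continuous_intros)
  have s\<beta>: "set_integrable lborel P \<beta>" using si1[of "\<lambda>_. 1"] by (simp add: si)
  have s\<beta>x: "set_integrable lborel P (\<lambda>x. \<beta> x * x$i)" for i by (rule si1[OF si[OF cn] bm[OF cn]])
  have s\<beta>\<beta>: "set_integrable lborel P (\<lambda>x. \<beta> x * \<beta> x)" by (rule si1[OF s\<beta> \<beta>(1)])
  have sx: "set_integrable lborel P (\<lambda>x. x$i)" "set_integrable lborel P (\<lambda>x. x$i * x$j)" for i j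
    by (intro si continuous_intros)+
  define b0 where "b0 = (LINT x:P|lborel. \<beta> x) / m"
  define b2 where "b2 = (LINT x:P|lborel. \<beta> x * \<beta> x) / m"
  define c where "c = (\<chi> i. (LINT x:P|lborel. \<beta> x * x$i) / m)"
  have ib: "(LINT x:P|lborel. \<beta> x) = m * b0" "(LINT x:P|lborel. \<beta> x * \<beta> x) = m * b2"
    "(LINT x:P|lborel. \<beta> x * x$i) = m * c$i" for i
    using m by (simp_all add: b0_def b2_def c_def)
  define \<eta> where "\<eta> = B *v c"
  have A\<eta>: "A *v \<eta> = c" by (simp add: \<eta>_def matrix_vector_mul_assoc B)
  define g where "g = b2 - b0\<^sup>2 - \<eta> \<bullet> c"
  have mK: "measure lborel (K t) = m" if "\<bar>t\<bar> < t0" for t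
    using KP[OF that, of "\<lambda>_. 1"] by (simp add: set_integral_const_one m_def)
  have cov: "covariance_matrix (K t) =
     (\<chi> i j. A$i$j + t * (u$i * (A *v \<eta>)$j + (A *v \<eta>)$i * u$j) + t\<^sup>2 * (\<eta> \<bullet> (A *v \<eta>) + g) * (u$i * u$j))"
    if t: "\<bar>t\<bar> < t0" for t
  proof -
    have "covariance_matrix (K t) $ i $ j = A$i$j + t * (u$i * c$j + c$i * u$j) + t\<^sup>2 * (b2 - b0\<^sup>2) * (u$i * u$j)" for i j
    proof -
      have f1: "(LINT x:K t|lborel. x$i) = m * (t * b0 * u$i)" for i
      proof -
        have "(LINT x:K t|lborel. x$i) = (LINT x:P|lborel. x$i + (t * u$i) * \<beta> x)"
          using KP[OF t cn] by (simp add: mult_ac)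
        also have "\<dots> = (LINT x:P|lborel. x$i) + (LINT x:P|lborel. (t * u$i) * \<beta> x)"
          by (rule set_integral_add(2)) (intro sx set_integrable_mult_right s\<beta>)+
        finally show ?thesis by (simp add: mean ib)
      qed
      have c2: "continuous_on UNIV (\<lambda>x :: real^'n. x$i * x$j)" by (intro continuous_intros)
      have "(LINT x:K t|lborel. x$i * x$j) = (LINT x:P|lborel. x$i * x$j + ((t * u$j) * (\<beta> x * x$i) + ((t * u$i) * (\<beta> x * x$j) + (t\<^sup>2 * u$i * u$j) * (\<beta> x * \<beta> x))))"
        unfolding KP[OF t c2] by (simp add: algebra_simps power2_eq_square)
      also have "\<dots> = (LINT x:P|lborel. x$i * x$j) + ((LINT x:P|lborel. (t * u$j) * (\<beta> x * x$i)) + ((LINT x:P|lborel. (t * u$i) * (\<beta> x * x$j)) + (LINT x:P|lborel. (t\<^sup>2 * u$i * u$j) * (\<beta> x * \<beta> x))))"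
        using sx(2)[of i j] s\<beta>x[of i] s\<beta>x[of j] s\<beta>\<beta>
        by (simp only: set_integral_add set_integrable_mult_right)
      also have "\<dots> = m * (A$i$j + t * (u$i * c$j + c$i * u$j) + t\<^sup>2 * b2 * (u$i * u$j))"
        by (simp only: set_integral_mult_right Aij ib) (simp add: algebra_simps)
      finally have f2: "(LINT x:K t|lborel. x$i * x$j) = m * (A$i$j + t * (u$i * c$j + c$i * u$j) + t\<^sup>2 * b2 * (u$i * u$j))" .
      show ?thesis
      proof (subst covariance_matrix_entry[OF K[OF t]])
        have e: "m * x / m = x" for x using m by simp
        show "(LINT x:K t|lborel. x$i * x$j) / measure lborel (K t) - (LINT x:K t|lborel. x$i) / measure lborel (K t) * ((LINT x:K t|lborel. x$j) / measure lborel (K t))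
          = A$i$j + t * (u$i * c$j + c$i * u$j) + t\<^sup>2 * (b2 - b0\<^sup>2) * (u$i * u$j)"
          by (simp only: f1 f2 mK[OF t] e) (simp add: power2_eq_square algebra_simps)
      qed (use m mK[OF t] in simp)
    qed
    then show ?thesis unfolding A\<eta> by (simp add: vec_eq_iff g_def)
  qed
  define L where "L x = \<eta> \<bullet> x + b0" for x
  have Lsum: "L x = (\<Sum>i\<in>UNIV. \<eta>$i * x$i) + b0" for x by (simp add: L_def inner_vec_def)
  have sL: "set_integrable lborel P L" "set_integrable lborel P (\<lambda>x. L x * L x)" "set_integrable lborel P (\<lambda>x. \<beta> x * L x)" "L \<in> borel_measurable borel"
  proof -
    have cL: "continuous_on UNIV L" unfolding L_def by (intro continuous_intros)
    then show "set_integrable lborel P L" "L \<in> borel_measurable borel" by (auto intro: si bm)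
    then show "set_integrable lborel P (\<lambda>x. \<beta> x * L x)" by (rule si1)
    show "set_integrable lborel P (\<lambda>x. L x * L x)" by (intro si continuous_intros cL)
  qed
  have iL: "(LINT x:P|lborel. \<beta> x * L x) = m * (\<eta> \<bullet> c + b0\<^sup>2)"
  proof -
    have "(LINT x:P|lborel. \<beta> x * L x) = (LINT x:P|lborel. (\<Sum>i\<in>UNIV. \<eta>$i * (\<beta> x * x$i)) + b0 * \<beta> x)"
      by (simp add: Lsum algebra_simps sum_distrib_left)
    also have "\<dots> = (LINT x:P|lborel. \<Sum>i\<in>UNIV. \<eta>$i * (\<beta> x * x$i)) + (LINT x:P|lborel. b0 * \<beta> x)"
      by (rule set_integral_add(2)) (intro set_integral_sum_fun(2) set_integrable_mult_right s\<beta>x s\<beta>)+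
    also have "(LINT x:P|lborel. \<Sum>i\<in>UNIV. \<eta>$i * (\<beta> x * x$i)) = (\<Sum>i\<in>UNIV. (LINT x:P|lborel. \<eta>$i * (\<beta> x * x$i)))"
      by (rule set_integral_sum_fun(1)) (intro set_integrable_mult_right s\<beta>x)
    finally show ?thesis
      by (simp only: set_integral_mult_right ib) (simp add: inner_vec_def power2_eq_square algebra_simps sum_distrib_left)
  qed
  have iLL: "(LINT x:P|lborel. L x * L x) = m * (\<eta> \<bullet> c + b0\<^sup>2)"
  proof -
    have "(LINT x:P|lborel. L x * L x) = (LINT x:P|lborel. x \<bullet> (outer \<eta> \<eta> *v x) + ((\<Sum>i\<in>UNIV. (2 * b0 * \<eta>$i) * x$i) + b0 * b0))"
    proof -
      have "L x * L x = x \<bullet> (outer \<eta> \<eta> *v x) + ((\<Sum>i\<in>UNIV. (2 * b0 * \<eta>$i) * x$i) + b0 * b0)" for x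
      proof -
        have "(\<Sum>i\<in>UNIV. (2 * b0 * \<eta>$i) * x$i) = 2 * b0 * (\<eta> \<bullet> x)"
          by (simp add: inner_vec_def sum_distrib_left mult_ac)
        then show ?thesis by (simp add: L_def outer_matrix_vector_mult inner_commute algebra_simps)
      qed
      then show ?thesis by simp
    qed
    also have "\<dots> = (LINT x:P|lborel. x \<bullet> (outer \<eta> \<eta> *v x)) + ((LINT x:P|lborel. \<Sum>i\<in>UNIV. (2 * b0 * \<eta>$i) * x$i) + (LINT x:P|lborel. b0 * b0))"
      by (rule trans[OF set_integral_add(2)], (intro si continuous_intros linear_continuous_on_compose[OF continuous_on_id] matrix_vector_mul_linear)+,
        rule arg_cong2[where f = "(+)"], rule refl, rule set_integral_add(2), (intro si continuous_intros)+)
    also have "(LINT x:P|lborel. \<Sum>i\<in>UNIV. (2 * b0 * \<eta>$i) * x$i) = 0"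
      by (subst set_integral_sum_fun(1)) (auto intro!: set_integrable_mult_right sx simp: mean)
    also have "(LINT x:P|lborel. b0 * b0) = m * b0\<^sup>2"
      by (simp add: set_lebesgue_integral_def m_def power2_eq_square)
    also have "(LINT x:P|lborel. x \<bullet> (outer \<eta> \<eta> *v x)) = m * (\<eta> \<bullet> (A *v \<eta>))"
      unfolding set_integral_quadratic[OF P(1,2)] Aij
      by (simp add: outer_def inner_vec_def matrix_vector_mult_def sum_distrib_left mult_ac, subst sum.swap, simp add: mult_ac)
    finally show ?thesis by (simp add: A\<eta> algebra_simps)
  qed
  \<comment> \<open>The error of the affine approximation. Its mean square over \<open>P\<close> is
    \<open>g\<close>, because \<open>\<beta>\<close> and \<open>L\<close> have the same integral
    against \<open>L\<close>.\<close>
  define \<gamma> where "\<gamma> x = \<beta> x - L x" for x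
  have i\<gamma>: "(LINT x:P|lborel. (\<gamma> x)\<^sup>2) = m * g" and s\<gamma>: "set_integrable lborel P (\<lambda>x. (\<gamma> x)\<^sup>2)"
  proof -
    have e: "(\<gamma> x)\<^sup>2 = (\<beta> x * \<beta> x - 2 * (\<beta> x * L x)) + L x * L x" for x
      by (simp add: \<gamma>_def power2_eq_square algebra_simps)
    have s2: "set_integrable lborel P (\<lambda>x. 2 * (\<beta> x * L x))" by (intro set_integrable_mult_right sL)
    have s3: "set_integrable lborel P (\<lambda>x. \<beta> x * \<beta> x - 2 * (\<beta> x * L x))"
      by (rule set_integral_diff(1)[OF s\<beta>\<beta> s2])
    show "set_integrable lborel P (\<lambda>x. (\<gamma> x)\<^sup>2)"
      unfolding e by (rule set_integral_add(1)[OF s3 sL(2)])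
    have "(LINT x:P|lborel. (\<gamma> x)\<^sup>2) = (LINT x:P|lborel. \<beta> x * \<beta> x) - (LINT x:P|lborel. 2 * (\<beta> x * L x)) + (LINT x:P|lborel. L x * L x)"
      unfolding e by (simp only: set_integral_add(2)[OF s3 sL(2)] set_integral_diff(2)[OF s\<beta>\<beta> s2])
    then show "(LINT x:P|lborel. (\<gamma> x)\<^sup>2) = m * g"
      by (simp only: set_integral_mult_right ib iL iLL) (simp add: g_def algebra_simps)
  qed
  have "g \<le> 0"
  proof (rule ccontr)
    assume "\<not> g \<le> 0"
    then have g: "g > 0" by simp
    \<comment> \<open>The sign of \<open>t\<close> is chosen so that the linear term of the
      determinant is nonnegative.\<close>
    define t where "t = (if \<eta> \<bullet> u \<ge> 0 then t0 / 2 else - t0 / 2)"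
    have t: "\<bar>t\<bar> < t0" "t \<noteq> 0" "t * (\<eta> \<bullet> u) \<ge> 0"
      using t0 by (auto simp: t_def intro: mult_nonneg_nonpos)
    have "det (covariance_matrix (K t)) = det A * ((1 + t * (\<eta> \<bullet> u))\<^sup>2 + t\<^sup>2 * g * (u \<bullet> (B *v u)))"
      unfolding cov[OF t(1)] by (rule det_shear_conjugate[OF B(1) sym]) (use t in auto)
    also have "\<dots> > det A * 1"
    proof (rule mult_strict_left_mono[OF _ detA])
      have "(1 + t * (\<eta> \<bullet> u))\<^sup>2 \<ge> 1" using t(3) by (simp add: one_le_power)
      moreover have "t\<^sup>2 * g * (u \<bullet> (B *v u)) > 0" using t(2) g Bpd[OF u] by simp
      ultimately show "1 < (1 + t * (\<eta> \<bullet> u))\<^sup>2 + t\<^sup>2 * g * (u \<bullet> (B *v u))" by linarith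
    qed
    finally have "det A < det (covariance_matrix (K t))" by simp
    moreover have "det (covariance_matrix (K t)) / m\<^sup>2 \<le> det A / m\<^sup>2"
      using max[OF t(1)] unfolding isotropic_constant_le_iff by (simp add: mK[OF t(1)] m_def A_def)
    ultimately show False using m by (simp add: divide_le_cancel)
  qed
  moreover have "(LINT x:P|lborel. (\<gamma> x)\<^sup>2) \<ge> 0"
    unfolding set_lebesgue_integral_def by (rule Bochner_Integration.integral_nonneg) simp
  ultimately have "(LINT x:P|lborel. (\<gamma> x)\<^sup>2) = 0"
    unfolding i\<gamma> using m by (simp add: zero_le_mult_iff)
  then have "(\<integral>x. indicator P x *\<^sub>R (\<gamma> x)\<^sup>2 \<partial>lborel) = 0" unfolding set_lebesgue_integral_def .
  then have "AE x in lborel. indicator P x *\<^sub>R (\<gamma> x)\<^sup>2 = 0"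
    using integral_nonneg_eq_0_iff_AE[OF s\<gamma>[unfolded set_integrable_def]] by simp
  then have "AE x in lborel. x \<in> P \<longrightarrow> \<beta> x = \<eta> \<bullet> x + b0"
    by eventually_elim (auto simp: \<gamma>_def L_def)
  then show ?thesis by blast
qed

section \<open>Facet normals and vertices of polytopes\<close>

text \<open>A facet of a full-dimensional set affinely spans a hyperplane. A hyperplane that misses
  0 has only one normal once the right-hand side is fixed to be 1.\<close>

lemma facet_normal_unique:
  fixes P :: "'a::euclidean_space set"
  assumes F: "F facet_of P" and int: "interior P \<noteq> {}"
    and c: "F \<subseteq> {x. c \<bullet> x = 1}" "F \<subseteq> {x. c' \<bullet> x = 1}"
  shows "c = c'"
proof -
  have dP: "aff_dim P = int (DIM('a))" using int by (rule aff_dim_nonempty_interior)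
  have Fne: "F \<noteq> {}" and dF: "aff_dim F = int (DIM('a)) - 1" using F dP by (auto simp: facet_of_def)
  have hyp: "affine hull F = {x. b \<bullet> x = 1}" if "F \<subseteq> {x. b \<bullet> x = 1}" for b
  proof -
    have "b \<noteq> 0" using that Fne by auto
    show ?thesis
    proof (rule affine_dim_equal)
      show "affine hull F \<subseteq> {x. b \<bullet> x = 1}" using that by (intro hull_minimal affine_hyperplane)
      show "aff_dim (affine hull F) = aff_dim {x. b \<bullet> x = 1}"
        using \<open>b \<noteq> 0\<close> by (simp add: dF aff_dim_hyperplane)
    qed (use Fne in \<open>auto intro: affine_hyperplane\<close>)
  qed
  have c0: "c \<noteq> 0" "c' \<noteq> 0" using c Fne by auto
  have eq: "{x. c \<bullet> x = 1} = {x. c' \<bullet> x = 1}" using hyp[OF c(1)] hyp[OF c(2)] by simp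
  \<comment> \<open>The points of the hyperplanes closest to 0, each tested in the other
    equation.\<close>
  have "(1 / (c \<bullet> c)) *\<^sub>R c \<in> {x. c \<bullet> x = 1}" "(1 / (c' \<bullet> c')) *\<^sub>R c' \<in> {x. c' \<bullet> x = 1}" using c0 by simp_all
  then have "c' \<bullet> ((1 / (c \<bullet> c)) *\<^sub>R c) = 1" "c \<bullet> ((1 / (c' \<bullet> c')) *\<^sub>R c') = 1" using eq by blast+
  then have "c' \<bullet> c = c \<bullet> c" "c \<bullet> c' = c' \<bullet> c'" using c0 by (simp_all add: field_simps)
  then have "(c - c') \<bullet> (c - c') = 0" by (simp add: inner_diff_left inner_diff_right inner_commute)
  then show ?thesis by simp
qed

text \<open>With 0 in the interior, the right-hand sides of a minimal halfspace description are
  positive and can be scaled to 1. Uniqueness of the scaled normal identifies the chosen normals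
  with those of the description.\<close>

lemma facet_normals_exist:
  fixes P :: "'a::euclidean_space set"
  assumes P: "polytope P" and int: "0 \<in> interior P"
  shows "\<exists>a. (\<forall>F. F facet_of P \<longrightarrow> F = P \<inter> {x. a F \<bullet> x = 1}) \<and> P = {x. \<forall>F. F facet_of P \<longrightarrow> a F \<bullet> x \<le> 1}"
proof -
  have "polyhedron P" using P by (rule polytope_imp_polyhedron)
  then obtain H where H: "finite H" "P = (affine hull P) \<inter> \<Inter>H"
      "\<forall>h \<in> H. \<exists>a b. a \<noteq> 0 \<and> h = {x. a \<bullet> x \<le> b}"
      "\<forall>F'. F' \<subset> H \<longrightarrow> P \<subset> (affine hull P) \<inter> \<Inter>F'"
    by (auto simp: polyhedron_Int_affine_minimal)
  then obtain n b where nb: "\<And>h. h \<in> H \<Longrightarrow> n h \<noteq> (0::'a) \<and> h = {x. n h \<bullet> x \<le> b h}" by metis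
  have facet: "C facet_of P \<longleftrightarrow> (\<exists>h. h \<in> H \<and> C = P \<inter> {x. n h \<bullet> x = b h})" for C
    by (rule facet_of_polyhedron_explicit[OF H(1,2) nb]) (use H(4) in auto)
  have PH: "P = \<Inter>H" using H(2) int affine_hull_nonempty_interior[of P] by auto
  have bpos: "b h > 0" if h: "h \<in> H" for h
  proof -
    obtain e where e: "e > 0" "ball 0 e \<subseteq> P" using int by (auto simp: mem_interior)
    have nz: "norm (n h) > 0" using nb[OF h] by auto
    have "(e / 2 / norm (n h)) *\<^sub>R n h \<in> ball 0 e" using e nz by simp
    then have "(e / 2 / norm (n h)) *\<^sub>R n h \<in> P" using e by blast
    then have "(e / 2 / norm (n h)) *\<^sub>R n h \<in> {x. n h \<bullet> x \<le> b h}" using PH h nb[OF h] by blast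
    then have "(e / 2 / norm (n h)) * (n h \<bullet> n h) \<le> b h" by simp
    moreover have "(e / 2 / norm (n h)) * (n h \<bullet> n h) > 0" using e nz by simp
    ultimately show ?thesis by linarith
  qed
  define a where "a F = (SOME c. F = P \<inter> {x. c \<bullet> x = 1} \<and> P \<subseteq> {x. c \<bullet> x \<le> 1})" for F
  define c where "c h = (1 / b h) *\<^sub>R n h" for h
  have c1: "c h \<bullet> x = 1 \<longleftrightarrow> n h \<bullet> x = b h" "c h \<bullet> x \<le> 1 \<longleftrightarrow> n h \<bullet> x \<le> b h" if "h \<in> H" for h x
    using bpos[OF that] by (auto simp: c_def field_simps)
  have cF: "P \<inter> {x. n h \<bullet> x = b h} = P \<inter> {x. c h \<bullet> x = 1} \<and> P \<subseteq> {x. c h \<bullet> x \<le> 1}" if h: "h \<in> H" for h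
  proof -
    have "P \<subseteq> h" using PH h by blast
    then show ?thesis using nb[OF h] c1[OF h] by auto
  qed
  have aF: "F = P \<inter> {x. a F \<bullet> x = 1} \<and> P \<subseteq> {x. a F \<bullet> x \<le> 1}" if "F facet_of P" for F
    unfolding a_def by (rule someI_ex) (use that cF facet in metis)
  have ac: "a (P \<inter> {x. n h \<bullet> x = b h}) = c h" if h: "h \<in> H" for h
  proof (rule facet_normal_unique)
    show F: "P \<inter> {x. n h \<bullet> x = b h} facet_of P" using facet h by blast
    show "interior P \<noteq> {}" using int by auto
    show "P \<inter> {x. n h \<bullet> x = b h} \<subseteq> {x. a (P \<inter> {x. n h \<bullet> x = b h}) \<bullet> x = 1}" using aF[OF F] by blast
    show "P \<inter> {x. n h \<bullet> x = b h} \<subseteq> {x. c h \<bullet> x = 1}" using c1[OF h] by auto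
  qed
  have "P = {x. \<forall>F. F facet_of P \<longrightarrow> a F \<bullet> x \<le> 1}"
  proof (intro subset_antisym subsetI)
    fix x assume "x \<in> P" then show "x \<in> {x. \<forall>F. F facet_of P \<longrightarrow> a F \<bullet> x \<le> 1}" using aF by blast
  next
    fix x assume x: "x \<in> {x. \<forall>F. F facet_of P \<longrightarrow> a F \<bullet> x \<le> 1}"
    have "x \<in> h" if h: "h \<in> H" for h
    proof -
      have "P \<inter> {x. n h \<bullet> x = b h} facet_of P" using facet h by blast
      then have "c h \<bullet> x \<le> 1" using x ac[OF h] by auto
      then show ?thesis using c1(2)[OF h] nb[OF h] by blast
    qed
    then show "x \<in> P" using PH by blast
  qed
  then show ?thesis using aF by blast
qed

text \<open>Meaningful for a polytope with 0 in its interior; the values at the facets are then the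
  vertices of the polar polytope.\<close>

definition facet_normal :: "'a::euclidean_space set \<Rightarrow> 'a set \<Rightarrow> 'a" where
  "facet_normal P = (SOME a. (\<forall>F. F facet_of P \<longrightarrow> F = P \<inter> {x. a F \<bullet> x = 1}) \<and> P = {x. \<forall>F. F facet_of P \<longrightarrow> a F \<bullet> x \<le> 1})"

lemma facet_normal:
  fixes P :: "'a::euclidean_space set"
  assumes P: "polytope P" and int: "0 \<in> interior P"
  shows "F facet_of P \<Longrightarrow> F = P \<inter> {x. facet_normal P F \<bullet> x = 1}"
    and "P = {x. \<forall>F. F facet_of P \<longrightarrow> facet_normal P F \<bullet> x \<le> 1}"
  using someI_ex[OF facet_normals_exist[OF assms], folded facet_normal_def] by blast+

definition vertices :: "'a::real_vector set \<Rightarrow> 'a set" where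
  "vertices P = {x. x extreme_point_of P}"

lemma vertices_facet: "F facet_of P \<Longrightarrow> vertices F = vertices P \<inter> F"
  unfolding vertices_def using extreme_point_of_face facet_of_imp_face_of by blast

text \<open>The vertices lie in a hyperplane missing 0: applying \<open>c\<close> to a linear
  relation shows that its coefficients sum to 0, which affine independence excludes. So they are
  linearly independent, and by the dimension of a facet they form a basis.\<close>

lemma simplicial_facet:
  fixes P :: "'a::euclidean_space set"
  assumes F: "F facet_of P" "k simplex F" and int: "interior P \<noteq> {}"
    and c: "F \<subseteq> {x. c \<bullet> x = 1}"
  shows "finite (vertices F)" "card (vertices F) = DIM('a)" "independent (vertices F)"
    "F = convex hull (vertices F)" "span (vertices F) = UNIV"
proof -
  obtain C where C: "\<not> affine_dependent C" "int (card C) = k + 1" "F = convex hull C"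
    using F(2) by (auto simp: simplex_def)
  have VC: "vertices F = C"
    unfolding vertices_def C(3) using extreme_point_of_convex_hull_affine_independent[OF C(1)] by auto
  have fin: "finite C" using C(1) by (rule aff_independent_finite)
  have dP: "aff_dim P = int (DIM('a))" using int by (rule aff_dim_nonempty_interior)
  have "aff_dim F = int (card C) - 1"
    unfolding C(3) aff_dim_convex_hull using aff_dim_affine_independent[OF C(1)] by simp
  then have card: "card C = DIM('a)" using F(1) dP by (auto simp: facet_of_def)
  have C1: "\<And>x. x \<in> C \<Longrightarrow> c \<bullet> x = 1" using c C(3) hull_subset[of C convex] by blast
  have ind: "independent C"
  proof (rule independent_if_scalars_zero[OF fin])
    fix f x assume s: "(\<Sum>x\<in>C. f x *\<^sub>R x) = 0" and x: "x \<in> C"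
    have "c \<bullet> (\<Sum>x\<in>C. f x *\<^sub>R x) = sum f C" using C1 by (simp add: inner_sum_right)
    then have "sum f C = 0" using s by simp
    then show "f x = 0" using C(1) s x unfolding affine_dependent_explicit_finite[OF fin] by blast
  qed
  show "finite (vertices F)" "card (vertices F) = DIM('a)" "independent (vertices F)" "F = convex hull (vertices F)"
    using VC fin card ind C(3) by auto
  show "span (vertices F) = UNIV"
    using card_eq_dim[of C UNIV] ind card fin by (simp add: VC) (metis dim_UNIV dim_eq_card_independent dim_eq_span dim_span span_UNIV subset_UNIV span_eq_dim top.extremum_uniqueI order_refl)
qed

lemma basis_coordinates:
  fixes V :: "'a::euclidean_space set"
  assumes V: "finite V" "independent V" "span V = UNIV"
  obtains y :: "'a \<Rightarrow> 'a \<Rightarrow> real" where "\<And>v. linear (y v)" "\<And>x. (\<Sum>v\<in>V. y v x *\<^sub>R v) = x"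
    "\<And>v w. v \<in> V \<Longrightarrow> w \<in> V \<Longrightarrow> y v w = (if v = w then 1 else 0)"
proof
  let ?y = "\<lambda>v x. representation V x v"
  show "linear (?y v)" for v
    by (rule linearI) (simp_all add: representation_add representation_scale V)
  show "(\<Sum>v\<in>V. ?y v x *\<^sub>R v) = x" for x
    by (rule sum_representation_eq) (auto simp: V)
  show "?y v w = (if v = w then 1 else 0)" if "v \<in> V" "w \<in> V" for v w
    using representation_basis[OF V(2) that(2)] by simp
qed

text \<open>As \<open>c\<close> is 1 on the basis, \<open>c \<bullet> x\<close> is the sum of the
  coordinates of \<open>x\<close>; the weight left for the vertex 0 is
  \<open>1 - c \<bullet> x\<close>.\<close>

lemma convex_hull_basis:
  fixes V :: "'a::euclidean_space set"
  assumes V: "finite V" and y: "\<And>v. linear (y v)" "\<And>x. (\<Sum>v\<in>V. y v x *\<^sub>R v) = x"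
    "\<And>v w. v \<in> V \<Longrightarrow> w \<in> V \<Longrightarrow> y v w = (if v = w then (1::real) else 0)"
    and c: "\<And>v. v \<in> V \<Longrightarrow> c \<bullet> v = 1"
  shows "c \<bullet> x = (\<Sum>v\<in>V. y v x)"
    and "convex hull V = {x. (\<forall>v\<in>V. 0 \<le> y v x) \<and> c \<bullet> x = 1}"
    and "convex hull (insert 0 V) = {x. (\<forall>v\<in>V. 0 \<le> y v x) \<and> c \<bullet> x \<le> 1}"
proof -
  have cx: "c \<bullet> x = (\<Sum>v\<in>V. y v x)" for x
  proof -
    have "c \<bullet> (\<Sum>v\<in>V. y v x *\<^sub>R v) = (\<Sum>v\<in>V. y v x)" using c by (simp add: inner_sum_right)
    then show ?thesis by (simp add: y(2))
  qed
  then show "c \<bullet> x = (\<Sum>v\<in>V. y v x)" .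
  have cv: "convex {x. \<forall>v\<in>V. 0 \<le> y v x}"
    unfolding convex_alt using y(1) by (auto simp: linear_add linear_cmul)
  have hs: "convex {x. c \<bullet> x = 1}" "convex {x. c \<bullet> x \<le> 1}" by (rule convex_hyperplane convex_halfspace_le)+
  have Vin: "V \<subseteq> {x. \<forall>v\<in>V. 0 \<le> y v x}" "0 \<in> {x. \<forall>v\<in>V. 0 \<le> y v x}"
    using y(3) linear_0[OF y(1)] by auto
  show "convex hull V = {x. (\<forall>v\<in>V. 0 \<le> y v x) \<and> c \<bullet> x = 1}"
  proof (intro subset_antisym)
    show "convex hull V \<subseteq> {x. (\<forall>v\<in>V. 0 \<le> y v x) \<and> c \<bullet> x = 1}"
      unfolding Collect_conj_eq using Vin c by (intro hull_minimal convex_Int cv hs) auto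
    show "{x. (\<forall>v\<in>V. 0 \<le> y v x) \<and> c \<bullet> x = 1} \<subseteq> convex hull V"
    proof safe
      fix x assume "\<forall>v\<in>V. 0 \<le> y v x" "c \<bullet> x = 1"
      then show "x \<in> convex hull V" unfolding convex_hull_finite[OF V]
        using y(2)[of x] cx[of x] by (auto intro!: exI[of _ "\<lambda>v. y v x"])
    qed
  qed
  show "convex hull (insert 0 V) = {x. (\<forall>v\<in>V. 0 \<le> y v x) \<and> c \<bullet> x \<le> 1}"
  proof (intro subset_antisym)
    show "convex hull (insert 0 V) \<subseteq> {x. (\<forall>v\<in>V. 0 \<le> y v x) \<and> c \<bullet> x \<le> 1}"
      unfolding Collect_conj_eq using Vin c by (intro hull_minimal convex_Int cv hs) auto
    show "{x. (\<forall>v\<in>V. 0 \<le> y v x) \<and> c \<bullet> x \<le> 1} \<subseteq> convex hull (insert 0 V)"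
    proof safe
      fix x assume x: "\<forall>v\<in>V. 0 \<le> y v x" "c \<bullet> x \<le> 1"
      have V0: "0 \<notin> V" using c by force
      show "x \<in> convex hull (insert 0 V)"
        unfolding convex_hull_finite[OF finite.insertI[OF V]]
      proof (intro CollectI exI[of _ "\<lambda>v. if v = 0 then 1 - c \<bullet> x else y v x"] conjI ballI)
        have *: "(\<Sum>v\<in>V. (if v = 0 then 1 - c \<bullet> x else y v x)) = (\<Sum>v\<in>V. y v x)"
          "(\<Sum>v\<in>V. (if v = 0 then 1 - c \<bullet> x else y v x) *\<^sub>R v) = (\<Sum>v\<in>V. y v x *\<^sub>R v)"
          using V0 by (intro sum.cong; auto)+
        show "(\<Sum>v\<in>insert 0 V. (if v = 0 then 1 - c \<bullet> x else y v x)) = 1"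
          using V V0 by (simp add: * cx)
        show "(\<Sum>v\<in>insert 0 V. (if v = 0 then 1 - c \<bullet> x else y v x) *\<^sub>R v) = x"
          using V V0 by (simp add: * y(2))
      qed (use x in auto)
    qed
  qed
qed

section \<open>Local maximizers with centroid at the origin\<close>

text \<open>A centroid at 0 removes the first moments from the variation formulas and puts 0 into
  the interior, as the normalized facet normals require.\<close>

locale centered_maximizer =
  fixes P :: "(real^'n) set" and B :: "real^'n^'n"
  assumes polytope: "polytope P" and interior: "interior P \<noteq> {}"
    and mean: "\<And>i. (LINT x:P|lborel. x$i) = 0"
    and B: "covariance_matrix P ** B = mat 1" "B ** covariance_matrix P = mat 1"
    and maximal: "\<exists>\<epsilon>>0. \<forall>K. convex_body K \<longrightarrow> hausdorff_distance K P < \<epsilon> \<longrightarrow> isotropic_constant K \<le> isotropic_constant P"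
begin

lemma P_basic: "compact P" "convex P" "closed P" "P \<noteq> {}" "P \<in> sets borel" "bounded P" "measure lborel P > 0"
proof -
  show c: "compact P" "convex P" using polytope polytope_imp_compact polytope_imp_convex by auto
  then show "closed P" "P \<in> sets borel" "bounded P" by (auto intro: compact_imp_closed borel_compact compact_imp_bounded)
  show "P \<noteq> {}" using interior interior_subset by auto
  have "emeasure lborel (interior P) \<noteq> 0" using interior by (intro emeasure_lborel_open_neq_0) auto
  moreover have "emeasure lborel (interior P) \<le> emeasure lborel P"
    using interior_subset \<open>P \<in> sets borel\<close> by (intro emeasure_mono) auto
  ultimately have "emeasure lborel P \<noteq> 0" by auto
  moreover have "emeasure lborel P < \<infinity>" using \<open>bounded P\<close> by (rule emeasure_bounded_finite)
  ultimately show "measure lborel P > 0"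
    by (simp add: measure_def enn2real_positive_iff zero_less_iff_neq_zero)
qed

text \<open>Otherwise a linear function is nonnegative on \<open>P\<close>. Its integral is 0 since
  the centroid is 0, so \<open>P\<close> would lie in a hyperplane up to a null set.\<close>

lemma zero_in_interior: "0 \<in> interior P"
proof (rule ccontr)
  assume "0 \<notin> interior P"
  then obtain a where a: "a \<noteq> 0" "\<And>x. x \<in> interior P \<Longrightarrow> 0 \<le> a \<bullet> x"
    using separating_hyperplane_set_0[of "interior P"] convex_interior[OF P_basic(2)] by auto
  have "closure (interior P) \<subseteq> {x. 0 \<le> a \<bullet> x}"
    using a(2) by (intro closure_minimal closed_Collect_le continuous_intros) auto
  then have aP: "0 \<le> a \<bullet> x" if "x \<in> P" for x
    using that convex_closure_interior[OF P_basic(2) interior] P_basic(3) by auto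
  have si: "set_integrable lborel P (\<lambda>x. a \<bullet> x)"
    by (intro set_integrable_continuous_bounded[OF P_basic(6,5)] continuous_intros)
  have "(LINT x:P|lborel. a \<bullet> x) = (LINT x:P|lborel. \<Sum>i\<in>UNIV. a$i * x$i)"
    by (simp add: inner_vec_def)
  also have "\<dots> = (\<Sum>i\<in>UNIV. (LINT x:P|lborel. a$i * x$i))"
    by (rule set_integral_sum_fun(1)) (intro set_integrable_continuous_bounded[OF P_basic(6,5)] continuous_intros)
  finally have "(\<integral>x. indicator P x *\<^sub>R (a \<bullet> x) \<partial>lborel) = 0"
    unfolding set_integral_mult_right mean set_lebesgue_integral_def[of lborel P "\<lambda>x. a \<bullet> x"] by simp
  moreover have "AE x in lborel. 0 \<le> indicator P x *\<^sub>R (a \<bullet> x)"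
    using aP by (intro AE_I2) (auto simp: indicator_def)
  ultimately have "AE x in lborel. indicator P x *\<^sub>R (a \<bullet> x) = 0"
    using integral_nonneg_eq_0_iff_AE[OF si[unfolded set_integrable_def]] by simp
  then have "AE x in lborel. x \<notin> P"
    using null_hyperplane_lborel[OF a(1), of 0] by eventually_elim (auto simp: indicator_def split: if_splits)
  then have "measure lborel P = 0"
    using P_basic(5) AE_iff_null_sets[of P lborel] by (simp add: measure_eq_0_null_sets)
  with P_basic(7) show False by simp
qed

abbreviation "nrm \<equiv> facet_normal P"

lemma facet_eq: "F facet_of P \<Longrightarrow> F = P \<inter> {x. nrm F \<bullet> x = 1}"
  and P_eq: "P = {x. \<forall>F. F facet_of P \<longrightarrow> nrm F \<bullet> x \<le> 1}"
  using facet_normal[OF polytope zero_in_interior] by blast+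

lemma facet_nrm: "F facet_of P \<Longrightarrow> x \<in> F \<Longrightarrow> nrm F \<bullet> x = 1"
  using facet_eq by blast

lemma P_nrm: "F facet_of P \<Longrightarrow> x \<in> P \<Longrightarrow> nrm F \<bullet> x \<le> 1"
  using P_eq by blast

lemma in_facet_iff: "F facet_of P \<Longrightarrow> x \<in> P \<Longrightarrow> x \<in> F \<longleftrightarrow> nrm F \<bullet> x = 1"
  using facet_eq by blast

lemma nrm_unique: "F facet_of P \<Longrightarrow> F \<subseteq> {x. c \<bullet> x = 1} \<Longrightarrow> c = nrm F"
  using facet_normal_unique[OF _ interior] facet_nrm by blast

lemma facet_subset_P: "F facet_of P \<Longrightarrow> F \<subseteq> P"
  using facet_of_imp_subset .

lemma finite_facets: "finite {F. F facet_of P}"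
  using polytope by (rule finite_polytope_facets)

lemma facet_subset_eq:
  assumes "F facet_of P" "G facet_of P" "F \<subseteq> G"
  shows "F = G"
proof -
  have "nrm G = nrm F" using assms facet_nrm by (intro nrm_unique) auto
  then show ?thesis using facet_eq[OF assms(1)] facet_eq[OF assms(2)] by simp
qed

lemma simplicial_vertices:
  assumes "F facet_of P" "k simplex F"
  shows "finite (vertices F)" "card (vertices F) = CARD('n)" "independent (vertices F)"
    "F = convex hull (vertices F)" "span (vertices F) = UNIV"
  using simplicial_facet[OF assms interior, of "nrm F"] facet_nrm[OF assms(1)] by auto

lemma vertices_subset: "vertices S \<subseteq> S"
  by (auto simp: vertices_def extreme_point_of_def)

definition Q :: "real^'n \<Rightarrow> real^'n \<Rightarrow> real" where "Q x y = x \<bullet> (B *v y)"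

lemma bilinear_Q: "bilinear Q"
  unfolding bilinear_def Q_def
  by (auto intro!: linearI simp: inner_add_left matrix_vector_right_distrib inner_add_right matrix_vector_mult_scaleR)

lemma Q_simps: "Q (x + y) z = Q x z + Q y z" "Q z (x + y) = Q z x + Q z y"
  "Q (t *\<^sub>R x) z = t * Q x z" "Q z (t *\<^sub>R x) = t * Q z x"
  "Q (x - y) z = Q x z - Q y z" "Q z (x - y) = Q z x - Q z y" "Q 0 z = 0" "Q z 0 = 0" "Q (- x) z = - Q x z" "Q z (- x) = - Q z x"
  by (simp_all add: Q_def inner_add_left inner_add_right inner_diff_left inner_diff_right matrix_vector_right_distrib
    matrix_vector_mult_diff_distrib matrix_vector_mult_scaleR linear_neg[OF matrix_vector_mul_linear])

lemma Q_sum: "Q (sum f A) z = (\<Sum>i\<in>A. Q (f i) z)" "Q z (sum f A) = (\<Sum>i\<in>A. Q z (f i))"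
  using bilinear_Q by (auto simp: bilinear_def intro!: linear_sum)

lemma cov_sym: "transpose (covariance_matrix P) = covariance_matrix P"
  by (simp add: vec_eq_iff transpose_def covariance_matrix_entry[OF P_basic(5,6,7)] mean mult.commute)

lemma Q_sym: "Q x y = Q y x"
proof -
  let ?A = "covariance_matrix P"
  have AB: "?A *v (B *v x) = x" for x by (simp add: matrix_vector_mul_assoc B)
  have "Q x y = (?A *v (B *v x)) \<bullet> (B *v y)" by (simp add: AB Q_def)
  also have "\<dots> = (B *v x) \<bullet> (?A *v (B *v y))"
    using cov_sym by (metis dot_lmul_matrix inner_commute transpose_matrix_vector)
  also have "\<dots> = Q y x" by (simp add: AB Q_def inner_commute)
  finally show ?thesis .
qed

lemma Q_pos: "x \<noteq> 0 \<Longrightarrow> Q x x > 0"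
proof -
  let ?A = "covariance_matrix P"
  assume x: "x \<noteq> 0"
  have AB: "?A *v (B *v x) = x" by (simp add: matrix_vector_mul_assoc B)
  then have "B *v x \<noteq> 0" using x by auto
  from covariance_matrix_pos_def[OF P_basic(5,6,7) mean this] show ?thesis
    by (simp add: AB Q_def inner_commute)
qed

lemma continuous_Q: "continuous_on A f \<Longrightarrow> continuous_on A g \<Longrightarrow> continuous_on A (\<lambda>x. Q (f x) (g x))"
  using bounded_bilinear.continuous_on[OF bilinear_Q[unfolded bilinear_conv_bounded_bilinear]] .

text \<open>Replaces the Hausdorff distance by distances of points. Halving the radius turns weak
  bounds into the strict one that is required.\<close>

lemma maximal_near:
  "\<exists>\<epsilon>>0. \<forall>K. convex_body K \<longrightarrow> (\<forall>x\<in>K. \<exists>y\<in>P. dist x y \<le> \<epsilon>) \<longrightarrow> (\<forall>y\<in>P. \<exists>x\<in>K. dist y x \<le> \<epsilon>) \<longrightarrow> isotropic_constant K \<le> isotropic_constant P"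
proof -
  obtain \<epsilon> where \<epsilon>: "\<epsilon> > 0" "\<And>K. convex_body K \<Longrightarrow> hausdorff_distance K P < \<epsilon> \<Longrightarrow> isotropic_constant K \<le> isotropic_constant P"
    using maximal by blast
  show ?thesis
  proof (intro exI[of _ "\<epsilon>/2"] conjI allI impI)
    fix K assume K: "convex_body K" "\<forall>x\<in>K. \<exists>y\<in>P. dist x y \<le> \<epsilon>/2" "\<forall>y\<in>P. \<exists>x\<in>K. dist y x \<le> \<epsilon>/2"
    have "K \<noteq> {}" using K(1) interior_subset[of K] by (auto simp: convex_body_def)
    then have "hausdorff_distance K P \<le> \<epsilon>/2" using K P_basic by (intro hausdorff_distance_le) auto
    then show "isotropic_constant K \<le> isotropic_constant P" using \<epsilon> K(1) by (intro \<epsilon>(2)) auto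
  qed (use \<epsilon> in simp)
qed

section \<open>First-order conditions at a simplicial facet\<close>

lemma thin_slab:
  fixes a :: "real^'n"
  assumes "a \<noteq> 0"
  shows "(\<lambda>k. measure lborel (cball 0 R \<inter> {x. \<bar>a \<bullet> x - 1\<bar> \<le> 1 / real (Suc k)})) \<longlonglongrightarrow> 0"
proof -
  let ?A = "\<lambda>k. cball 0 R \<inter> {x. \<bar>a \<bullet> x - 1\<bar> \<le> 1 / real (Suc k)}"
  have cl: "closed (?A k)" for k
    by (intro closed_Int closed_cball closed_Collect_le continuous_intros)
  have dec: "decseq ?A"
  proof (intro decseq_SucI subsetI)
    fix k x assume x: "x \<in> ?A (Suc k)"
    have "1 / real (Suc (Suc k)) \<le> 1 / real (Suc k)" by (simp add: frac_le)
    then show "x \<in> ?A k" using x by auto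
  qed
  have "(\<lambda>k. measure lborel (?A k)) \<longlonglongrightarrow> measure lborel (\<Inter>k. ?A k)"
  proof (rule Lim_measure_decseq[OF _ dec])
    show "range ?A \<subseteq> sets lborel" using cl by (auto intro: borel_closed)
    show "emeasure lborel (?A k) \<noteq> \<infinity>" for k
      using emeasure_bounded_finite[of "?A k"] bounded_subset[OF bounded_cball] by fastforce
  qed
  moreover have "measure lborel (\<Inter>k. ?A k) = 0"
  proof -
    have "AE x in lborel. x \<notin> (\<Inter>k. ?A k)"
      using null_hyperplane_lborel[OF assms, of 1]
    proof eventually_elim
      case (elim x)
      show ?case
      proof
        assume x: "x \<in> (\<Inter>k. ?A k)"
        obtain k where "1 / real (Suc k) < \<bar>a \<bullet> x - 1\<bar>"
          using reals_Archimedean[of "\<bar>a \<bullet> x - 1\<bar>"] elim by (auto simp: inverse_eq_divide)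
        with x show False by (auto simp: not_le[symmetric] simp del: of_nat_Suc)
      qed
    qed
    moreover have "(\<Inter>k. ?A k) \<in> sets lborel"
      using cl by (simp add: borel_closed closed_INT)
    ultimately show ?thesis using AE_iff_null_sets[of "\<Inter>k. ?A k" lborel] by (simp add: measure_eq_0_null_sets)
  qed
  ultimately show ?thesis by simp
qed

lemma facet_normal_nz: "F facet_of P \<Longrightarrow> nrm F \<noteq> 0"
  using facet_nrm[of F] by (metis all_not_in_conv facet_of_def inner_zero_left zero_neq_one)

text \<open>Pushing \<open>y\<close> outwards directly could violate the other facets through
  \<open>y\<close>. So \<open>y\<close> is first moved slightly towards the barycentre
  \<open>g\<close> of the vertices of \<open>F\<close>, where all other facet inequalities are
  strict, and only then along the normal of \<open>F\<close>.\<close>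

lemma point_beyond_facet:
  assumes F: "F facet_of P" "k simplex F" and y: "y \<in> vertices F" and \<eta>: "\<eta> > 0"
  shows "\<exists>x. dist x y < \<eta> \<and> 1 < nrm F \<bullet> x \<and> nrm F \<bullet> x < 1 + \<eta> \<and> (\<forall>G. G facet_of P \<longrightarrow> G \<noteq> F \<longrightarrow> nrm G \<bullet> x \<le> 1)"
proof -
  note V = simplicial_vertices[OF F]
  let ?V = "vertices F"
  let ?n = "real (card ?V)"
  have n: "?n > 0" by (simp add: V(2))
  define g where "g = (1 / ?n) *\<^sub>R (\<Sum>v\<in>?V. v)"
  have VP: "v \<in> P" if "v \<in> ?V" for v using that vertices_subset facet_subset_P[OF F(1)] by blast
  have gG: "nrm G \<bullet> g < 1" if G: "G facet_of P" "G \<noteq> F" for G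
  proof -
    have "\<exists>v\<in>?V. nrm G \<bullet> v \<noteq> 1"
    proof (rule ccontr)
      assume "\<not> ?thesis"
      then have "?V \<subseteq> {x. nrm G \<bullet> x = 1}" by auto
      then have "convex hull ?V \<subseteq> {x. nrm G \<bullet> x = 1}" by (intro hull_minimal convex_hyperplane)
      then have "nrm G = nrm F" using V(4) F(1) by (intro nrm_unique) auto
      then show False using facet_eq[OF F(1)] facet_eq[OF G(1)] G(2) by auto
    qed
    then obtain v where v: "v \<in> ?V" "nrm G \<bullet> v < 1" using P_nrm[OF G(1)] VP by fastforce
    have "(\<Sum>v\<in>?V. nrm G \<bullet> v) < (\<Sum>v\<in>?V. 1)"
      using v V(1) P_nrm[OF G(1)] VP by (intro sum_strict_mono_ex1) auto
    then show ?thesis using n by (simp add: g_def inner_sum_right field_simps)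
  qed
  have gF: "nrm F \<bullet> g = 1"
  proof -
    have "(\<Sum>v\<in>?V. nrm F \<bullet> v) = (\<Sum>v\<in>?V. 1)"
      using facet_nrm[OF F(1)] vertices_subset by (intro sum.cong) auto
    then show ?thesis using n by (simp add: g_def inner_sum_right)
  qed
  have yF: "nrm F \<bullet> y = 1" using facet_nrm[OF F(1)] vertices_subset y by blast
  have yG: "nrm G \<bullet> y \<le> 1" if "G facet_of P" for G using P_nrm[OF that VP[OF y]] .
  define z where "z e = (1 - e) *\<^sub>R y + e *\<^sub>R g" for e :: real
  have "((\<lambda>e. dist (z e) y) \<longlongrightarrow> dist (z 0) y) (at_right 0)"
    unfolding z_def by (intro tendsto_intros)
  then have "\<forall>\<^sub>F e in at_right 0. dist (z e) y < \<eta>"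
    using \<eta> by (intro order_tendstoD(2)) (auto simp: z_def)
  moreover have "\<forall>\<^sub>F e in at_right (0::real). e > 0 \<and> e < 1"
    by (auto simp: eventually_at_right_less intro!: eventually_conj eventually_at_rightI[of 0 1])
  ultimately obtain e where e: "dist (z e) y < \<eta>" "e > 0" "e < 1"
    using eventually_happens[OF eventually_conj] by (metis (mono_tags, lifting) trivial_limit_at_right_real)
  have zF: "nrm F \<bullet> z e = 1" by (simp add: z_def inner_add_right yF gF)
  have zG: "nrm G \<bullet> z e < 1" if G: "G facet_of P" "G \<noteq> F" for G
  proof -
    have "nrm G \<bullet> z e = (1 - e) * (nrm G \<bullet> y) + e * (nrm G \<bullet> g)" by (simp add: z_def inner_add_right)
    also have "\<dots> < (1 - e) * 1 + e * 1"
      using e gG[OF G] yG[OF G(1)] by (intro add_le_less_mono mult_left_mono mult_strict_left_mono) auto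
    finally show ?thesis by simp
  qed
  define w where "w d = z e + d *\<^sub>R nrm F" for d
  have w: "\<forall>\<^sub>F d in at_right 0. f (w d) < c" if f: "continuous_on UNIV f" "f (z e) < c" for f :: "_ \<Rightarrow> real" and c
  proof -
    have "continuous_on UNIV (\<lambda>d. f (w d))"
      by (rule continuous_on_compose2[OF f(1)]) (auto simp: w_def intro!: continuous_intros)
    then have "((\<lambda>d. f (w d)) \<longlongrightarrow> f (w 0)) (at 0)"
      by (simp add: continuous_on_def)
    then have "((\<lambda>d. f (w d)) \<longlongrightarrow> f (w 0)) (at_right 0)"
      by (rule tendsto_within_subset) simp
    from order_tendstoD(2)[OF this, of c] show ?thesis using f(2) by (simp add: w_def)
  qed
  have "\<forall>\<^sub>F d in at_right 0. dist (w d) y < \<eta>"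
    by (rule w[of "\<lambda>x. dist x y"]) (use e in \<open>auto intro!: continuous_intros\<close>)
  moreover have "\<forall>\<^sub>F d in at_right 0. nrm F \<bullet> w d < 1 + \<eta>"
    by (rule w[of "\<lambda>x. nrm F \<bullet> x"]) (use zF \<eta> in \<open>auto intro!: continuous_intros\<close>)
  moreover have "\<forall>\<^sub>F d in at_right 0. \<forall>G\<in>{G. G facet_of P}. G \<noteq> F \<longrightarrow> nrm G \<bullet> w d < 1"
  proof (intro eventually_ball_finite finite_facets ballI)
    fix G assume G: "G \<in> {G. G facet_of P}"
    show "\<forall>\<^sub>F d in at_right 0. G \<noteq> F \<longrightarrow> nrm G \<bullet> w d < 1"
    proof (cases "G = F")
      case False
      have "\<forall>\<^sub>F d in at_right 0. nrm G \<bullet> w d < 1"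
        by (rule w[of "\<lambda>x. nrm G \<bullet> x"]) (use zG G False in \<open>auto intro!: continuous_intros\<close>)
      then show ?thesis by eventually_elim simp
    qed simp
  qed
  moreover have "\<forall>\<^sub>F d in at_right (0::real). d > 0" by (simp add: eventually_at_right_less)
  ultimately have "\<forall>\<^sub>F d in at_right 0. dist (w d) y < \<eta> \<and> nrm F \<bullet> w d < 1 + \<eta> \<and> (\<forall>G\<in>{G. G facet_of P}. G \<noteq> F \<longrightarrow> nrm G \<bullet> w d < 1) \<and> d > 0"
    by eventually_elim auto
  from eventually_happens'[OF trivial_limit_at_right_real this]
  obtain d where d: "dist (w d) y < \<eta>" "nrm F \<bullet> w d < 1 + \<eta>" "\<And>G. G facet_of P \<Longrightarrow> G \<noteq> F \<Longrightarrow> nrm G \<bullet> w d < 1" "d > 0"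
    by blast
  have "nrm F \<bullet> w d = 1 + d * (nrm F \<bullet> nrm F)" by (simp add: w_def inner_add_right zF)
  then have "1 < nrm F \<bullet> w d" using d(4) facet_normal_nz[OF F(1)] by simp
  then show ?thesis using d by (intro exI[of _ "w d"]) (auto intro: less_imp_le)
qed

text \<open>A segment from a point of \<open>P\<close> to \<open>x\<close> can leave
  \<open>P\<close> only through \<open>F\<close>, the only facet whose inequality \<open>x\<close>
  violates.\<close>

lemma hull_beyond_facet:
  assumes F: "F facet_of P" and x: "nrm F \<bullet> x > 1" "\<And>G. G facet_of P \<Longrightarrow> G \<noteq> F \<Longrightarrow> nrm G \<bullet> x \<le> 1"
  shows "convex hull (insert x P) = P \<union> convex hull (insert x F)"
proof (intro subset_antisym subsetI)
  fix z assume "z \<in> convex hull (insert x P)"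
  then obtain s q where s: "0 \<le> s" "s \<le> 1" "q \<in> P" "z = (1 - s) *\<^sub>R q + s *\<^sub>R x"
    unfolding convex_hull_insert[OF P_basic(4)] hull_same[of convex, OF P_basic(2)]
    by auto
  have qG: "nrm G \<bullet> q \<le> 1" if "G facet_of P" for G using P_nrm[OF that s(3)] .
  have zG: "nrm G \<bullet> z \<le> 1" if "G facet_of P" "G \<noteq> F" for G
  proof -
    have "nrm G \<bullet> z = (1 - s) * (nrm G \<bullet> q) + s * (nrm G \<bullet> x)" by (simp add: s(4) inner_add_right)
    also have "\<dots> \<le> (1 - s) * 1 + s * 1"
      using s qG[OF that(1)] x(2)[OF that] by (intro add_mono mult_left_mono) auto
    finally show ?thesis by simp
  qed
  show "z \<in> P \<union> convex hull (insert x F)"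
  proof (cases "nrm F \<bullet> z \<le> 1")
    case True
    then have "z \<in> P" using zG P_eq by blast
    then show ?thesis by simp
  next
    case False
    define \<alpha> where "\<alpha> = nrm F \<bullet> q"
    define \<xi> where "\<xi> = nrm F \<bullet> x"
    have al: "\<alpha> \<le> 1" "\<xi> > 1" using qG[OF F] x(1) by (auto simp: \<alpha>_def \<xi>_def)
    \<comment> \<open>The parameter at which the segment from \<open>q\<close> to \<open>x\<close>
      crosses the hyperplane of \<open>F\<close>.\<close>
    define r where "r = (1 - \<alpha>) / (\<xi> - \<alpha>)"
    have r: "0 \<le> r" "r < 1" using al by (auto simp: r_def field_simps)
    have rr: "(1 - r) * \<alpha> + r * \<xi> = 1"
    proof -
      have "r * (\<xi> - \<alpha>) = 1 - \<alpha>" using al by (simp add: r_def)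
      then show ?thesis by (simp add: algebra_simps)
    qed
    have nz: "nrm F \<bullet> z = (1 - s) * \<alpha> + s * \<xi>" by (simp add: s(4) inner_add_right \<alpha>_def \<xi>_def)
    have "s > r"
    proof (rule ccontr)
      assume "\<not> s > r"
      then have "(s - r) * (\<xi> - \<alpha>) \<le> 0" using al by (simp add: mult_le_0_iff)
      then have "nrm F \<bullet> z \<le> 1" using nz rr by (simp add: algebra_simps)
      with False show False by simp
    qed
    define q' where "q' = (1 - r) *\<^sub>R q + r *\<^sub>R x"
    have "nrm G \<bullet> q' \<le> 1" if "G facet_of P" for G
    proof (cases "G = F")
      case True then show ?thesis using rr by (simp add: q'_def inner_add_right \<alpha>_def \<xi>_def)
    next
      case G: False
      have "nrm G \<bullet> q' = (1 - r) * (nrm G \<bullet> q) + r * (nrm G \<bullet> x)" by (simp add: q'_def inner_add_right)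
      also have "\<dots> \<le> (1 - r) * 1 + r * 1"
        using r qG[OF that(1)] x(2)[OF that G] by (intro add_mono mult_left_mono) auto
      finally show ?thesis by simp
    qed
    then have "q' \<in> P" using P_eq by blast
    moreover have "nrm F \<bullet> q' = 1" using rr by (simp add: q'_def inner_add_right \<alpha>_def \<xi>_def)
    ultimately have q'F: "q' \<in> F" using in_facet_iff[OF F] by blast
    \<comment> \<open>The position of \<open>z\<close> on the remaining segment from
      \<open>q'\<close> to \<open>x\<close>.\<close>
    define p where "p = (s - r) / (1 - r)"
    have p: "0 \<le> p" "p \<le> 1" using r \<open>s > r\<close> s by (auto simp: p_def field_simps)
    have "p * (1 - r) = s - r" using r by (simp add: p_def)
    then have p1: "(1 - p) * (1 - r) = 1 - s" "(1 - p) * r + p = s" by (simp_all add: algebra_simps)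
    have "(1 - p) *\<^sub>R q' + p *\<^sub>R x = ((1 - p) * (1 - r)) *\<^sub>R q + ((1 - p) * r + p) *\<^sub>R x"
      by (simp add: q'_def algebra_simps)
    then have "z = (1 - p) *\<^sub>R q' + p *\<^sub>R x" unfolding p1 s(4) by simp
    moreover have "(1 - p) *\<^sub>R q' + p *\<^sub>R x \<in> convex hull (insert x F)"
      using p q'F by (intro convexD_alt[OF convex_convex_hull]) (auto intro: hull_inc)
    ultimately show ?thesis by simp
  qed
next
  fix z assume "z \<in> P \<union> convex hull (insert x F)"
  then show "z \<in> convex hull (insert x P)"
    using hull_mono[of "insert x F" "insert x P" convex] facet_subset_P[OF F] hull_subset[of "insert x P" convex] by blast
qed

end

section \<open>Integrals under dilations and translations\<close>

lemma set_integral_scale: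
  fixes f :: "real^'n \<Rightarrow> real"
  assumes "s > 0" "S \<in> sets borel" "f \<in> borel_measurable borel"
  shows "(LINT x:(*\<^sub>R) s ` S|lborel. f x) = s ^ CARD('n) * (LINT x:S|lborel. f (s *\<^sub>R x))"
    and "(*\<^sub>R) s ` S \<in> sets borel"
proof -
  have im: "(*\<^sub>R) s ` S = (\<lambda>x. (1/s) *\<^sub>R x) -` S"
  proof safe
    fix x assume "(1/s) *\<^sub>R x \<in> S" then show "x \<in> (*\<^sub>R) s ` S"
      using assms(1) by (intro image_eqI[of _ _ "(1/s) *\<^sub>R x"]) simp_all
  qed (use assms(1) in simp)
  have "(\<lambda>x. (1/s) *\<^sub>R x) \<in> borel_measurable (borel :: (real^'n) measure)" by simp
  from measurable_sets[OF this assms(2)] show m[measurable]: "(*\<^sub>R) s ` S \<in> sets borel" by (simp add: im)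
  note assms(3)[measurable]
  have ind: "indicator ((*\<^sub>R) s ` S) (s *\<^sub>R x) = (indicator S x :: real)" for x
    using assms(1) by (simp add: im indicator_def)
  have "(LINT x:(*\<^sub>R) s ` S|lborel. f x) =
     (\<integral>x. indicator ((*\<^sub>R) s ` S) x * f x \<partial>density (distr lborel borel (\<lambda>x. 0 + s *\<^sub>R x)) (\<lambda>_. \<bar>s\<bar>^DIM(real^'n)))"
    unfolding set_lebesgue_integral_def using lborel_affine[of s "0 :: real^'n"] assms(1) by simp
  also have "\<dots> = (\<integral>x. \<bar>s\<bar>^CARD('n) * (indicator ((*\<^sub>R) s ` S) (s *\<^sub>R x) * f (s *\<^sub>R x)) \<partial>lborel)"
    by (subst integral_density) (simp_all add: integral_distr)
  finally show "(LINT x:(*\<^sub>R) s ` S|lborel. f x) = s ^ CARD('n) * (LINT x:S|lborel. f (s *\<^sub>R x))"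
    using assms(1) by (simp add: ind set_lebesgue_integral_def)
qed

lemma translation_borel:
  fixes S :: "(real^'n) set"
  assumes "S \<in> sets borel"
  shows "(\<lambda>x. c + x) ` S \<in> sets borel" "measure lborel ((\<lambda>x. c + x) ` S) = measure lborel S"
proof -
  have im: "(\<lambda>x. c + x) ` S = (\<lambda>x. x - c) -` S"
    by (force simp: image_iff)
  have "(\<lambda>x. x - c) \<in> borel_measurable borel" by simp
  from measurable_sets[OF this assms] show b: "(\<lambda>x. c + x) ` S \<in> sets borel" unfolding im by simp
  have "measure lebesgue ((\<lambda>x. c + x) ` S) = measure lebesgue S" by (rule measure_translation)
  then show "measure lborel ((\<lambda>x. c + x) ` S) = measure lborel S"
    using measure_completion[of "(\<lambda>x. c + x) ` S" lborel] measure_completion[of S lborel] b assms by (simp only: sets_lborel)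
qed

text \<open>Gives the first-order volume of the difference of two dilates of a cone, and likewise
  its second moment with the exponent raised by 2.\<close>

lemma power_difference_limit:
  "((\<lambda>t. ((1 + c * t) ^ p - (1 + d * t) ^ p) / t) \<longlongrightarrow> real p * (c - d)) (at_right (0::real))"
proof -
  have "((\<lambda>t. (1 + c * t) ^ p - (1 + d * t) ^ p) has_field_derivative real p * (c - d)) (at 0)"
    by (auto intro!: derivative_eq_intros simp: algebra_simps)
  then have "((\<lambda>t. ((1 + c * t) ^ p - (1 + d * t) ^ p) / t) \<longlongrightarrow> real p * (c - d)) (at 0)"
    by (simp add: has_field_derivative_def DERIV_def[unfolded has_field_derivative_def])
  then show ?thesis by (rule tendsto_within_subset) simp
qed

context centered_maximizer
begin

lemma near_hull_insert:
  assumes "z \<in> convex hull (insert x P)" "y \<in> P" "dist x y \<le> \<eta>" "\<eta> \<ge> 0"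
  shows "\<exists>p\<in>P. dist z p \<le> \<eta>"
proof -
  obtain s q where s: "0 \<le> s" "s \<le> 1" "q \<in> P" "z = (1 - s) *\<^sub>R q + s *\<^sub>R x"
    using assms(1) unfolding convex_hull_insert[OF P_basic(4)] hull_same[of convex, OF P_basic(2)]
    by auto
  have "(1 - s) *\<^sub>R q + s *\<^sub>R y \<in> P" using s assms(2) by (intro convexD_alt[OF P_basic(2)]) auto
  moreover have "dist z ((1 - s) *\<^sub>R q + s *\<^sub>R y) = s * dist x y"
    using s by (simp add: dist_norm scaleR_diff_right[symmetric])
  moreover have "s * dist x y \<le> 1 * \<eta>" using s assms by (intro mult_mono) auto
  ultimately show ?thesis by (metis mult_1)
qed

text \<open>The simplices over \<open>F\<close> with apices \<open>x k\<close> beyond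
  \<open>F\<close> are glued on, where \<open>x k\<close> tends to the vertex \<open>y\<close>. The
  mean of \<open>Q\<close> over such a simplex depends continuously on its vertices, so in the limit
  \<open>y\<close> counts twice, as a vertex of \<open>F\<close> and as apex. The first variation
  bounds this limit by \<open>n + 2\<close>.\<close>

lemma facet_add_condition:
  assumes F: "F facet_of P" "k simplex F" and y: "y \<in> vertices F"
  defines "S \<equiv> \<Sum>(vertices F)" and "n \<equiv> real CARD('n)"
  shows "Q (y + S) (y + S) + Q y y + (\<Sum>v\<in>vertices F. Q v v) \<le> (n + 1) * (n + 2)\<^sup>2"
proof -
  let ?V = "vertices F" and ?a = "nrm F"
  note V = simplicial_vertices[OF F]
  have yP: "y \<in> P" using y vertices_subset facet_subset_P[OF F(1)] by blast
  have "\<forall>k. \<exists>x. dist x y < 1 / real (Suc k) \<and> 1 < ?a \<bullet> x \<and> ?a \<bullet> x < 1 + 1 / real (Suc k) \<and> (\<forall>G. G facet_of P \<longrightarrow> G \<noteq> F \<longrightarrow> nrm G \<bullet> x \<le> 1)"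
    using point_beyond_facet[OF F y] by simp
  then obtain x where x: "\<And>k. dist (x k) y < 1 / real (Suc k)" "\<And>k. 1 < ?a \<bullet> x k" "\<And>k. ?a \<bullet> x k < 1 + 1 / real (Suc k)"
      "\<And>k G. G facet_of P \<Longrightarrow> G \<noteq> F \<Longrightarrow> nrm G \<bullet> x k \<le> 1"
    by metis
  have inv_le: "1 / real (Suc k) \<le> 1" for k by simp
  have xy: "x \<longlonglongrightarrow> y"
  proof (rule metric_LIMSEQ_I)
    fix r :: real assume "r > 0"
    then obtain N where N: "1 / real (Suc N) < r" using reals_Archimedean by (auto simp: inverse_eq_divide)
    have "dist (x k) y < r" if "k \<ge> N" for k
    proof -
      have "1 / real (Suc k) \<le> 1 / real (Suc N)" using that by (simp add: frac_le)
      then show ?thesis using x(1)[of k] N by linarith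
    qed
    then show "\<exists>N. \<forall>k\<ge>N. dist (x k) y < r" by blast
  qed
  obtain R0 where R0: "\<And>p. p \<in> P \<Longrightarrow> norm p \<le> R0" using P_basic(6) by (auto simp: bounded_iff)
  define R where "R = R0 + 1"
  have xR: "norm (x k) \<le> R" for k
    using R0[OF yP] x(1)[of k] inv_le[of k] norm_triangle_sub[of "x k" y] 
    unfolding R_def dist_norm by linarith
  have PR: "P \<subseteq> cball 0 R" using R0 by (force simp: R_def)
  define T where "T k = convex hull (insert (x k) ?V)" for k
  define K where "K k = convex hull (insert (x k) P)" for k
  have TF: "T k = convex hull (insert (x k) F)" for k
    unfolding T_def using hull_insert[of convex "x k" ?V] V(4) by simp
  have KPT: "K k = P \<union> T k" for k
    unfolding K_def TF using x by (intro hull_beyond_facet F) auto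
  have cT: "compact (T k)" for k unfolding T_def using V(1) by (intro finite_imp_compact_convex_hull) simp
  have cK: "compact (K k)" for k unfolding K_def using P_basic(1) by (intro compact_convex_hull compact_insert)
  have TR: "T k \<subseteq> cball 0 R" for k
    unfolding TF using xR PR facet_subset_P[OF F(1)] by (intro hull_minimal) auto
  have Ta: "T k \<subseteq> {z. 1 \<le> ?a \<bullet> z} \<inter> {z. ?a \<bullet> z \<le> 1 + 1 / real (Suc k)}" for k
  proof -
    have "insert (x k) F \<subseteq> {z. 1 \<le> ?a \<bullet> z} \<inter> {z. ?a \<bullet> z \<le> 1 + 1 / real (Suc k)}"
      using x(2,3)[of k] facet_nrm[OF F(1)] by (auto intro: less_imp_le)
    then show ?thesis unfolding TF
      by (intro hull_minimal convex_Int convex_halfspace_ge convex_halfspace_le)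
  qed
  obtain w :: "'n \<Rightarrow> real^'n" where w: "bij_betw w UNIV ?V"
    using finite_same_card_bij[of "UNIV :: 'n set" ?V] V by auto
  have wi: "inj w" "range w = ?V" using w by (auto simp: bij_betw_def)
  have wsum: "(\<Sum>i\<in>UNIV. f (w i)) = sum f ?V" for f :: "_ \<Rightarrow> 'b::comm_monoid_add"
    using sum.reindex_bij_betw[OF w] .
  have aw: "?a \<bullet> w i = 1" for i using wi(2) facet_nrm[OF F(1)] vertices_subset[of F] by blast
  \<comment> \<open>The glued simplex is nondegenerate: its apex is off the hyperplane of
    \<open>F\<close>, so applying the facet normal to a relation forces the coefficients to sum to
    0, and then the independence of the vertices applies.\<close>
  have ind: "independent (range (\<lambda>i. w i - x k))" for k
  proof (rule independent_if_scalars_zero)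
    fix f v assume s: "(\<Sum>v\<in>range (\<lambda>i. w i - x k). f v *\<^sub>R v) = 0" and v: "v \<in> range (\<lambda>i. w i - x k)"
    have inj: "inj (\<lambda>i. w i - x k)" using wi(1) by (auto simp: inj_def)
    define c where "c i = f (w i - x k)" for i
    have "(\<Sum>i\<in>UNIV. c i *\<^sub>R (w i - x k)) = 0" using s by (simp add: sum.reindex[OF inj] c_def)
    then have e: "(\<Sum>i\<in>UNIV. c i *\<^sub>R w i) = (\<Sum>i\<in>UNIV. c i) *\<^sub>R x k"
      by (simp add: scaleR_diff_right sum_subtractf scaleR_sum_left)
    have "?a \<bullet> (\<Sum>i\<in>UNIV. c i *\<^sub>R w i) = sum c UNIV" by (simp add: inner_sum_right aw)
    then have "sum c UNIV = sum c UNIV * (?a \<bullet> x k)" unfolding e by simp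
    then have c0: "sum c UNIV = 0" using x(2)[of k] by (simp add: mult_cancel_left1)
    then have "(\<Sum>i\<in>UNIV. c i *\<^sub>R w i) = 0" using e by simp
    then have "(\<Sum>v\<in>?V. c (inv w v) *\<^sub>R v) = 0"
      using wsum[of "\<lambda>v. c (inv w v) *\<^sub>R v"] wi(1) by simp
    then have cz: "\<forall>v\<in>?V. c (inv w v) = 0" using independentD[OF V(3) V(1) order_refl, of "\<lambda>v. c (inv w v)"] by blast
    obtain i where i: "v = w i - x k" using v by auto
    have "w i \<in> ?V" using wi(2) by blast
    then have "c (inv w (w i)) = 0" using cz by blast
    then show "f v = 0" using wi(1) by (simp add: c_def i)
  qed simp
  note simp_int = set_integral_simplex_quadratic[OF bilinear_Q Q_sym ind wi(1)]
  have Tw: "convex hull (insert (x k) (range w)) = T k" for k by (simp add: T_def wi(2))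
  have Tpos: "measure lborel (T k) > 0" for k using simp_int(2)[of k] unfolding Tw .
  \<comment> \<open>The simplex formula up to its factor, as a function of the apex
    \<open>z\<close>.\<close>
  define q where "q z = Q (z + S) (z + S) + Q z z + (\<Sum>v\<in>?V. Q v v)" for z
  have Tq: "(LINT z:T k|lborel. z \<bullet> (B *v z)) / measure lborel (T k) = q (x k) / ((n+1)*(n+2))" for k
    using simp_int(1)[of k] Tpos[of k] unfolding Tw
    by (simp add: Q_def[symmetric] wsum[of "\<lambda>v. v"] wsum[of "\<lambda>v. Q v v"] q_def S_def n_def)
  have "continuous_on UNIV q" unfolding q_def by (intro continuous_intros continuous_Q)
  then have "(\<lambda>k. q (x k)) \<longlonglongrightarrow> q y" 
    by (rule continuous_on_tendsto_compose[OF _ xy]) auto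
  then have lim: "(\<lambda>k. q (x k) / ((n+1)*(n+2))) \<longlonglongrightarrow> q y / ((n+1)*(n+2))" by (intro tendsto_intros) (auto simp: n_def)
  obtain \<epsilon> where \<epsilon>: "\<epsilon> > 0" "\<And>K. convex_body K \<Longrightarrow> (\<forall>x\<in>K. \<exists>y\<in>P. dist x y \<le> \<epsilon>) \<Longrightarrow> (\<forall>y\<in>P. \<exists>x\<in>K. dist y x \<le> \<epsilon>) \<Longrightarrow> isotropic_constant K \<le> isotropic_constant P"
    using maximal_near by blast
  have "1 * (q y / ((n+1)*(n+2)) - (real CARD('n) + 2)) \<le> 0"
  proof (rule first_variation[OF P_basic(5,6,7) mean B, where K = K and T = T and R = R])
    show "K k \<in> sets borel" "bounded (K k)" "T k \<in> sets borel" for k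
      using cK cT by (auto intro: borel_compact compact_imp_bounded)
    show "(\<lambda>k. measure lborel (T k)) \<longlonglongrightarrow> 0"
    proof (rule tendsto_sandwich[OF _ _ tendsto_const thin_slab[OF facet_normal_nz[OF F(1)], of R]])
      show "\<forall>\<^sub>F k in sequentially. measure lborel (T k) \<le> measure lborel (cball 0 R \<inter> {x. \<bar>?a \<bullet> x - 1\<bar> \<le> 1 / real (Suc k)})"
      proof (intro always_eventually allI measure_mono_fmeasurable)
        fix k
        show "T k \<subseteq> cball 0 R \<inter> {x. \<bar>?a \<bullet> x - 1\<bar> \<le> 1 / real (Suc k)}"
        proof (intro subsetI IntI CollectI)
          fix z assume z: "z \<in> T k"
          then have "1 \<le> ?a \<bullet> z" "?a \<bullet> z \<le> 1 + 1 / real (Suc k)" using Ta[of k] by auto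
          then show "\<bar>?a \<bullet> z - 1\<bar> \<le> 1 / real (Suc k)" by linarith
          show "z \<in> cball 0 R" using z TR by blast
        qed
        show "T k \<in> sets lborel" using cT by (simp add: borel_compact)
        have "compact (cball 0 R \<inter> {x. \<bar>?a \<bullet> x - 1\<bar> \<le> 1 / real (Suc k)})"
          by (intro compact_Int_closed compact_cball closed_Collect_le continuous_intros)
        then show "cball 0 R \<inter> {x. \<bar>?a \<bullet> x - 1\<bar> \<le> 1 / real (Suc k)} \<in> fmeasurable lborel"
          by (rule fmeasurable_compact)
      qed
    qed simp
    show "(LINT z:K k|lborel. f z) = (LINT z:P|lborel. f z) + 1 * (LINT z:T k|lborel. f z)" if f: "continuous_on UNIV f" for k and f :: "real^'n \<Rightarrow> real"
    proof -
      have ae: "AE z in lborel. \<not> (z \<in> P \<and> z \<in> T k)"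
        using null_hyperplane_lborel[OF facet_normal_nz[OF F(1)], of 1]
      proof eventually_elim
        case (elim z)
        show ?case
        proof
          assume "z \<in> P \<and> z \<in> T k"
          then have "?a \<bullet> z \<le> 1" "1 \<le> ?a \<bullet> z" using P_nrm[OF F(1)] Ta[of k] by auto
          with elim show False by simp
        qed
      qed
      show ?thesis unfolding KPT
        using ae f P_basic cT by (subst set_integral_Un_AE) (auto intro!: set_integrable_continuous_bounded compact_imp_bounded borel_compact)
    qed
    show "\<forall>\<^sub>F k in sequentially. isotropic_constant (K k) \<le> isotropic_constant P"
    proof -
      obtain N where N: "1 / real (Suc N) < \<epsilon>" using reals_Archimedean[OF \<epsilon>(1)] by (auto simp: inverse_eq_divide)
      have "isotropic_constant (K k) \<le> isotropic_constant P" if "k \<ge> N" for k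
      proof (rule \<epsilon>(2))
        have PK: "P \<subseteq> K k" by (simp add: KPT)
        then have "interior (K k) \<noteq> {}" using interior interior_mono by blast
        then show "convex_body (K k)" using cK by (simp add: convex_body_def K_def)
        have "1 / real (Suc k) \<le> 1 / real (Suc N)" using that by (simp add: frac_le)
        then have "dist (x k) y \<le> \<epsilon>" using x(1)[of k] N by linarith
        then show "\<forall>z\<in>K k. \<exists>p\<in>P. dist z p \<le> \<epsilon>"
          using near_hull_insert[OF _ yP] \<epsilon>(1) unfolding K_def by auto
        show "\<forall>p\<in>P. \<exists>z\<in>K k. dist p z \<le> \<epsilon>"
          using PK \<epsilon>(1) by (intro ballI bexI) auto
      qed
      then show ?thesis by (auto simp: eventually_sequentially)
    qed
    show "(\<lambda>k. (LINT z:T k|lborel. z \<bullet> (B *v z)) / measure lborel (T k)) \<longlonglongrightarrow> q y / ((n+1)*(n+2))"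
      unfolding Tq by (rule lim)
  qed (use TR Tpos in auto)
  then have "q y \<le> (n + 2) * ((n+1)*(n+2))" by (simp add: n_def pos_divide_le_eq)
  then show ?thesis by (simp add: q_def power2_eq_square mult_ac)
qed

text \<open>The slab \<open>T t\<close> cut off at \<open>F\<close> contains \<open>D t = C - (1 - t) C\<close>, where \<open>C\<close> is the cone over \<open>F\<close> with apex 0, and a
  translate of it lies in a difference of two dilates of \<open>C\<close> of asymptotically the same volume.\<close>

lemma facet_cut_condition:
  assumes F: "F facet_of P" "k simplex F"
  defines "S \<equiv> \<Sum>(vertices F)" and "n \<equiv> real CARD('n)"
  shows "Q S S + (\<Sum>v\<in>vertices F. Q v v) \<ge> n * (n + 1) * (n + 2)"
proof -
  let ?V = "vertices F" and ?a = "nrm F"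
  let ?m = "measure lborel :: (real^'n) set \<Rightarrow> real"
  note V = simplicial_vertices[OF F]
  have n: "n > 0" by (simp add: n_def)
  have av: "?a \<bullet> v = 1" if "v \<in> ?V" for v using that facet_nrm[OF F(1)] vertices_subset[of F] by blast
  obtain Y where Y: "\<And>v. linear (Y v)" "\<And>x. (\<Sum>v\<in>?V. Y v x *\<^sub>R v) = x"
    "\<And>v w. v \<in> ?V \<Longrightarrow> w \<in> ?V \<Longrightarrow> Y v w = (if v = w then 1 else (0::real))"
    by (rule basis_coordinates[OF V(1,3,5)]) blast
  note hull = convex_hull_basis[where V = "vertices F" and y = Y and c = "nrm F", OF V(1) Y av]
  have P0: "0 \<in> P" using zero_in_interior interior_subset by blast
  define C where "C = convex hull (insert 0 ?V)"
  have C_eq: "C = {x. (\<forall>v\<in>?V. 0 \<le> Y v x) \<and> ?a \<bullet> x \<le> 1}" unfolding C_def by (rule hull(3))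
  have VP: "?V \<subseteq> P" using vertices_subset facet_subset_P[OF F(1)] by blast
  have CP: "C \<subseteq> P" unfolding C_def using P0 VP P_basic(2) by (intro hull_minimal) auto
  have cC: "compact C" unfolding C_def using V(1) by (intro finite_imp_compact_convex_hull) simp
  have CB: "C \<in> sets borel" using cC by (rule borel_compact)
  obtain R where R: "\<And>p. p \<in> P \<Longrightarrow> norm p \<le> R" using P_basic(6) by (auto simp: bounded_iff)
  have cQ: "continuous_on UNIV (\<lambda>x. Q x x)" by (intro continuous_Q continuous_intros)
  have bQ: "(\<lambda>x. Q x x) \<in> borel_measurable borel" using cQ by (rule borel_measurable_continuous_onI)
  obtain M where M: "\<And>x. x \<in> P \<Longrightarrow> \<bar>Q x x\<bar> \<le> M"
    using compact_imp_bounded[OF compact_continuous_image[OF continuous_on_subset[OF cQ] P_basic(1)]]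
    by (auto simp: bounded_iff)
  obtain w :: "'n \<Rightarrow> real^'n" where w: "bij_betw w UNIV ?V"
    using finite_same_card_bij[of "UNIV :: 'n set" ?V] V by auto
  have wi: "inj w" "range w = ?V" using w by (auto simp: bij_betw_def)
  have wsum: "(\<Sum>i\<in>UNIV. f (w i)) = sum f ?V" for f :: "_ \<Rightarrow> 'b::comm_monoid_add"
    using sum.reindex_bij_betw[OF w] .
  have "independent (range (\<lambda>i. w i - 0))" using wi(2) V(3) by simp
  note simp_int = set_integral_simplex_quadratic[OF bilinear_Q Q_sym this wi(1)]
  \<comment> \<open>The mean of \<open>Q x x\<close> over the cone \<open>C\<close>, from the
    simplex formula with the vertex 0.\<close>
  define \<kappa> where "\<kappa> = (Q S S + (\<Sum>v\<in>?V. Q v v)) / ((n+1)*(n+2))"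
  define vC where "vC = ?m C"
  have vC: "vC > 0" using simp_int(2) by (simp add: wi(2) vC_def C_def)
  have QC: "(LINT x:C|lborel. Q x x) = vC * \<kappa>"
    using simp_int(1) unfolding wi(2) C_def[symmetric] vC_def[symmetric]
    by (simp add: wsum[of "\<lambda>v. v"] wsum[of "\<lambda>v. Q v v"] \<kappa>_def S_def n_def Q_simps)
  have sC: "(*\<^sub>R) s ` C = {x. (\<forall>v\<in>?V. 0 \<le> Y v x) \<and> ?a \<bullet> x \<le> s}" if s: "s > 0" for s
  proof safe
    fix x assume x: "\<forall>v\<in>?V. 0 \<le> Y v x" "?a \<bullet> x \<le> s"
    have "(1/s) *\<^sub>R x \<in> C" using s x by (simp add: C_eq linear_cmul[OF Y(1)])
    then show "x \<in> (*\<^sub>R) s ` C" using s by (intro image_eqI[of _ _ "(1/s) *\<^sub>R x"]) simp_all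
  qed (use s in \<open>simp_all add: C_eq linear_cmul[OF Y(1)] mult_left_le\<close>)
  have sCB: "(*\<^sub>R) s ` C \<in> sets borel" if "s > 0" for s using set_integral_scale(2)[OF that CB, of "\<lambda>_. 0"] by simp
  have msC: "?m ((*\<^sub>R) s ` C) = s ^ CARD('n) * vC" if "s > 0" for s
    using set_integral_scale(1)[OF that CB, of "\<lambda>_. 1"] by (simp add: set_integral_const_one vC_def)
  have QsC: "(LINT x:(*\<^sub>R) s ` C|lborel. Q x x) = s ^ (CARD('n) + 2) * (vC * \<kappa>)" if "s > 0" for s
    using set_integral_scale(1)[OF that CB bQ] by (simp add: Q_simps QC power_add power2_eq_square mult.assoc)
  have sCb: "bounded ((*\<^sub>R) s ` C)" for s
    using cC by (intro compact_imp_bounded compact_scaling)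
  have finb: "emeasure lborel A < \<infinity>" if "bounded A" for A :: "(real^'n) set" using that by (rule emeasure_bounded_finite)
  have subC: "(*\<^sub>R) s ` C \<subseteq> (*\<^sub>R) s' ` C" if "0 < s" "s \<le> s'" for s s'
    using that by (auto simp: sC)
  have mdiff: "?m ((*\<^sub>R) s' ` C - (*\<^sub>R) s ` C) = (s' ^ CARD('n) - s ^ CARD('n)) * vC" if "0 < s" "s \<le> s'" for s s'
  proof -
    have "?m ((*\<^sub>R) s' ` C - (*\<^sub>R) s ` C) = ?m ((*\<^sub>R) s' ` C) - ?m ((*\<^sub>R) s ` C)"
      using that finb[OF sCb] by (intro measure_Diff) (auto simp: sCB subC less_top[symmetric])
    then show ?thesis using that by (simp add: msC left_diff_distrib)
  qed
  obtain U where U: "finite U" "P = convex hull U" using polytope by (auto simp: polytope_def)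
  \<comment> \<open>The coordinates are nonnegative on \<open>F\<close>, so on \<open>P\<close> they
    can be negative at most in proportion to \<open>1 - ?a \<bullet> x\<close>. It suffices to take
    the largest ratio over the generators \<open>U\<close>; those on \<open>F\<close> are treated
    separately.\<close>
  obtain K where K: "K \<ge> 0" "\<And>x v. x \<in> P \<Longrightarrow> v \<in> ?V \<Longrightarrow> 0 \<le> Y v x + K * (1 - ?a \<bullet> x)"
  proof -
    define K where "K = Max (insert 0 ((\<lambda>(v,u). - Y v u / (1 - ?a \<bullet> u)) ` (?V \<times> U)))"
    have fin: "finite (insert 0 ((\<lambda>(v,u). - Y v u / (1 - ?a \<bullet> u)) ` (?V \<times> U)))" using V(1) U(1) by simp
    have K0: "K \<ge> 0" unfolding K_def using fin by (intro Max_ge) auto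
    have "0 \<le> Y v x + K * (1 - ?a \<bullet> x)" if x: "x \<in> P" and v: "v \<in> ?V" for x v
    proof -
      have "U \<subseteq> {x. 0 \<le> Y v x + K * (1 - ?a \<bullet> x)}"
      proof safe
        fix u assume u: "u \<in> U"
        have uP: "u \<in> P" unfolding U(2) using u by (rule hull_inc)
        show "0 \<le> Y v u + K * (1 - ?a \<bullet> u)"
        proof (cases "?a \<bullet> u = 1")
          case True
          then have "u \<in> F" using in_facet_iff[OF F(1) uP] by simp
          then have "u \<in> convex hull ?V" using V(4) by simp
          then have "u \<in> {x. (\<forall>v\<in>?V. 0 \<le> Y v x) \<and> ?a \<bullet> x = 1}" using hull(2) by simp
          then show ?thesis using True v by simp
        next
          case False
          then have lt: "?a \<bullet> u < 1" using P_nrm[OF F(1) uP] by simp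
          have "- Y v u / (1 - ?a \<bullet> u) \<le> K" unfolding K_def using fin u v by (intro Max_ge) auto
          then have "- Y v u \<le> K * (1 - ?a \<bullet> u)" using pos_divide_le_eq[of "1 - ?a \<bullet> u" "- Y v u" K] lt by linarith
          then show ?thesis by linarith
        qed
      qed
      moreover have "convex {x. 0 \<le> Y v x + K * (1 - ?a \<bullet> x)}"
        unfolding convex_alt
      proof safe
        fix x y and u :: real
        assume "0 \<le> Y v x + K * (1 - ?a \<bullet> x)" "0 \<le> Y v y + K * (1 - ?a \<bullet> y)" "0 \<le> u" "u \<le> 1"
        then have "0 \<le> (1 - u) * (Y v x + K * (1 - ?a \<bullet> x)) + u * (Y v y + K * (1 - ?a \<bullet> y))" by simp
        also have "\<dots> = Y v ((1 - u) *\<^sub>R x + u *\<^sub>R y) + K * (1 - ?a \<bullet> ((1 - u) *\<^sub>R x + u *\<^sub>R y))"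
          by (simp add: linear_add[OF Y(1)] linear_diff[OF Y(1)] linear_cmul[OF Y(1)] inner_add_right algebra_simps)
        finally show "0 \<le> Y v ((1 - u) *\<^sub>R x + u *\<^sub>R y) + K * (1 - ?a \<bullet> ((1 - u) *\<^sub>R x + u *\<^sub>R y))" .
      qed
      ultimately have "convex hull U \<subseteq> {x. 0 \<le> Y v x + K * (1 - ?a \<bullet> x)}" by (rule hull_minimal)
      then show ?thesis using x U(2) by blast
    qed
    with K0 show thesis by (rule that)
  qed
  \<comment> \<open>Translation by \<open>(K * t) *\<^sub>R S\<close> raises
    \<open>?a \<bullet> x\<close> by \<open>c * t\<close>, since
    \<open>?a \<bullet> S = n\<close>.\<close>
  define c where "c = n * K"
  have c: "c \<ge> 0" using K(1) n by (simp add: c_def)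
  define T where "T t = P \<inter> {x. 1 - t < ?a \<bullet> x}" for t
  have TB: "T t \<in> sets borel" for t
    unfolding T_def by (rule sets.Int[OF P_basic(5)]) (intro borel_open open_Collect_less continuous_intros)
  have Tb: "bounded (T t)" for t using P_basic(6) by (rule bounded_subset) (auto simp: T_def)
  define D where "D t = C - (*\<^sub>R) (1 - t) ` C" for t
  have DT: "D t \<subseteq> T t" if "0 < t" "t < 1" for t
  proof
    fix x assume "x \<in> D t"
    then have "x \<in> C" "x \<notin> {x. (\<forall>v\<in>?V. 0 \<le> Y v x) \<and> ?a \<bullet> x \<le> 1 - t}"
      using sC[of "1 - t"] that unfolding D_def by auto
    then show "x \<in> T t" using CP by (auto simp: C_eq T_def)
  qed
  have DB: "D t \<in> sets borel" "bounded (D t)" if "0 < t" "t < 1" for t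
    using that CB sCB[of "1-t"] bounded_diff[OF compact_imp_bounded[OF cC]] by (auto simp: D_def)
  have mD: "?m (D t) = (1 - (1 - t) ^ CARD('n)) * vC" if "0 < t" "t < 1" for t
    using mdiff[of "1 - t" 1] that by (simp add: D_def)
  have QD: "(LINT x:D t|lborel. Q x x) = (1 - (1 - t) ^ (CARD('n) + 2)) * (vC * \<kappa>)" if t: "0 < t" "t < 1" for t
  proof -
    have sub: "(*\<^sub>R) (1 - t) ` C \<subseteq> C" using subC[of "1 - t" 1] t by simp
    have un: "C = D t \<union> (*\<^sub>R) (1 - t) ` C" using sub by (auto simp: D_def)
    have "(LINT x:C|lborel. Q x x) = (LINT x:D t|lborel. Q x x) + (LINT x:(*\<^sub>R) (1 - t) ` C|lborel. Q x x)"
      using DB[OF t] sCB[of "1-t"] sCb t by (subst un, subst set_integral_Un) (auto simp: D_def intro!: set_integrable_continuous_bounded cQ)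
    then show ?thesis using t by (simp add: QC QsC left_diff_distrib)
  qed
  have mT: "?m (T t) \<le> ((1 + c * t) ^ CARD('n) - (1 + (c - 1) * t) ^ CARD('n)) * vC" if t: "0 < t" "t < 1" for t
  proof -
    have ct: "c * t \<ge> 0" using c t by simp
    have pos: "1 + (c - 1) * t > 0" using ct t by (simp add: left_diff_distrib)
    \<comment> \<open>The translation raises every coordinate by \<open>K * t\<close>. On the slab
      this makes all of them nonnegative, so the slab lands in a layer of the infinite cone, that
      is, in a difference of dilates of \<open>C\<close>.\<close>
    have "(\<lambda>x. (K * t) *\<^sub>R S + x) ` T t \<subseteq> (*\<^sub>R) (1 + c * t) ` C - (*\<^sub>R) (1 + (c - 1) * t) ` C"
    proof (rule image_subsetI)
      fix x assume x: "x \<in> T t"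
      have xP: "x \<in> P" and xt: "1 - ?a \<bullet> x < t" "?a \<bullet> x \<le> 1" using x P_nrm[OF F(1)] by (auto simp: T_def)
      have aS: "?a \<bullet> S = n" using av V(2) by (simp add: S_def inner_sum_right n_def)
      have az: "?a \<bullet> ((K * t) *\<^sub>R S + x) = c * t + ?a \<bullet> x" by (simp add: inner_add_right aS c_def)
      have "0 \<le> Y v ((K * t) *\<^sub>R S + x)" if v: "v \<in> ?V" for v
      proof -
        have "Y v S = (\<Sum>w\<in>?V. Y v w)" unfolding S_def using linear_sum[OF Y(1)] by blast
        also have "\<dots> = 1" using v V(1) by (simp add: Y(3))
        finally have "Y v ((K * t) *\<^sub>R S + x) = K * t + Y v x" by (simp add: linear_add[OF Y(1)] linear_cmul[OF Y(1)])
        moreover have "K * (1 - ?a \<bullet> x) \<le> K * t" using K(1) xt by (intro mult_left_mono) auto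
        ultimately show ?thesis using K(2)[OF xP v] by linarith
      qed
      then have "(K * t) *\<^sub>R S + x \<in> (*\<^sub>R) (1 + c * t) ` C"
        using ct xt by (subst sC) (auto simp: az)
      moreover have "(K * t) *\<^sub>R S + x \<notin> (*\<^sub>R) (1 + (c - 1) * t) ` C"
      proof
        assume "(K * t) *\<^sub>R S + x \<in> (*\<^sub>R) (1 + (c - 1) * t) ` C"
        then have "c * t + ?a \<bullet> x \<le> 1 + (c - 1) * t" using sC[OF pos] by (auto simp: az)
        then show False using xt by (simp add: left_diff_distrib)
      qed
      ultimately show "(K * t) *\<^sub>R S + x \<in> (*\<^sub>R) (1 + c * t) ` C - (*\<^sub>R) (1 + (c - 1) * t) ` C" by blast
    qed
    moreover have "?m ((\<lambda>x. (K * t) *\<^sub>R S + x) ` T t) = ?m (T t)"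
      by (rule translation_borel(2)[OF TB])
    moreover have "(*\<^sub>R) (1 + c * t) ` C - (*\<^sub>R) (1 + (c - 1) * t) ` C \<in> fmeasurable lborel"
      using ct pos sCB sCb by (intro fmeasurableI finb bounded_diff) auto
    moreover have "(\<lambda>x. (K * t) *\<^sub>R S + x) ` T t \<in> sets lborel"
      using translation_borel(1)[OF TB] by simp
    ultimately have "?m (T t) \<le> ?m ((*\<^sub>R) (1 + c * t) ` C - (*\<^sub>R) (1 + (c - 1) * t) ` C)"
      using measure_mono_fmeasurable by metis
    also have "\<dots> = ((1 + c * t) ^ CARD('n) - (1 + (c - 1) * t) ^ CARD('n)) * vC"
      using pos t by (intro mdiff) (auto simp: left_diff_distrib)
    finally show ?thesis .
  qed
  have mDT: "?m (T t) = ?m (D t) + ?m (T t - D t)" if t: "0 < t" "t < 1" for t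
    using measure_Diff[of lborel "T t" "D t"] finb[OF Tb] DB[OF t] TB DT[OF t] by (simp add: less_top[symmetric])
  have mT': "?m (D t) \<le> ?m (T t)" if t: "0 < t" "t < 1" for t using mDT[OF t] by simp
  have ev: "\<forall>\<^sub>F t in at_right (0::real). 0 < t \<and> t < 1"
    by (auto intro!: eventually_at_rightI[of 0 1])
  have limD: "((\<lambda>t. ?m (D t) / t) \<longlongrightarrow> n * vC) (at_right 0)"
  proof -
    have "((\<lambda>t. (1 - (1 - t) ^ CARD('n)) / t * vC) \<longlongrightarrow> n * vC) (at_right 0)"
      using tendsto_mult[OF power_difference_limit[of 0 "CARD('n)" "-1"] tendsto_const[of vC]] by (simp add: n_def)
    moreover have "\<forall>\<^sub>F t in at_right 0. (1 - (1 - t) ^ CARD('n)) / t * vC = ?m (D t) / t"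
      using ev by eventually_elim (simp add: mD)
    ultimately show ?thesis by (rule Lim_transform_eventually)
  qed
  have limT: "((\<lambda>t. ?m (T t) / t) \<longlongrightarrow> n * vC) (at_right 0)"
  proof (rule tendsto_sandwich[OF _ _ limD])
    show "\<forall>\<^sub>F t in at_right 0. ?m (D t) / t \<le> ?m (T t) / t"
      using ev by eventually_elim (simp add: mT' divide_right_mono)
    show "\<forall>\<^sub>F t in at_right 0. ?m (T t) / t \<le> ((1 + c * t) ^ CARD('n) - (1 + (c - 1) * t) ^ CARD('n)) / t * vC"
      using ev by eventually_elim (use mT in \<open>simp add: divide_right_mono\<close>)
    have "((\<lambda>t. ((1 + c * t) ^ CARD('n) - (1 + (c - 1) * t) ^ CARD('n)) / t * vC) \<longlongrightarrow> n * (c - (c - 1)) * vC) (at_right 0)"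
      unfolding n_def by (intro tendsto_mult power_difference_limit tendsto_const)
    then show "((\<lambda>t. ((1 + c * t) ^ CARD('n) - (1 + (c - 1) * t) ^ CARD('n)) / t * vC) \<longlongrightarrow> n * vC) (at_right 0)" by simp
  qed
  have limQD: "((\<lambda>t. (LINT x:D t|lborel. Q x x) / t) \<longlongrightarrow> (n + 2) * (vC * \<kappa>)) (at_right 0)"
  proof -
    have "((\<lambda>t. (1 - (1 - t) ^ (CARD('n) + 2)) / t * (vC * \<kappa>)) \<longlongrightarrow> (n + 2) * (vC * \<kappa>)) (at_right 0)"
      using tendsto_mult[OF power_difference_limit[of 0 "CARD('n) + 2" "-1"] tendsto_const[of "vC * \<kappa>"]] by (simp add: n_def add.commute)
    moreover have "\<forall>\<^sub>F t in at_right 0. (1 - (1 - t) ^ (CARD('n) + 2)) / t * (vC * \<kappa>) = (LINT x:D t|lborel. Q x x) / t"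
      using ev by eventually_elim (simp add: QD)
    ultimately show ?thesis by (rule Lim_transform_eventually)
  qed
  \<comment> \<open>The parts of the slab outside \<open>D t\<close> have volume o(t), and
    \<open>Q x x\<close> is bounded on \<open>P\<close>; so they do not affect the limit.\<close>
  have limQT: "((\<lambda>t. (LINT x:T t|lborel. Q x x) / t) \<longlongrightarrow> (n + 2) * (vC * \<kappa>)) (at_right 0)"
  proof -
    have "((\<lambda>t. (LINT x:T t|lborel. Q x x) / t - (LINT x:D t|lborel. Q x x) / t) \<longlongrightarrow> 0) (at_right 0)"
    proof (rule Lim_null_comparison)
      show "\<forall>\<^sub>F t in at_right 0. norm ((LINT x:T t|lborel. Q x x) / t - (LINT x:D t|lborel. Q x x) / t) \<le> M * (?m (T t) / t - ?m (D t) / t)"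
        using ev
      proof eventually_elim
        case (elim t)
        then have t: "0 < t" "t < 1" by auto
        have TDB: "T t - D t \<in> sets borel" "bounded (T t - D t)" using TB DB[OF t] Tb bounded_diff by auto
        have un: "T t = D t \<union> (T t - D t)" using DT[OF t] by blast
        have "(LINT x:T t|lborel. Q x x) = (LINT x:D t|lborel. Q x x) + (LINT x:T t - D t|lborel. Q x x)"
          using DB[OF t] TDB by (subst un, subst set_integral_Un) (auto intro!: set_integrable_continuous_bounded cQ)
        moreover have "\<bar>LINT x:T t - D t|lborel. Q x x\<bar> \<le> M * ?m (T t - D t)"
          using TDB finb[OF TDB(2)] M by (intro set_integral_abs_bound set_integrable_continuous_bounded cQ) (auto simp: T_def)
        ultimately show ?case using mDT[OF t] t
          by (simp add: diff_divide_distrib[symmetric] add_divide_distrib abs_div_pos[symmetric] divide_right_mono)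
      qed
      have "((\<lambda>t. M * (?m (T t) / t - ?m (D t) / t)) \<longlongrightarrow> M * (n * vC - n * vC)) (at_right 0)"
        by (intro tendsto_intros limT limD)
      then show "((\<lambda>t. M * (?m (T t) / t - ?m (D t) / t)) \<longlongrightarrow> 0) (at_right 0)" by simp
    qed
    from tendsto_add[OF this limQD] show ?thesis by simp
  qed
  define \<rho> where "\<rho> = (n + 2) * (vC * \<kappa>) / (n * vC)"
  have lim\<rho>: "((\<lambda>t. (LINT x:T t|lborel. Q x x) / ?m (T t)) \<longlongrightarrow> \<rho>) (at_right 0)"
  proof -
    have "((\<lambda>t. ((LINT x:T t|lborel. Q x x) / t) / (?m (T t) / t)) \<longlongrightarrow> \<rho>) (at_right 0)"
      unfolding \<rho>_def using n vC by (intro tendsto_divide limQT limT) simp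
    moreover have "\<forall>\<^sub>F t in at_right 0. ((LINT x:T t|lborel. Q x x) / t) / (?m (T t) / t) = (LINT x:T t|lborel. Q x x) / ?m (T t)"
      using ev by eventually_elim simp
    ultimately show ?thesis by (rule Lim_transform_eventually)
  qed
  \<comment> \<open>The index shift by two keeps every \<open>t k\<close> strictly below 1.\<close>
  define t where "t k = 1 / real (Suc (Suc k))" for k
  have t: "0 < t k" "t k < 1" for k by (simp_all add: t_def)
  have t0: "t \<longlonglongrightarrow> 0"
    unfolding t_def using LIMSEQ_Suc[OF LIMSEQ_inverse_real_of_nat] by (simp add: inverse_eq_divide)
  have tr: "filterlim t (at_right 0) sequentially"
    using t0 t by (intro tendsto_imp_filterlim_at_right) auto
  obtain \<epsilon> where \<epsilon>: "\<epsilon> > 0" "\<And>K. convex_body K \<Longrightarrow> (\<forall>x\<in>K. \<exists>y\<in>P. dist x y \<le> \<epsilon>) \<Longrightarrow> (\<forall>y\<in>P. \<exists>x\<in>K. dist y x \<le> \<epsilon>) \<Longrightarrow> isotropic_constant K \<le> isotropic_constant P"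
    using maximal_near by blast
  define L where "L k = P \<inter> {x. ?a \<bullet> x \<le> 1 - t k}" for k
  have cL: "compact (L k)" for k
    unfolding L_def using P_basic(1) by (intro compact_Int_closed closed_Collect_le continuous_intros)
  have "-1 * (\<rho> - (real CARD('n) + 2)) \<le> 0"
  proof (rule first_variation[OF P_basic(5,6,7) mean B, where K = L and T = "\<lambda>k. T (t k)" and R = R])
    show "L k \<in> sets borel" "bounded (L k)" for k using cL by (auto intro: borel_compact compact_imp_bounded)
    show "T (t k) \<subseteq> cball 0 R" for k using R by (auto simp: T_def)
    show "measure lborel (T (t k)) > 0" for k
    proof -
      have "(1 - t k) ^ CARD('n) < 1" using t[of k] by (intro power_less_one_iff[THEN iffD2]) auto
      then have "?m (D (t k)) > 0" using t vC by (simp add: mD)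
      then show ?thesis using mT'[OF t] by (rule less_le_trans)
    qed
    show "(\<lambda>k. measure lborel (T (t k))) \<longlonglongrightarrow> 0"
    proof -
      have "((\<lambda>t. (?m (T t) / t) * t) \<longlongrightarrow> (n * vC) * 0) (at_right 0)"
        by (intro tendsto_mult limT tendsto_ident_at)
      moreover have "\<forall>\<^sub>F t in at_right 0. (?m (T t) / t) * t = ?m (T t)" using ev by eventually_elim simp
      ultimately have "((\<lambda>t. ?m (T t)) \<longlongrightarrow> (n * vC) * 0) (at_right 0)" by (rule Lim_transform_eventually)
      from filterlim_compose[OF this tr] show ?thesis by simp
    qed
    show "(LINT x:L k|lborel. f x) = (LINT x:P|lborel. f x) + (-1) * (LINT x:T (t k)|lborel. f x)" if f: "continuous_on UNIV f" for k and f :: "real^'n \<Rightarrow> real"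
    proof -
      have un: "P = L k \<union> T (t k)" by (auto simp: L_def T_def)
      have "(LINT x:P|lborel. f x) = (LINT x:L k|lborel. f x) + (LINT x:T (t k)|lborel. f x)"
        using f cL TB Tb by (subst un, subst set_integral_Un) (auto simp: L_def T_def intro!: set_integrable_continuous_bounded intro: borel_compact compact_imp_bounded)
      then show ?thesis by simp
    qed
    show "\<forall>\<^sub>F k in sequentially. isotropic_constant (L k) \<le> isotropic_constant P"
    proof -
      have "(\<lambda>k. t k * R) \<longlonglongrightarrow> 0 * R" by (intro tendsto_intros t0)
      then have "\<forall>\<^sub>F k in sequentially. t k * R < \<epsilon>" using \<epsilon>(1) by (intro order_tendstoD(2)) auto
      then show ?thesis
      proof eventually_elim
        case (elim k)
        show ?case
        proof (rule \<epsilon>(2))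
          have "0 \<in> interior P \<inter> {x. ?a \<bullet> x < 1 - t k}" using zero_in_interior t[of k] by simp
          moreover have "interior P \<inter> {x. ?a \<bullet> x < 1 - t k} \<subseteq> L k" using interior_subset by (auto simp: L_def)
          moreover have "open (interior P \<inter> {x. ?a \<bullet> x < 1 - t k})"
            by (intro open_Int open_interior open_Collect_less continuous_intros)
          ultimately have "0 \<in> interior (L k)" by (meson interiorI)
          moreover have "convex (L k)" unfolding L_def using P_basic(2) by (intro convex_Int convex_halfspace_le)
          ultimately show "convex_body (L k)" using cL by (auto simp: convex_body_def)
          show "\<forall>x\<in>L k. \<exists>y\<in>P. dist x y \<le> \<epsilon>" using \<epsilon>(1) by (intro ballI bexI) (auto simp: L_def)
          \<comment> \<open>Shrinking \<open>P\<close> towards 0 by the factor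
            \<open>1 - t k\<close> maps it into \<open>L k\<close>.\<close>
          show "\<forall>y\<in>P. \<exists>x\<in>L k. dist y x \<le> \<epsilon>"
          proof
            fix y assume y: "y \<in> P"
            have "(1 - t k) *\<^sub>R y + t k *\<^sub>R 0 \<in> P" using y P0 t[of k] by (intro convexD_alt[OF P_basic(2)]) auto
            moreover have "?a \<bullet> ((1 - t k) *\<^sub>R y) \<le> 1 - t k"
              using mult_left_mono[OF P_nrm[OF F(1) y], of "1 - t k"] t[of k] by simp
            moreover have "dist y ((1 - t k) *\<^sub>R y) \<le> \<epsilon>"
            proof -
              have "y - (1 - t k) *\<^sub>R y = t k *\<^sub>R y" by (simp add: algebra_simps)
              then have "dist y ((1 - t k) *\<^sub>R y) = t k * norm y" using t[of k] by (simp add: dist_norm)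
              also have "\<dots> \<le> t k * R" using R[OF y] t[of k] by simp
              finally show ?thesis using elim by simp
            qed
            ultimately show "\<exists>x\<in>L k. dist y x \<le> \<epsilon>" by (intro bexI[of _ "(1 - t k) *\<^sub>R y"]) (auto simp: L_def)
          qed
        qed
      qed
    qed
    show "(\<lambda>k. (LINT x:T (t k)|lborel. x \<bullet> (B *v x)) / measure lborel (T (t k))) \<longlonglongrightarrow> \<rho>"
      using filterlim_compose[OF lim\<rho> tr] by (simp add: Q_def)
  qed (use TB in auto)
  then have "n + 2 \<le> \<rho>" by (simp add: n_def)
  also have "\<rho> = (Q S S + (\<Sum>v\<in>?V. Q v v)) / (n * (n + 1))"
  proof -
    have "\<rho> = (n + 2) * \<kappa> / n" using vC by (simp add: \<rho>_def)
    also have "\<dots> = (Q S S + (\<Sum>v\<in>?V. Q v v)) / (n * (n + 1))"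
    proof -
      have "(n + 2) * (E / ((n+1)*(n+2))) / n = E / (n * (n + 1))" for E :: real
        using n by (simp add: divide_simps)
      then show ?thesis unfolding \<kappa>_def .
    qed
    finally show ?thesis .
  qed
  finally have "(n + 2) * (n * (n + 1)) \<le> Q S S + (\<Sum>v\<in>?V. Q v v)"
    using n pos_le_divide_eq[of "n * (n + 1)"] by simp
  then show ?thesis by (simp add: mult_ac)
qed

text \<open>Summed over the n vertices, the gluing inequalities \<open>f v \<le> b\<close> bound
  \<open>E\<close> from above by exactly the value that cutting gives as a lower bound. Hence every
  one of them is an equality.\<close>

lemma simplicial_equations:
  assumes F: "F facet_of P" "k simplex F"
  defines "S \<equiv> \<Sum>(vertices F)" and "n \<equiv> real CARD('n)"
  shows "Q S S + (\<Sum>v\<in>vertices F. Q v v) = n * (n + 1) * (n + 2)"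
    and "\<And>v. v \<in> vertices F \<Longrightarrow> Q v S + Q v v = (n + 1) * (n + 2)"
proof -
  let ?V = "vertices F"
  note V = simplicial_vertices[OF F]
  define E where "E = Q S S + (\<Sum>v\<in>?V. Q v v)"
  define b where "b = (n + 1) * (n + 2)\<^sup>2"
  define f where "f v = E + 2 * (Q v S + Q v v)" for v
  have n: "n > 0" by (simp add: n_def)
  have fb: "f v \<le> b" if "v \<in> ?V" for v
  proof -
    have "Q (v + S) (v + S) = Q v v + 2 * Q v S + Q S S" using Q_sym[of S v] by (simp add: Q_simps)
    then show ?thesis using facet_add_condition[OF F that] unfolding f_def E_def b_def S_def n_def by simp
  qed
  have sumf: "sum f ?V = (n + 2) * E"
  proof -
    have "sum f ?V = n * E + 2 * ((\<Sum>v\<in>?V. Q v S) + (\<Sum>v\<in>?V. Q v v))"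
      by (simp add: f_def sum.distrib sum_distrib_left[symmetric] V(2) n_def)
    also have "(\<Sum>v\<in>?V. Q v S) = Q S S" using Q_sum(1)[of "\<lambda>v. v" ?V S] by (simp add: S_def)
    finally show ?thesis by (simp add: E_def algebra_simps)
  qed
  have Ege: "E \<ge> n * (n + 1) * (n + 2)" using facet_cut_condition[OF F] by (simp add: E_def S_def n_def)
  have "(\<Sum>v\<in>?V. b - f v) = n * b - (n + 2) * E" by (simp add: sum_subtractf sumf V(2) n_def)
  also have "\<dots> \<le> n * b - (n + 2) * (n * (n + 1) * (n + 2))"
    using Ege n by (intro diff_left_mono mult_left_mono) auto
  also have "\<dots> = 0" by (simp add: b_def power2_eq_square algebra_simps)
  finally have "(\<Sum>v\<in>?V. b - f v) \<le> 0" .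
  moreover have "(\<Sum>v\<in>?V. b - f v) \<ge> 0" using fb by (intro sum_nonneg) simp
  ultimately have s0: "(\<Sum>v\<in>?V. b - f v) = 0" by simp
  then have "n * b = (n + 2) * E" by (simp add: sum_subtractf sumf V(2) n_def)
  then have "(n + 2) * E = (n + 2) * (n * (n + 1) * (n + 2))" by (simp add: b_def power2_eq_square algebra_simps)
  then have E: "E = n * (n + 1) * (n + 2)" using n by simp
  then show "Q S S + (\<Sum>v\<in>vertices F. Q v v) = n * (n + 1) * (n + 2)" by (simp add: E_def)
  fix v assume v: "v \<in> ?V"
  have "b - f v = 0" using s0 v fb V(1) by (subst (asm) sum_nonneg_eq_0_iff) auto
  then have "2 * (Q v S + Q v v) = (n + 1) * (n + 2)\<^sup>2 - n * (n + 1) * (n + 2)" by (simp add: f_def E b_def)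
  also have "\<dots> = 2 * ((n + 1) * (n + 2))" by (simp add: power2_eq_square algebra_simps)
  finally show "Q v S + Q v v = (n + 1) * (n + 2)" by simp
qed

end

section \<open>Symmetry of the star of a simplicial vertex\<close>

lemma vertices_linear_image:
  assumes f: "linear f" "inj f"
  shows "vertices (f ` S) = f ` vertices S"
proof -
  have "f x extreme_point_of f ` S \<longleftrightarrow> x extreme_point_of S" for x
    using face_of_linear_image[OF f, of "{x}" S] by (simp add: face_of_singleton)
  moreover have "x \<in> f ` S" if "x extreme_point_of f ` S" for x
    using that by (simp add: extreme_point_of_def)
  ultimately show ?thesis unfolding vertices_def by (auto simp: image_iff) (metis (no_types, lifting) imageE)
qed

context centered_maximizer
begin

lemma facet_subset_iff_vertices:
  assumes F: "F facet_of P" "k simplex F" and G: "G facet_of P"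
  shows "vertices F \<subseteq> G \<Longrightarrow> F = G"
proof -
  assume "vertices F \<subseteq> G"
  moreover have "convex G" using facet_of_imp_face_of[OF G] face_of_imp_convex by blast
  ultimately have "convex hull (vertices F) \<subseteq> G" by (rule hull_minimal)
  then show "F = G" using simplicial_vertices(4)[OF F] by (intro facet_subset_eq F G) simp
qed

text \<open>The two vertex sums differ by \<open>a - b\<close>, so subtracting the equations of a
  common vertex \<open>w\<close> gives \<open>Q w (a - b) = 0\<close>. Summing over the common
  vertices gives \<open>Q a s = Q b s\<close>, after which the equations of \<open>a\<close> and
  \<open>b\<close> yield equal lengths.\<close>

lemma adjacent_facets:
  assumes F: "F facet_of P" "k simplex F" and G: "G facet_of P" "l simplex G" and FG: "F \<noteq> G"
    and a: "a \<in> vertices F" "vertices F - {a} \<subseteq> G"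
  obtains b where "b \<notin> vertices F" "vertices G = insert b (vertices F - {a})"
    "\<And>w. w \<in> vertices F - {a} \<Longrightarrow> Q w (a - b) = 0" "Q a a = Q b b"
proof -
  note V = simplicial_vertices[OF F] and W = simplicial_vertices[OF G]
  let ?R = "vertices F - {a}"
  have RW: "?R \<subseteq> vertices G" using a(2) vertices_facet[OF F(1)] vertices_facet[OF G(1)] by blast
  have "card (vertices G - ?R) = 1"
    using V W a(1) RW by (subst card_Diff_subset) (auto simp: card_Diff_singleton)
  then obtain b where b: "vertices G - ?R = {b}" by (auto simp: card_1_singleton_iff)
  then have W_eq: "vertices G = insert b ?R" using RW by blast
  have bR: "b \<notin> ?R" using b by blast
  have "b \<noteq> a"
  proof
    assume "b = a"
    then have "vertices F \<subseteq> G" using W_eq a vertices_subset[of G] by blast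
    then show False using facet_subset_iff_vertices[OF F G(1)] FG by blast
  qed
  then have bF: "b \<notin> vertices F" using bR by blast
  define s where "s = \<Sum>?R"
  have SF: "\<Sum>(vertices F) = a + s" using V(1) a(1) by (simp add: s_def sum.remove)
  have SG: "\<Sum>(vertices G) = b + s" using W_eq V(1) bR by (simp add: s_def)
  note eF = simplicial_equations(2)[OF F, unfolded SF] and eG = simplicial_equations(2)[OF G, unfolded SG]
  have orth: "Q w (a - b) = 0" if w: "w \<in> ?R" for w
    using eF[of w] eG[of w] w W_eq by (simp add: Q_simps)
  have "Q s (a - b) = 0" unfolding s_def Q_sum(1)[of "\<lambda>x. x"] using orth by simp
  then have "Q a s = Q b s" using Q_sym[of s a] Q_sym[of s b] by (simp add: Q_simps)
  then have "Q a a = Q b b" using eF[OF a(1)] eG[of b] W_eq by (simp add: Q_simps)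
  then show thesis using that[OF bF W_eq orth] by blast
qed

text \<open>The ridge opposite to \<open>a\<close> is a proper face, hence the intersection of the
  facets containing it. If \<open>F\<close> were the only one, the ridge would be all of
  \<open>F\<close>.\<close>

lemma adjacent_facet_exists:
  assumes F: "F facet_of P" "k simplex F" and a: "a \<in> vertices F" and ne: "vertices F \<noteq> {a}"
  obtains G where "G facet_of P" "G \<noteq> F" "vertices F - {a} \<subseteq> G"
proof -
  note V = simplicial_vertices[OF F]
  let ?R = "convex hull (vertices F - {a})"
  have ai: "\<not> affine_dependent (vertices F)" using V(3) affine_dependent_imp_dependent by blast
  have "?R face_of F"
    using face_of_convex_hull_affine_independent[OF ai, of ?R] V(4) by auto
  then have RP: "?R face_of P" using face_of_trans facet_of_imp_face_of[OF F(1)] by blast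
  have Rne: "?R \<noteq> {}" using ne a by auto
  have RF: "?R \<noteq> F"
  proof
    assume "?R = F"
    then have "a \<in> convex hull (vertices F - {a})" using a vertices_subset by blast
    then have "a \<in> span (vertices F - {a})" using convex_hull_subset_span by blast
    then show False using V(3) a by (auto simp: dependent_def)
  qed
  have "?R \<noteq> P"
  proof
    assume "?R = P"
    then have "P \<subseteq> F" using \<open>?R face_of F\<close> face_of_imp_subset by blast
    then have "F = P" using facet_subset_P[OF F(1)] by blast
    then show False using F(1) by (simp add: facet_of_def)
  qed
  then have "?R = \<Inter>{G. G facet_of P \<and> ?R \<subseteq> G}"
    by (rule face_of_polyhedron[OF polytope_imp_polyhedron[OF polytope] RP Rne])
  moreover have "F \<in> {G. G facet_of P \<and> ?R \<subseteq> G}"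
    using F(1) \<open>?R face_of F\<close> face_of_imp_subset by blast
  ultimately have "\<exists>G. G facet_of P \<and> ?R \<subseteq> G \<and> G \<noteq> F" using RF by (metis (mono_tags, lifting) Inter_lower RP cInf_eq_minimum mem_Collect_eq order_refl)
  then obtain G where G: "G facet_of P" "?R \<subseteq> G" "G \<noteq> F" by blast
  then show thesis using that[of G] hull_subset[of "vertices F - {a}" convex] by blast
qed

section \<open>Reflections and the facets at a vertex\<close>

definition reflection :: "real^'n \<Rightarrow> real^'n \<Rightarrow> real^'n" where
  "reflection d x = x - (2 * Q d x / Q d d) *\<^sub>R d"

lemma linear_reflection: "linear (reflection d)"
  unfolding reflection_def by (rule linearI) (simp_all add: Q_simps algebra_simps add_divide_distrib)

lemma reflection_involution: "d \<noteq> 0 \<Longrightarrow> reflection d (reflection d x) = x"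
  using Q_pos[of d] by (simp add: reflection_def Q_simps)

lemma inj_reflection: "d \<noteq> 0 \<Longrightarrow> inj (reflection d)"
  by (metis injI reflection_involution)

lemma reflection_fixed: "Q d x = 0 \<Longrightarrow> reflection d x = x"
  by (simp add: reflection_def)

lemma reflection_swap:
  assumes "a \<noteq> b" "Q a a = Q b b"
  shows "reflection (a - b) a = b" "reflection (a - b) b = a"
proof -
  have "Q (a - b) (a - b) = 2 * Q (a - b) a" using assms(2) Q_sym[of a b] by (simp add: Q_simps)
  moreover have "Q (a - b) (a - b) > 0" using assms(1) by (intro Q_pos) simp
  ultimately show "reflection (a - b) a = b" by (simp add: reflection_def)
  then show "reflection (a - b) b = a" using reflection_involution[of "a - b" a] assms(1) by simp
qed

lemma Q_reflection: "d \<noteq> 0 \<Longrightarrow> Q (reflection d x) (reflection d y) = Q x y"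
  using Q_pos[of d] Q_sym[of d x] by (simp add: reflection_def Q_simps field_simps)

definition star :: "real^'n \<Rightarrow> (real^'n) set set" where
  "star v = {F. F facet_of P \<and> v \<in> F}"

text \<open>The facets at a simplicial vertex are connected through ridges: given a facet \<open>G\<close> of the star,
  the facet \<open>F\<close> of \<open>\<R>\<close> that maximizes the product of the two vertex sums must be \<open>G\<close>, because
  crossing a ridge of \<open>F\<close> that separates \<open>F\<close> from \<open>G\<close> acts on vertex sums as a reflection.\<close>

lemma star_connected:
  assumes simp: "\<And>F. F \<in> star v \<Longrightarrow> \<exists>k. k simplex F" and v: "v \<in> vertices P"
    and \<R>: "\<R> \<subseteq> star v" "\<R> \<noteq> {}"
    and closed: "\<And>F G a. F \<in> \<R> \<Longrightarrow> G \<in> star v \<Longrightarrow> G \<noteq> F \<Longrightarrow> a \<in> vertices F \<Longrightarrow> a \<noteq> v \<Longrightarrow> vertices F - {a} \<subseteq> G \<Longrightarrow> G \<in> \<R>"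
  shows "\<R> = star v"
proof (intro subset_antisym \<R>(1) subsetI)
  fix G assume G: "G \<in> star v"
  then have Gf: "G facet_of P" and vG: "v \<in> G" by (auto simp: star_def)
  obtain l where l: "l simplex G" using simp[OF G] by blast
  note W = simplicial_vertices[OF Gf l]
  define z where "z = \<Sum>(vertices G)"
  have "finite (star v)" by (rule finite_subset[OF _ finite_facets]) (auto simp: star_def)
  with \<R>(1) have fin: "finite \<R>" by (rule finite_subset)
  obtain F where F: "F \<in> \<R>" "\<And>F'. F' \<in> \<R> \<Longrightarrow> Q z (\<Sum>(vertices F')) \<le> Q z (\<Sum>(vertices F))"
  proof -
    let ?h = "\<lambda>F. Q z (\<Sum>(vertices F))"
    have "Max (?h ` \<R>) \<in> ?h ` \<R>" using fin \<R>(2) by (intro Max_in) auto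
    then obtain F where "F \<in> \<R>" "?h F = Max (?h ` \<R>)" by auto
    then show thesis using that[of F] fin by simp
  qed
  have Ff: "F facet_of P" and vF: "v \<in> F" using F(1) \<R>(1) by (auto simp: star_def)
  obtain k where k: "k simplex F" using simp F(1) \<R>(1) by blast
  note V = simplicial_vertices[OF Ff k]
  have vV: "v \<in> vertices F" "v \<in> vertices G" using v vF vG vertices_facet[OF Ff] vertices_facet[OF Gf] by auto
  have nF: "nrm F \<bullet> w = 1" if "w \<in> vertices F" for w using that facet_nrm[OF Ff] vertices_subset[of F] by blast
  have nG: "nrm G \<bullet> w = 1" if "w \<in> vertices G" for w using that facet_nrm[OF Gf] vertices_subset[of G] by blast
  have VP: "w \<in> P" if "w \<in> vertices F" for w using that vertices_subset facet_subset_P[OF Ff] by blast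
  have WP: "w \<in> P" if "w \<in> vertices G" for w using that vertices_subset facet_subset_P[OF Gf] by blast
  obtain Y where Y: "\<And>v. linear (Y v)" "\<And>x. (\<Sum>v\<in>vertices F. Y v x *\<^sub>R v) = x"
    "\<And>v w. v \<in> vertices F \<Longrightarrow> w \<in> vertices F \<Longrightarrow> Y v w = (if v = w then 1 else (0::real))"
    by (rule basis_coordinates[OF V(1,3,5)]) blast
  have nz: "nrm F \<bullet> z = (\<Sum>w\<in>vertices F. Y w z)"
    by (rule convex_hull_basis(1)[where V = "vertices F" and y = Y, OF V(1) Y nF])
  \<comment> \<open>If the coordinate of \<open>z\<close> at \<open>a\<close> were negative,
    crossing the ridge opposite to \<open>a\<close> would change the vertex sum by
    \<open>b - a\<close> and increase its product with \<open>z\<close>, against the choice of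
    \<open>F\<close>.\<close>
  have pos: "Y a z \<ge> 0" if a: "a \<in> vertices F" "a \<noteq> v" for a
  proof (rule ccontr)
    assume "\<not> Y a z \<ge> 0"
    then have neg: "Y a z < 0" by simp
    obtain H where H: "H facet_of P" "H \<noteq> F" "vertices F - {a} \<subseteq> H"
      using adjacent_facet_exists[OF Ff k a(1)] a(2) vV(1) by (metis singletonD)
    have Hs: "H \<in> star v" using H a vV by (auto simp: star_def)
    then obtain m where m: "m simplex H" using simp by blast
    have HR: "H \<in> \<R>" using closed[OF F(1) Hs H(2) a H(3)] .
    obtain b where b: "b \<notin> vertices F" "vertices H = insert b (vertices F - {a})"
      "\<And>w. w \<in> vertices F - {a} \<Longrightarrow> Q w (a - b) = 0" "Q a a = Q b b"
      using adjacent_facets[OF Ff k H(1) m H(2)[symmetric] a(1) H(3)] by blast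
    have "\<Sum>(vertices H) = \<Sum>(vertices F) - (a - b)"
      using b(1,2) V(1) a(1) by (simp add: sum_diff1)
    then have "Q z (\<Sum>(vertices H)) = Q z (\<Sum>(vertices F)) - Q z (a - b)" by (simp add: Q_simps)
    then have "Q z (a - b) \<ge> 0" using F(2)[OF HR] by simp
    moreover have "Q z (a - b) = Y a z * Q a (a - b)"
    proof -
      have "Q z (a - b) = (\<Sum>w\<in>vertices F. Y w z * Q w (a - b))"
        by (subst Y(2)[of z, symmetric]) (simp only: Q_sum Q_simps sum_subtractf right_diff_distrib)
      also have "\<dots> = Y a z * Q a (a - b) + (\<Sum>w\<in>vertices F - {a}. Y w z * Q w (a - b))"
        using V(1) a(1) by (rule sum.remove)
      also have "(\<Sum>w\<in>vertices F - {a}. Y w z * Q w (a - b)) = 0" using b(3) by simp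
      finally show ?thesis by simp
    qed
    moreover have "Q a (a - b) > 0"
    proof -
      have "Q (a - b) (a - b) > 0" using a(1) b(1) by (intro Q_pos) auto
      moreover have "Q (a - b) (a - b) = 2 * Q a (a - b)" using b(4) Q_sym[of a b] by (simp add: Q_simps)
      ultimately show ?thesis by simp
    qed
    ultimately show False using neg by (simp add: zero_le_mult_iff)
  qed
  let ?n = "real CARD('n)"
  have zF: "nrm F \<bullet> z = (\<Sum>x\<in>vertices G. nrm F \<bullet> x)" by (simp add: z_def inner_sum_right)
  \<comment> \<open>Nothing is known about the sign of the coordinate at \<open>v\<close>, but
    \<open>nrm G\<close> is exactly 1 there. The other coordinates are nonnegative and
    \<open>nrm G\<close> is at most 1 on the vertices of \<open>F\<close>. The resulting bound
    forces \<open>nrm F\<close> to be 1 on all vertices of \<open>G\<close>.\<close>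
  have "?n = nrm G \<bullet> z" using nG W(2) by (simp add: z_def inner_sum_right)
  also have "nrm G \<bullet> z = (\<Sum>w\<in>vertices F. Y w z * (nrm G \<bullet> w))"
    by (subst Y(2)[of z, symmetric]) (simp only: inner_sum_right inner_scaleR_right)
  also have "\<dots> = Y v z * (nrm G \<bullet> v) + (\<Sum>w\<in>vertices F - {v}. Y w z * (nrm G \<bullet> w))"
    using V(1) vV(1) by (rule sum.remove)
  also have "\<dots> \<le> Y v z + (\<Sum>w\<in>vertices F - {v}. Y w z)"
  proof (rule add_mono)
    show "Y v z * (nrm G \<bullet> v) \<le> Y v z" by (simp add: nG[OF vV(2)])
    show "(\<Sum>w\<in>vertices F - {v}. Y w z * (nrm G \<bullet> w)) \<le> (\<Sum>w\<in>vertices F - {v}. Y w z)"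
    proof (rule sum_mono)
      fix w assume w: "w \<in> vertices F - {v}"
      then show "Y w z * (nrm G \<bullet> w) \<le> Y w z"
        using mult_left_mono[OF P_nrm[OF Gf VP], of w "Y w z"] pos[of w] by simp
    qed
  qed
  also have "\<dots> = nrm F \<bullet> z" unfolding nz using V(1) vV(1) by (rule sum.remove[symmetric])
  finally have "?n \<le> (\<Sum>x\<in>vertices G. nrm F \<bullet> x)" by (simp add: zF)
  then have "(\<Sum>x\<in>vertices G. 1 - nrm F \<bullet> x) \<le> 0" using W(2) by (simp add: sum_subtractf)
  moreover have ge: "1 - nrm F \<bullet> x \<ge> 0" if "x \<in> vertices G" for x using P_nrm[OF Ff WP[OF that]] by simp
  ultimately have "(\<Sum>x\<in>vertices G. 1 - nrm F \<bullet> x) = 0" by (meson antisym sum_nonneg)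
  then have "\<forall>x\<in>vertices G. 1 - nrm F \<bullet> x = 0" using ge W(1) by (subst (asm) sum_nonneg_eq_0_iff) auto
  then have "vertices G \<subseteq> F" using in_facet_iff[OF Ff WP] by auto
  then have "G = F" by (rule facet_subset_iff_vertices[OF Gf l Ff])
  then show "G \<in> \<R>" using F(1) by simp
qed

text \<open>The facets of the star whose mirror images are again in the star include
  \<open>F0\<close>, as its image is \<open>G0\<close>. The family is closed under crossing ridges
  at \<open>v\<close>: the neighbour of a mirrored facet across a mirrored ridge is the mirrored
  neighbour. So connectedness of the star applies.\<close>

lemma star_symmetric:
  assumes simp: "\<And>F. F \<in> star v \<Longrightarrow> \<exists>k. k simplex F" and v: "v \<in> vertices P"
    and F0: "F0 \<in> star v" and a0: "a0 \<in> vertices F0" "a0 \<noteq> v"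
    and G0: "G0 \<in> star v" "G0 \<noteq> F0" "vertices F0 - {a0} \<subseteq> G0"
    and b0: "vertices G0 = insert b0 (vertices F0 - {a0})" "b0 \<notin> vertices F0"
      "\<And>w. w \<in> vertices F0 - {a0} \<Longrightarrow> Q w (a0 - b0) = 0" "Q a0 a0 = Q b0 b0"
    and F: "F \<in> star v"
  shows "reflection (a0 - b0) ` F \<in> star v"
proof -
  define \<sigma> where "\<sigma> = reflection (a0 - b0)"
  have ne: "a0 - b0 \<noteq> 0" using a0 b0 by auto
  have lin: "linear \<sigma>" and inj: "inj \<sigma>" and inv: "\<And>x. \<sigma> (\<sigma> x) = x" and iso: "\<And>x y. Q (\<sigma> x) (\<sigma> y) = Q x y"
    unfolding \<sigma>_def using linear_reflection inj_reflection[OF ne] reflection_involution[OF ne] Q_reflection[OF ne] by auto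
  have vF0: "v \<in> vertices F0 - {a0}" using v F0 a0 vertices_facet[of F0] by (auto simp: star_def)
  have fixed: "\<sigma> w = w" if "w \<in> vertices F0 - {a0}" for w
    unfolding \<sigma>_def using b0(3)[OF that] by (intro reflection_fixed) (simp add: Q_sym)
  have \<sigma>v: "\<sigma> v = v" by (rule fixed[OF vF0])
  have hull: "\<sigma> ` F = convex hull (\<sigma> ` vertices F)" "vertices (\<sigma> ` F) = \<sigma> ` vertices F" if "F \<in> star v" for F
  proof -
    obtain k where "k simplex F" using simp[OF \<open>F \<in> star v\<close>] by blast
    with that have F_eq: "F = convex hull (vertices F)" using simplicial_vertices(4) by (auto simp: star_def)
    show "\<sigma> ` F = convex hull (\<sigma> ` vertices F)" by (subst F_eq) (rule convex_hull_linear_image[OF lin])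
    show "vertices (\<sigma> ` F) = \<sigma> ` vertices F" by (rule vertices_linear_image[OF lin inj])
  qed
  define \<R> where "\<R> = {F \<in> star v. \<sigma> ` F \<in> star v}"
  have "\<R> = star v"
  proof (rule star_connected[OF simp v])
    show "\<R> \<subseteq> star v" by (auto simp: \<R>_def)
    have "\<sigma> ` F0 = G0"
    proof -
      have "\<sigma> a0 = b0" unfolding \<sigma>_def using ne b0(4) by (intro reflection_swap) auto
      then have "\<sigma> ` vertices F0 = vertices G0"
        using fixed a0(1) b0(1) by (auto simp: image_iff) (metis Diff_iff singletonD)+
      moreover obtain l where "l simplex G0" using simp[OF G0(1)] by blast
      ultimately show ?thesis using hull(1)[OF F0] simplicial_vertices(4)[of G0 l] G0(1) by (simp add: star_def)
    qed
    then show "\<R> \<noteq> {}" using F0 G0(1) by (auto simp: \<R>_def)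
    fix F G a assume FR: "F \<in> \<R>" and G: "G \<in> star v" "G \<noteq> F" and a: "a \<in> vertices F" "a \<noteq> v" "vertices F - {a} \<subseteq> G"
    have Fs: "F \<in> star v" and \<sigma>F: "\<sigma> ` F \<in> star v" using FR by (auto simp: \<R>_def)
    obtain k where k: "k simplex F" using simp[OF Fs] by blast
    obtain l where l: "l simplex G" using simp[OF G(1)] by blast
    obtain m where m: "m simplex \<sigma> ` F" using simp[OF \<sigma>F] by blast
    have Ff: "F facet_of P" and Gf: "G facet_of P" and \<sigma>Ff: "\<sigma> ` F facet_of P" using Fs G \<sigma>F by (auto simp: star_def)
    obtain b where b: "b \<notin> vertices F" "vertices G = insert b (vertices F - {a})"
      "\<And>w. w \<in> vertices F - {a} \<Longrightarrow> Q w (a - b) = 0" "Q a a = Q b b"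
      using adjacent_facets[OF Ff k Gf l G(2)[symmetric] a(1,3)] by blast
    have V': "vertices (\<sigma> ` F) = \<sigma> ` vertices F" by (rule hull(2)[OF Fs])
    have \<sigma>a: "\<sigma> a \<in> vertices (\<sigma> ` F)" "\<sigma> a \<noteq> v" using a V' \<sigma>v inj by (auto simp: inj_def)
    have vV: "v \<in> vertices F" using v Fs vertices_facet[OF Ff] by (auto simp: star_def)
    have v\<sigma>: "v \<in> vertices (\<sigma> ` F) - {\<sigma> a}" using vV \<sigma>a(2) \<sigma>v V' by force
    obtain H where H: "H facet_of P" "H \<noteq> \<sigma> ` F" "vertices (\<sigma> ` F) - {\<sigma> a} \<subseteq> H"
      using adjacent_facet_exists[OF \<sigma>Ff m \<sigma>a(1)] v\<sigma> by (metis Diff_cancel empty_iff)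
    have Hs: "H \<in> star v" using H v\<sigma> by (auto simp: star_def)
    then obtain p where p: "p simplex H" using simp by blast
    obtain h where h: "h \<notin> vertices (\<sigma> ` F)" "vertices H = insert h (vertices (\<sigma> ` F) - {\<sigma> a})"
      "\<And>w. w \<in> vertices (\<sigma> ` F) - {\<sigma> a} \<Longrightarrow> Q w (\<sigma> a - h) = 0" "Q (\<sigma> a) (\<sigma> a) = Q h h"
      using adjacent_facets[OF \<sigma>Ff m H(1) p H(2)[symmetric] \<sigma>a(1) H(3)] by blast
    \<comment> \<open>\<open>d1\<close> and \<open>d2\<close> are both orthogonal to the mirrored
      ridge, hence parallel. As \<open>h\<close> and \<open>\<sigma> b\<close> both have the same
      length as \<open>\<sigma> a\<close>, the factor between \<open>d1\<close> and
      \<open>d2\<close> is 1.\<close>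
    have "h = \<sigma> b"
    proof -
      define d1 where "d1 = \<sigma> a - h"
      define d2 where "d2 = \<sigma> a - \<sigma> b"
      have d1: "d1 \<noteq> 0" using h(1) \<sigma>a(1) by (auto simp: d1_def)
      have d2: "d2 \<noteq> 0" using a(1) b(1) inj by (auto simp: d2_def inj_def)
      have n1: "Q d1 d1 = 2 * Q (\<sigma> a) d1" using h(4) Q_sym[of "\<sigma> a" h] by (simp add: d1_def Q_simps)
      have n2: "Q d2 d2 = 2 * Q (\<sigma> a) d2" using b(4) iso Q_sym[of "\<sigma> a" "\<sigma> b"] by (simp add: d2_def Q_simps)
      define \<kappa> where "\<kappa> = Q (\<sigma> a) d2 / Q (\<sigma> a) d1"
      have p1: "Q (\<sigma> a) d1 > 0" using Q_pos[OF d1] n1 by simp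
      have p2: "Q (\<sigma> a) d2 > 0" using Q_pos[OF d2] n2 by simp
      have orth: "Q w (d2 - \<kappa> *\<^sub>R d1) = 0" if w: "w \<in> vertices (\<sigma> ` F)" for w
      proof (cases "w = \<sigma> a")
        case True then show ?thesis using p1 by (simp add: Q_simps \<kappa>_def)
      next
        case False
        then have "Q w d1 = 0" using h(3) w by (simp add: d1_def)
        moreover obtain w' where w': "w' \<in> vertices F - {a}" "w = \<sigma> w'" using w V' False by auto
        have "Q w d2 = Q w' (a - b)" unfolding d2_def w'(2) by (simp only: Q_simps iso)
        then have "Q w d2 = 0" using b(3)[OF w'(1)] by simp
        ultimately show ?thesis by (simp add: Q_simps)
      qed
      have "Q x (d2 - \<kappa> *\<^sub>R d1) = 0" for x
      proof -
        have "x \<in> span (vertices (\<sigma> ` F))" using simplicial_vertices(5)[OF \<sigma>Ff m] by simp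
        then show ?thesis
        proof (induction rule: span_induct_alt)
          case (step c w y)
          have "Q w d2 = \<kappa> * Q w d1" using orth[OF step(1)] by (simp add: Q_simps)
          then show ?case using step(2) by (simp add: Q_simps algebra_simps)
        qed (simp add: Q_simps)
      qed
      then have "d2 - \<kappa> *\<^sub>R d1 = 0" using Q_pos[of "d2 - \<kappa> *\<^sub>R d1"] by fastforce
      then have d: "d2 = \<kappa> *\<^sub>R d1" by simp
      have "\<kappa> > 0" using p1 p2 by (simp add: \<kappa>_def)
      have "\<kappa> * \<kappa> * Q d1 d1 = \<kappa> * Q d1 d1" using n2 n1 unfolding d by (auto simp add: Q_simps)
      then have "\<kappa> = 1" using \<open>\<kappa> > 0\<close> Q_pos[OF d1] p1 by simp
      then show ?thesis using d by (simp add: d1_def d2_def)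
    qed
    then have "vertices H = \<sigma> ` vertices G"
      unfolding h(2) b(2) V' using inj by (auto simp: inj_def)
    then have "H = \<sigma> ` G" using simplicial_vertices(4)[OF H(1) p] hull(1)[OF G(1)] by simp
    then show "G \<in> \<R>" using G(1) Hs by (simp add: \<R>_def)
  qed
  then show ?thesis using F by (auto simp: \<R>_def \<sigma>_def)
qed

end

section \<open>Moving a vertex\<close>

text \<open>Each shear preserves volume, and injectivity of \<open>\<phi>\<close> keeps the images
  of disjoint pieces disjoint. The sets \<open>D i\<close> may overlap, so in the induction a new
  set contributes only what the earlier ones do not cover.\<close>

lemma piecewise_shear_integral:
  fixes \<phi> :: "'a::euclidean_space \<Rightarrow> 'a" and D :: "'i \<Rightarrow> 'a set" and f :: "'a \<Rightarrow> real"
  assumes I: "finite I" and D: "\<And>i. i \<in> I \<Longrightarrow> D i \<in> sets borel" "\<And>i. i \<in> I \<Longrightarrow> bounded (D i)"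
    and g: "\<And>i. i \<in> I \<Longrightarrow> g i \<bullet> u = 0" "\<And>i x. i \<in> I \<Longrightarrow> x \<in> D i \<Longrightarrow> \<phi> x = x + (g i \<bullet> x + c i) *\<^sub>R u"
    and inj: "inj_on \<phi> (\<Union>i\<in>I. D i)" and f: "continuous_on UNIV f"
  shows "(LINT x:\<phi> ` (\<Union>i\<in>I. D i)|lborel. f x) = (LINT x:(\<Union>i\<in>I. D i)|lborel. f (\<phi> x))
    \<and> \<phi> ` (\<Union>i\<in>I. D i) \<in> sets borel \<and> bounded (\<phi> ` (\<Union>i\<in>I. D i))
    \<and> set_integrable lborel (\<Union>i\<in>I. D i) (\<lambda>x. f (\<phi> x))"
  using I D g inj
proof (induction I)
  case empty
  show ?case by (simp add: set_lebesgue_integral_def set_integrable_def)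
next
  case (insert i I)
  let ?A = "\<Union>i\<in>I. D i" and ?N = "D i - (\<Union>i\<in>I. D i)"
  have "inj_on \<phi> ?A" by (rule inj_on_subset[OF insert.prems(5)]) auto
  then have IH': "(LINT x:\<phi> ` ?A|lborel. f x) = (LINT x:?A|lborel. f (\<phi> x)) \<and> \<phi> ` ?A \<in> sets borel \<and> bounded (\<phi> ` ?A)
    \<and> set_integrable lborel ?A (\<lambda>x. f (\<phi> x))"
    by (intro insert.IH insert.prems) auto
  then have IH: "(LINT x:\<phi> ` ?A|lborel. f x) = (LINT x:?A|lborel. f (\<phi> x))" "\<phi> ` ?A \<in> sets borel" "bounded (\<phi> ` ?A)"
    "set_integrable lborel ?A (\<lambda>x. f (\<phi> x))"
    by blast+
  define h where "h x = x + (g i \<bullet> x + c i) *\<^sub>R u" for x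
  have hphi: "\<phi> x = h x" if "x \<in> D i" for x using insert.prems(4)[of i x] that by (simp add: h_def)
  have ch: "continuous_on A h" for A unfolding h_def by (intro continuous_intros)
  have A: "?A \<in> sets borel" using insert.prems(1) insert.hyps(1) by (intro sets.finite_UN) auto
  have N: "?N \<in> sets borel" "bounded ?N" using insert.prems(1,2)[of i] A bounded_diff by auto
  have im: "\<phi> ` ?N = h ` ?N" using hphi by (intro image_cong) auto
  have cf: "continuous_on UNIV (\<lambda>x. f (h x))" by (rule continuous_on_compose2[OF f ch]) simp
  have intN: "(LINT x:\<phi> ` ?N|lborel. f x) = (LINT x:?N|lborel. f (h x))" "\<phi> ` ?N \<in> sets borel"
    unfolding im h_def using set_integral_shear[OF insert.prems(3)[of i] N(1) borel_measurable_continuous_onI[OF f], of "c i"] by simp_all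
  have "bounded (h ` closure ?N)"
    using N(2) by (intro compact_imp_bounded compact_continuous_image ch) (simp add: compact_closure)
  then have bN: "bounded (\<phi> ` ?N)" unfolding im using closure_subset by (rule bounded_subset[OF _ image_mono])
  have cong: "(LINT x:?N|lborel. f (h x)) = (LINT x:?N|lborel. f (\<phi> x))"
    using hphi N(1) by (intro set_lebesgue_integral_cong) auto
  have siN: "set_integrable lborel ?N (\<lambda>x. f (\<phi> x))"
  proof -
    have "set_integrable lborel ?N (\<lambda>x. f (h x))" by (rule set_integrable_continuous_bounded[OF N(2,1) cf])
    then show ?thesis using set_integrable_cong[OF refl refl, of ?N "\<lambda>x. f (h x)" "\<lambda>x. f (\<phi> x)" lborel] hphi by simp
  qed
  have un: "(\<Union>i\<in>insert i I. D i) = ?A \<union> ?N" by auto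
  have imun: "\<phi> ` (\<Union>i\<in>insert i I. D i) = \<phi> ` ?A \<union> \<phi> ` ?N" unfolding un by (rule image_Un)
  have disj: "\<phi> ` ?A \<inter> \<phi> ` ?N = {}"
    using insert.prems(5) by (auto simp: inj_on_def) 
  have si: "set_integrable lborel S f" if "bounded S" "S \<in> sets borel" for S
    by (rule set_integrable_continuous_bounded[OF that f])
  have "(LINT x:\<phi> ` ?A \<union> \<phi> ` ?N|lborel. f x) = (LINT x:\<phi> ` ?A|lborel. f x) + (LINT x:\<phi> ` ?N|lborel. f x)"
    by (rule set_integral_Un[OF disj]) (intro si IH bN intN)+
  also have "\<dots> = (LINT x:?A|lborel. f (\<phi> x)) + (LINT x:?N|lborel. f (\<phi> x))"
    by (simp only: IH intN cong)
  also have "\<dots> = (LINT x:?A \<union> ?N|lborel. f (\<phi> x))"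
    by (rule set_integral_Un[symmetric]) (auto intro: IH siN)
  finally have "(LINT x:\<phi> ` (\<Union>i\<in>insert i I. D i)|lborel. f x) = (LINT x:(\<Union>i\<in>insert i I. D i)|lborel. f (\<phi> x))"
    unfolding imun unfolding un .
  moreover have "set_integrable lborel (?A \<union> ?N) (\<lambda>x. f (\<phi> x))"
    using A N by (intro set_integrable_Un IH siN) auto
  then have "set_integrable lborel (\<Union>i\<in>insert i I. D i) (\<lambda>x. f (\<phi> x))" unfolding un .
  moreover have "\<phi> ` (\<Union>i\<in>insert i I. D i) \<in> sets borel" "bounded (\<phi> ` (\<Union>i\<in>insert i I. D i))"
    unfolding imun using IH(2,3) intN(2) bN by (auto simp only: bounded_Un intro: sets.Un)
  ultimately show ?case by blast
qed

lemma piecewise_measurable: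
  fixes f :: "'a::topological_space \<Rightarrow> real"
  assumes "finite I" "\<And>i. i \<in> I \<Longrightarrow> D i \<in> sets borel" "\<And>i. i \<in> I \<Longrightarrow> g i \<in> borel_measurable borel"
    "\<And>i x. i \<in> I \<Longrightarrow> x \<in> D i \<Longrightarrow> f x = g i x" "\<And>x. x \<notin> (\<Union>i\<in>I. D i) \<Longrightarrow> f x = 0"
  shows "f \<in> borel_measurable borel"
  using assms
proof (induction I arbitrary: f)
  case empty
  then have "f = (\<lambda>_. 0)" by auto
  then show ?case by simp
next
  case (insert i I)
  define f' where "f' x = (if x \<in> (\<Union>i\<in>I. D i) then f x else 0)" for x
  have "f' \<in> borel_measurable borel"
  proof (rule insert.IH)
    show "D j \<in> sets borel" "g j \<in> borel_measurable borel" if "j \<in> I" for j using insert.prems(1,2)[of j] that by simp_all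
    show "f' x = g j x" if "j \<in> I" "x \<in> D j" for j x
    proof -
      have "x \<in> (\<Union>i\<in>I. D i)" using that by blast
      then show ?thesis using insert.prems(3)[of j x] that by (simp add: f'_def)
    qed
    show "f' x = 0" if "x \<notin> (\<Union>i\<in>I. D i)" for x using that by (simp only: f'_def if_False)
  qed
  then have m: "(\<lambda>x. if x \<in> D i then g i x else f' x) \<in> borel_measurable borel"
    using insert.prems(1,2)[of i] by (intro measurable_If_set) auto
  have eq: "(\<lambda>x. if x \<in> D i then g i x else f' x) = f"
  proof
    fix x
    show "(if x \<in> D i then g i x else f' x) = f x"
    proof (cases "x \<in> D i")
      case True then show ?thesis using insert.prems(3)[of i x] by simp
    next
      case False
      show ?thesis
      proof (cases "x \<in> (\<Union>i\<in>I. D i)")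
        case True with False show ?thesis by (simp only: f'_def if_True if_False)
      next
        case F2: False
        then have "f x = 0" using insert.prems(4)[of x] False by blast
        with F2 False show ?thesis by (simp only: f'_def if_False)
      qed
    qed
  qed
  show ?case using m unfolding eq .
qed

lemma convex_line_between:
  fixes x u :: "'a::real_vector"
  assumes "convex S" "x + s *\<^sub>R u \<in> S" "x - r *\<^sub>R u \<in> S" "s \<ge> 0" "r \<ge> 0"
  shows "x \<in> S"
proof (cases "s + r = 0")
  case True
  then have "s = 0" using assms by simp
  then show ?thesis using assms by simp
next
  case False
  then have sr: "s + r > 0" using assms by simp
  have "(r / (s + r)) *\<^sub>R (x + s *\<^sub>R u) + (s / (s + r)) *\<^sub>R (x - r *\<^sub>R u) \<in> S"
    using assms sr by (intro convexD) (auto simp: add_divide_distrib[symmetric])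
  also have "(r / (s + r)) *\<^sub>R (x + s *\<^sub>R u) + (s / (s + r)) *\<^sub>R (x - r *\<^sub>R u) = (r / (s + r) + s / (s + r)) *\<^sub>R x"
    by (simp add: algebra_simps)
  also have "r / (s + r) + s / (s + r) = 1" using sr by (simp add: add_divide_distrib[symmetric] add.commute)
  finally show ?thesis by simp
qed

lemma continuous_AE_eq_on_open:
  fixes f g :: "'a::euclidean_space \<Rightarrow> real"
  assumes S: "open S" and f: "continuous_on UNIV f" "continuous_on UNIV g"
    and ae: "AE x in lborel. x \<in> S \<longrightarrow> f x = g x" and x: "x \<in> S"
  shows "f x = g x"
proof (rule ccontr)
  assume ne: "f x \<noteq> g x"
  let ?U = "S \<inter> {x. f x \<noteq> g x}"
  have "open ?U" using S f by (intro open_Int open_Collect_neq)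
  moreover have "?U \<noteq> {}" using x ne by auto
  ultimately have "emeasure lborel ?U \<noteq> 0" by (rule emeasure_lborel_open_neq_0)
  moreover have "AE x in lborel. x \<notin> ?U" using ae by eventually_elim auto
  then have "?U \<in> null_sets lborel" using \<open>open ?U\<close> AE_iff_null_sets[of ?U lborel] by auto
  ultimately show False by auto
qed

lemma affine_eq_on_open:
  fixes c d :: "'a::euclidean_space"
  assumes S: "open S" "S \<noteq> {}" and eq: "\<And>x. x \<in> S \<Longrightarrow> c \<bullet> x + k = d \<bullet> x + l"
  shows "c = d" "k = l"
proof -
  obtain x where x: "x \<in> S" using S by auto
  then obtain e where e: "e > 0" "ball x e \<subseteq> S" using S open_contains_ball by blast
  show "c = d"
  proof (rule ccontr)
    assume ne: "c \<noteq> d"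
    define z where "z = (e / 2 / norm (c - d)) *\<^sub>R (c - d)"
    have "norm z < e" using ne e by (simp add: z_def)
    then have "x + z \<in> S" using e by (auto simp: dist_norm)
    then have "(c - d) \<bullet> z = 0" using eq[OF x] eq[of "x + z"] by (simp add: inner_diff_left inner_add_right)
    then show False using ne e by (simp add: z_def)
  qed
  then show "k = l" using eq[OF x] by simp
qed

text \<open>The map in \<open>act\<close> is a reflection that fixes \<open>w\<close> and reverses
  \<open>u\<close>. Only facets at \<open>w\<close> that are not parallel to \<open>u\<close> are
  constrained, so the locale applies to vertices \<open>w\<close> other than the simplicial one,
  whose remaining facets may be arbitrary.\<close>

locale shear_vertex = centered_maximizer P B for P :: "(real^'n) set" and B +
  fixes w u :: "real^'n" and \<mu> :: "real^'n \<Rightarrow> real"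
  assumes w: "w \<in> vertices P" and u: "u \<noteq> 0" and lin_\<mu>: "linear \<mu>" and \<mu>u: "\<mu> u = 2" and \<mu>w: "\<mu> w = 0"
    and act: "\<And>G. G facet_of P \<Longrightarrow> w \<in> G \<Longrightarrow> nrm G \<bullet> u \<noteq> 0 \<Longrightarrow>
      (\<exists>k. k simplex G) \<and> (\<lambda>x. x - \<mu> x *\<^sub>R u) ` G facet_of P"
begin

definition \<sigma> where "\<sigma> x = x - \<mu> x *\<^sub>R u"

lemma lin_\<sigma>: "linear \<sigma>"
  unfolding \<sigma>_def by (rule linearI) (simp_all add: linear_add[OF lin_\<mu>] linear_cmul[OF lin_\<mu>] algebra_simps)

lemma \<sigma>_simps: "\<sigma> w = w" "\<sigma> u = - u" "\<sigma> (\<sigma> x) = x"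
  by (simp_all add: \<sigma>_def \<mu>w \<mu>u linear_diff[OF lin_\<mu>] linear_cmul[OF lin_\<mu>] scaleR_2 algebra_simps)

section \<open>Moving facets and the barycentric coordinate of the moving vertex\<close>

lemma inj_\<sigma>: "inj \<sigma>"
  by (metis injI \<sigma>_simps(3))

text \<open>The facets that change when \<open>w\<close> moves along \<open>u\<close>. The
  reflection exchanges those in \<open>ups\<close> with the others in \<open>acts\<close>.\<close>

definition acts where "acts = {G. G facet_of P \<and> w \<in> G \<and> nrm G \<bullet> u \<noteq> 0}"
definition ups where "ups = {G. G facet_of P \<and> w \<in> G \<and> nrm G \<bullet> u > 0}"

lemma acts_facet: "G \<in> acts \<Longrightarrow> G facet_of P" "G \<in> acts \<Longrightarrow> w \<in> G" "G \<in> acts \<Longrightarrow> nrm G \<bullet> u \<noteq> 0"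
  by (auto simp: acts_def)

lemma ups_acts: "G \<in> ups \<Longrightarrow> G \<in> acts" "G \<in> ups \<Longrightarrow> nrm G \<bullet> u > 0"
  by (auto simp: acts_def ups_def)

lemma acts_simplex: "G \<in> acts \<Longrightarrow> \<exists>k. k simplex G"
  using act acts_facet by blast

lemma finite_acts: "finite acts" "finite ups"
  by (rule finite_subset[OF _ finite_facets]; auto simp: acts_def ups_def)+

lemma \<sigma>_facet: "G \<in> acts \<Longrightarrow> \<sigma> ` G facet_of P"
  using act[OF acts_facet] by (simp add: \<sigma>_def[abs_def])

lemma nrm_\<sigma>: assumes G: "G \<in> acts" shows "nrm (\<sigma> ` G) \<bullet> x = nrm G \<bullet> \<sigma> x"
proof -
  have "adjoint \<sigma> (nrm G) = nrm (\<sigma> ` G)"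
  proof (rule nrm_unique[OF \<sigma>_facet[OF G]], safe)
    fix y assume "y \<in> G"
    then show "adjoint \<sigma> (nrm G) \<bullet> \<sigma> y = 1"
      using facet_nrm[OF acts_facet(1)[OF G]] adjoint_works[OF lin_\<sigma>, of "\<sigma> y" "nrm G"]
      by (simp add: \<sigma>_simps inner_commute)
  qed
  then show ?thesis using adjoint_works[OF lin_\<sigma>, of x "nrm G"] by (metis inner_commute)
qed

lemma \<sigma>_acts: assumes G: "G \<in> acts" shows "\<sigma> ` G \<in> acts" "nrm (\<sigma> ` G) \<bullet> u = - (nrm G \<bullet> u)"
proof -
  show "nrm (\<sigma> ` G) \<bullet> u = - (nrm G \<bullet> u)" by (simp add: nrm_\<sigma>[OF G] \<sigma>_simps)
  then show "\<sigma> ` G \<in> acts" using \<sigma>_facet[OF G] acts_facet[OF G] \<sigma>_simps(1) by (force simp: acts_def)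
qed

lemma \<sigma>_ups: "G \<in> acts \<Longrightarrow> G \<notin> ups \<Longrightarrow> \<sigma> ` G \<in> ups"
  using \<sigma>_acts[of G] acts_facet[of G] acts_facet[of "\<sigma> ` G"] by (auto simp: ups_def)

lemma vertices_\<sigma>: "vertices (\<sigma> ` G) = \<sigma> ` vertices G"
  by (rule vertices_linear_image[OF lin_\<sigma> inj_\<sigma>])

lemma acts_vertices:
  assumes "G \<in> acts"
  shows "finite (vertices G)" "independent (vertices G)" "G = convex hull (vertices G)" "span (vertices G) = UNIV"
    "w \<in> vertices G" "vertices G \<subseteq> vertices P"
proof -
  obtain k where "k simplex G" using acts_simplex[OF assms] by blast
  note V = simplicial_vertices[OF acts_facet(1)[OF assms] this]
  show "finite (vertices G)" "independent (vertices G)" "G = convex hull (vertices G)" "span (vertices G) = UNIV" using V by auto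
  show "w \<in> vertices G" "vertices G \<subseteq> vertices P"
    using vertices_facet[OF acts_facet(1)[OF assms]] w acts_facet(2)[OF assms] by auto
qed

text \<open>On the simplex \<open>G\<close> this is the barycentric coordinate of the vertex
  \<open>w\<close>; it is extended linearly to the whole space.\<close>

definition \<nu> where "\<nu> G x = representation (vertices G) x w"

lemma lin_\<nu>: "G \<in> acts \<Longrightarrow> linear (\<nu> G)"
  unfolding \<nu>_def using acts_vertices
  by (intro linearI) (simp_all add: representation_add representation_scale)

lemma \<nu>_vertex: "G \<in> acts \<Longrightarrow> v \<in> vertices G \<Longrightarrow> \<nu> G v = (if v = w then 1 else 0)"
  unfolding \<nu>_def using acts_vertices by (simp add: representation_basis)

lemma facet_combination:
  assumes G: "G \<in> acts" and y: "y \<in> G"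
  obtains c where "\<And>v. v \<in> vertices G \<Longrightarrow> 0 \<le> c v" "sum c (vertices G) = 1" "(\<Sum>v\<in>vertices G. c v *\<^sub>R v) = y" "c w = \<nu> G y"
proof -
  note V = acts_vertices[OF G]
  have "y \<in> convex hull (vertices G)" using y V(3) by simp
  then obtain c where c: "\<And>v. v \<in> vertices G \<Longrightarrow> 0 \<le> c v" "sum c (vertices G) = 1" "(\<Sum>v\<in>vertices G. c v *\<^sub>R v) = y"
    unfolding convex_hull_finite[OF V(1)] by auto
  have "\<nu> G y = (\<Sum>v\<in>vertices G. c v * \<nu> G v)"
    unfolding c(3)[symmetric] linear_sum[OF lin_\<nu>[OF G]] by (simp add: linear_cmul[OF lin_\<nu>[OF G]])
  also have "\<dots> = (\<Sum>v\<in>vertices G. if v = w then c w else 0)"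
    by (intro sum.cong refl) (simp add: \<nu>_vertex[OF G])
  also have "\<dots> = c w" using V(1,5) by simp
  finally have e: "\<nu> G y = c w" .
  show thesis by (rule that[of c]) (use c e in auto)
qed

lemma \<nu>_range: "G \<in> acts \<Longrightarrow> y \<in> G \<Longrightarrow> 0 \<le> \<nu> G y \<and> \<nu> G y \<le> 1"
proof (rule facet_combination)
  fix c assume G: "G \<in> acts" and c: "\<And>v. v \<in> vertices G \<Longrightarrow> 0 \<le> c v" "sum c (vertices G) = 1" "c w = \<nu> G y"
  have "c w \<le> sum c (vertices G)" using c acts_vertices[OF G] by (intro member_le_sum) auto
  then show ?thesis using c acts_vertices(5)[OF G] by (metis)
qed

text \<open>In a convex combination of vertices of \<open>G\<close> that lies on \<open>H\<close>,
  only vertices on \<open>H\<close> have positive weight. So the same combination computes both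
  coordinates.\<close>

lemma \<nu>_consistent:
  assumes G: "G \<in> acts" and H: "H \<in> acts" and y: "y \<in> G" "y \<in> H"
  shows "\<nu> G y = \<nu> H y"
proof -
  note V = acts_vertices[OF G]
  obtain c where c: "\<And>v. v \<in> vertices G \<Longrightarrow> 0 \<le> c v" "sum c (vertices G) = 1" "(\<Sum>v\<in>vertices G. c v *\<^sub>R v) = y" "c w = \<nu> G y"
    using facet_combination[OF G y(1)] by blast
  have VP: "v \<in> P" if "v \<in> vertices G" for v using that V(6) vertices_subset by blast
  have "1 = nrm H \<bullet> y" using facet_nrm[OF acts_facet(1)[OF H] y(2)] by simp
  also have "\<dots> = (\<Sum>v\<in>vertices G. c v * (nrm H \<bullet> v))" unfolding c(3)[symmetric] by (simp add: inner_sum_right)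
  finally have "(\<Sum>v\<in>vertices G. c v * (1 - nrm H \<bullet> v)) = 0"
    using c(2) by (simp add: right_diff_distrib sum_subtractf)
  moreover have "c v * (1 - nrm H \<bullet> v) \<ge> 0" if "v \<in> vertices G" for v
    using c(1)[OF that] P_nrm[OF acts_facet(1)[OF H] VP[OF that]] by simp
  ultimately have zero: "c v * (1 - nrm H \<bullet> v) = 0" if "v \<in> vertices G" for v
    using V(1) that by (simp add: sum_nonneg_eq_0_iff)
  have mem: "v \<in> vertices H" if "v \<in> vertices G" "c v \<noteq> 0" for v
  proof -
    have "v \<in> H" using zero[OF that(1)] that(2) in_facet_iff[OF acts_facet(1)[OF H] VP[OF that(1)]] by simp
    then show ?thesis using vertices_facet[OF acts_facet(1)[OF H]] V(6) that(1) by blast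
  qed
  have "\<nu> H y = (\<Sum>v\<in>vertices G. c v * \<nu> H v)"
    unfolding c(3)[symmetric] linear_sum[OF lin_\<nu>[OF H]] by (simp add: linear_cmul[OF lin_\<nu>[OF H]])
  also have "\<dots> = (\<Sum>v\<in>vertices G. if v = w then c w else 0)"
  proof (intro sum.cong refl)
    fix v assume v: "v \<in> vertices G"
    show "c v * \<nu> H v = (if v = w then c w else 0)"
      by (cases "c v = 0") (use mem[OF v] \<nu>_vertex[OF H, of v] in auto)
  qed
  also have "\<dots> = c w" using V(1,5) by simp
  finally show ?thesis using c(4) by simp
qed

lemma \<nu>_\<sigma>: assumes G: "G \<in> acts" and y: "y \<in> G" shows "\<nu> (\<sigma> ` G) (\<sigma> y) = \<nu> G y"
proof -
  note V = acts_vertices[OF G]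
  obtain c where c: "(\<Sum>v\<in>vertices G. c v *\<^sub>R v) = y" "c w = \<nu> G y"
    using facet_combination[OF G y] by blast
  have "\<nu> (\<sigma> ` G) (\<sigma> y) = (\<Sum>v\<in>vertices G. c v * \<nu> (\<sigma> ` G) (\<sigma> v))"
    unfolding c(1)[symmetric] linear_sum[OF lin_\<sigma>] linear_sum[OF lin_\<nu>[OF \<sigma>_acts(1)[OF G]]]
    by (simp add: linear_cmul[OF lin_\<nu>[OF \<sigma>_acts(1)[OF G]]] linear_cmul[OF lin_\<sigma>])
  also have "\<dots> = (\<Sum>v\<in>vertices G. if v = w then c w else 0)"
  proof (intro sum.cong refl)
    fix v assume v: "v \<in> vertices G"
    have "\<sigma> v \<in> vertices (\<sigma> ` G)" using v by (simp add: vertices_\<sigma>)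
    moreover have "\<sigma> v = w \<longleftrightarrow> v = w" using \<sigma>_simps by metis
    ultimately show "c v * \<nu> (\<sigma> ` G) (\<sigma> v) = (if v = w then c w else 0)" using \<nu>_vertex[OF \<sigma>_acts(1)[OF G]] by simp
  qed
  also have "\<dots> = c w" using V(1,5) by simp
  finally show ?thesis using c(2) by simp
qed

text \<open>The projection along \<open>u\<close> onto the hyperplane of \<open>G\<close>.\<close>

definition \<tau> where "\<tau> G x = x + ((1 - nrm G \<bullet> x) / (nrm G \<bullet> u)) *\<^sub>R u"

text \<open>The part of \<open>P\<close> swept by the chords in direction \<open>u\<close> that meet
  \<open>G\<close>.\<close>

definition Dom where "Dom G = {x \<in> P. \<tau> G x \<in> G}"

text \<open>The speed, in units of \<open>u\<close>, at which the chord through \<open>x\<close> is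
  translated: the weight of \<open>w\<close> at its upper end, or 0 if that end does not lie on a
  moving facet.\<close>

definition \<beta> where "\<beta> x = (if \<exists>G\<in>ups. x \<in> Dom G then let G = SOME G. G \<in> ups \<and> x \<in> Dom G in \<nu> G (\<tau> G x) else 0)"

lemma \<tau>_line: "G \<in> acts \<Longrightarrow> \<tau> G (x + s *\<^sub>R u) = \<tau> G x"
proof -
  assume "G \<in> acts"
  then have k: "nrm G \<bullet> u \<noteq> 0" by (rule acts_facet)
  have "(1 - nrm G \<bullet> (x + s *\<^sub>R u)) / (nrm G \<bullet> u) = (1 - nrm G \<bullet> x) / (nrm G \<bullet> u) - s"
    using k by (simp add: inner_add_right field_simps)
  then show ?thesis by (simp add: \<tau>_def scaleR_left_diff_distrib)
qed

lemma \<tau>_facet: "G \<in> acts \<Longrightarrow> y \<in> G \<Longrightarrow> \<tau> G y = y"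
  using facet_nrm[OF acts_facet(1)] by (simp add: \<tau>_def)

text \<open>The chord leaves \<open>P\<close> at a single point, so all facets eligible in the
  choice give the same end point, and \<open>\<nu>_consistent\<close> gives the same weight
  there.\<close>

lemma \<beta>_eq:
  assumes G: "G \<in> ups" "x \<in> Dom G"
  shows "\<beta> x = \<nu> G (\<tau> G x)"
proof -
  define H where "H = (SOME G. G \<in> ups \<and> x \<in> Dom G)"
  have H: "H \<in> ups \<and> x \<in> Dom H" unfolding H_def by (rule someI_ex) (use G in blast)
  have \<beta>: "\<beta> x = \<nu> H (\<tau> H x)" using G by (auto simp: \<beta>_def H_def Let_def)
  define s where "s G = (1 - nrm G \<bullet> x) / (nrm G \<bullet> u)" for G
  have le: "s H \<le> s G" if "G \<in> ups" "H \<in> ups" "x \<in> Dom G" "x \<in> Dom H" for G H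
  proof -
    note uG = ups_acts[OF that(1)] and uH = ups_acts[OF that(2)]
    have "\<tau> H x \<in> P" using that(4) facet_subset_P[OF acts_facet(1)[OF uH(1)]] by (auto simp: Dom_def)
    then have "nrm G \<bullet> \<tau> H x \<le> 1" by (rule P_nrm[OF acts_facet(1)[OF uG(1)]])
    then have "nrm G \<bullet> x + s H * (nrm G \<bullet> u) \<le> 1" by (simp add: \<tau>_def inner_add_right s_def)
    then show ?thesis using uG(2) by (simp add: s_def pos_le_divide_eq)
  qed
  have "s G = s H" using le H G by (meson antisym)
  then have "\<tau> G x = \<tau> H x" by (simp add: \<tau>_def s_def)
  then show ?thesis unfolding \<beta>
    using \<nu>_consistent[of H G "\<tau> G x"] ups_acts(1) H G by (auto simp: Dom_def)
qed

lemma \<beta>_zero: "(\<And>G. G \<in> ups \<Longrightarrow> x \<notin> Dom G) \<Longrightarrow> \<beta> x = 0"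
  by (auto simp: \<beta>_def)

lemma \<beta>_range: "0 \<le> \<beta> x \<and> \<beta> x \<le> 1"
proof (cases "\<exists>G\<in>ups. x \<in> Dom G")
  case True
  then obtain G where G: "G \<in> ups" "x \<in> Dom G" by blast
  then show ?thesis using \<beta>_eq[OF G] \<nu>_range[OF ups_acts(1)[OF G(1)], of "\<tau> G x"] by (simp add: Dom_def)
qed (auto simp: \<beta>_def)

lemma Dom_line: "G \<in> acts \<Longrightarrow> x \<in> Dom G \<Longrightarrow> x + s *\<^sub>R u \<in> P \<Longrightarrow> x + s *\<^sub>R u \<in> Dom G"
  by (simp add: Dom_def \<tau>_line)

text \<open>Every chord moves as a whole, which makes the displacement map injective on
  \<open>P\<close>.\<close>

lemma \<beta>_line:
  assumes "x \<in> P" "x + s *\<^sub>R u \<in> P"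
  shows "\<beta> (x + s *\<^sub>R u) = \<beta> x"
proof (cases "\<exists>G\<in>ups. x \<in> Dom G")
  case True
  then obtain G where G: "G \<in> ups" "x \<in> Dom G" by blast
  have "x + s *\<^sub>R u \<in> Dom G" by (rule Dom_line[OF ups_acts(1)[OF G(1)] G(2) assms(2)])
  then show ?thesis using \<beta>_eq[OF G] \<beta>_eq[OF G(1)] \<tau>_line[OF ups_acts(1)[OF G(1)]] by simp
next
  case False
  have "x + s *\<^sub>R u \<notin> Dom G" if "G \<in> ups" for G
  proof
    assume "x + s *\<^sub>R u \<in> Dom G"
    then have "(x + s *\<^sub>R u) + (- s) *\<^sub>R u \<in> Dom G"
      by (rule Dom_line[OF ups_acts(1)[OF that]]) (use assms(1) in simp)
    then show False using False that by auto
  qed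
  then show ?thesis using False \<beta>_zero by auto
qed

text \<open>A ratio test: among the facets whose normals increase along \<open>d\<close>, the one
  that is reached first contains the exit point.\<close>

lemma exit_point:
  assumes x: "x \<in> P" and d: "d \<noteq> 0"
  obtains s H where "s \<ge> 0" "H facet_of P" "nrm H \<bullet> d > 0" "x + s *\<^sub>R d \<in> H"
proof -
  define \<H> where "\<H> = {H. H facet_of P \<and> nrm H \<bullet> d > 0}"
  have fin: "finite \<H>" by (rule finite_subset[OF _ finite_facets]) (auto simp: \<H>_def)
  define r where "r H = (1 - nrm H \<bullet> x) / (nrm H \<bullet> d)" for H
  have ne: "\<H> \<noteq> {}"
  proof
    assume "\<H> = {}"
    then have neg: "nrm H \<bullet> d \<le> 0" if "H facet_of P" for H using that by (force simp: \<H>_def)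
    have ray: "x + s *\<^sub>R d \<in> P" if "s \<ge> 0" for s
    proof -
      have "nrm H \<bullet> (x + s *\<^sub>R d) \<le> 1" if "H facet_of P" for H
        using P_nrm[OF that x] mult_nonneg_nonpos[OF \<open>s \<ge> 0\<close> neg[OF that]] by (simp add: inner_add_right)
      then show ?thesis using P_eq by blast
    qed
    obtain R where R: "\<And>p. p \<in> P \<Longrightarrow> norm p \<le> R" using P_basic(6) by (auto simp: bounded_iff)
    \<comment> \<open>The displacement becomes longer than the diameter of a ball containing
      \<open>P\<close>.\<close>
    define s where "s = (2 * \<bar>R\<bar> + 1) / norm d"
    have "norm (s *\<^sub>R d) \<le> norm (x + s *\<^sub>R d) + norm x" using norm_triangle_ineq4[of "x + s *\<^sub>R d" x] by simp
    moreover have "s \<ge> 0" using d by (simp add: s_def)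
    moreover have "norm (s *\<^sub>R d) = 2 * \<bar>R\<bar> + 1" using d by (simp add: s_def)
    ultimately show False using R[OF x] R[OF ray[of s]] by linarith
  qed
  have "Min (r ` \<H>) \<in> r ` \<H>" using fin ne by (intro Min_in) auto
  then obtain H where H: "H \<in> \<H>" "r H = Min (r ` \<H>)" by auto
  have rmin: "r H \<le> r G" if "G \<in> \<H>" for G unfolding H(2) using fin that by simp
  have Hf: "H facet_of P" "nrm H \<bullet> d > 0" using H(1) by (auto simp: \<H>_def)
  have r0: "r H \<ge> 0" using P_nrm[OF Hf(1) x] Hf(2) by (simp add: r_def)
  have "nrm G \<bullet> (x + r H *\<^sub>R d) \<le> 1" if G: "G facet_of P" for G
  proof (cases "nrm G \<bullet> d > 0")
    case True
    then have "r H \<le> r G" using rmin G by (simp add: \<H>_def)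
    then have "r H * (nrm G \<bullet> d) \<le> 1 - nrm G \<bullet> x" using True by (simp add: r_def[of G] pos_le_divide_eq)
    then show ?thesis by (simp add: inner_add_right)
  next
    case False
    then show ?thesis using P_nrm[OF G x] mult_nonneg_nonpos[OF r0, of "nrm G \<bullet> d"] by (simp add: inner_add_right)
  qed
  then have "x + r H *\<^sub>R d \<in> P" using P_eq by blast
  moreover have "nrm H \<bullet> (x + r H *\<^sub>R d) = 1" using Hf(2) by (simp add: inner_add_right r_def)
  ultimately have "x + r H *\<^sub>R d \<in> H" using in_facet_iff[OF Hf(1)] by blast
  then show thesis using that r0 Hf by blast
qed

section \<open>The polytope with the moved vertex\<close>

definition Bs where "Bs = vertices P - {w}"

definition Kt where "Kt t = convex hull (insert (w + t *\<^sub>R u) Bs)"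

lemma finite_vertices: "finite (vertices P)"
  unfolding vertices_def by (rule finite_polyhedron_extreme_points[OF polytope_imp_polyhedron[OF polytope]])

lemma facet_in_hull_Bs: assumes H: "H facet_of P" "w \<notin> H" shows "H \<subseteq> convex hull Bs"
proof -
  have "H face_of P" by (rule facet_of_imp_face_of[OF H(1)])
  then have "compact H" "convex H" using face_of_imp_compact[OF P_basic(2,1)] face_of_imp_convex by auto
  then have "H = convex hull (vertices H)" unfolding vertices_def by (rule Krein_Milman_Minkowski)
  moreover have "vertices H \<subseteq> Bs" using vertices_facet[OF H(1)] H(2) by (auto simp: Bs_def)
  ultimately show ?thesis using hull_mono by blast
qed

text \<open>On the line through \<open>x\<close>, either both ends of the chord of \<open>P\<close> lie on moving facets, mirrored by \<open>\<sigma>\<close>,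
  or neither end does.\<close>

lemma chord_moving:
  assumes G: "G \<in> ups" and x: "x \<in> Dom G"
  obtains s r where "s \<ge> 0" "r \<ge> 0" "\<tau> G x = x + s *\<^sub>R u" "\<sigma> (\<tau> G x) = x - r *\<^sub>R u" "\<tau> G x \<in> G" "\<sigma> (\<tau> G x) \<in> \<sigma> ` G"
proof -
  note a = ups_acts[OF G]
  have xP: "x \<in> P" and y: "\<tau> G x \<in> G" using x by (auto simp: Dom_def)
  define s where "s = (1 - nrm G \<bullet> x) / (nrm G \<bullet> u)"
  have \<tau>: "\<tau> G x = x + s *\<^sub>R u" by (simp add: \<tau>_def s_def)
  have s: "s \<ge> 0" using a(2) P_nrm[OF acts_facet(1)[OF a(1)] xP] by (simp add: s_def)
  define r where "r = \<mu> (\<tau> G x) - s"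
  have \<sigma>: "\<sigma> (\<tau> G x) = x - r *\<^sub>R u" by (simp add: \<sigma>_def r_def \<tau> algebra_simps)
  have "nrm (\<sigma> ` G) \<bullet> x \<le> 1" by (rule P_nrm[OF \<sigma>_facet[OF a(1)] xP])
  moreover have "nrm (\<sigma> ` G) \<bullet> (x - r *\<^sub>R u) = 1"
    unfolding \<sigma>[symmetric] using y by (intro facet_nrm \<sigma>_facet a) auto
  ultimately have "r * (nrm G \<bullet> u) \<ge> 0" using \<sigma>_acts(2)[OF a(1)] by (simp add: inner_diff_right)
  then have "r \<ge> 0" using a(2) by (simp add: zero_le_mult_iff)
  then show thesis using that s \<tau> \<sigma> y by blast
qed

lemma chord_fixed:
  assumes x: "x \<in> P" "\<And>G. G \<in> ups \<Longrightarrow> x \<notin> Dom G"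
  obtains s r H H' where "s \<ge> 0" "r \<ge> 0" "H facet_of P" "H' facet_of P" "w \<notin> H" "w \<notin> H'"
    "nrm H \<bullet> u > 0" "nrm H' \<bullet> u < 0" "x + s *\<^sub>R u \<in> H" "x - r *\<^sub>R u \<in> H'"
proof -
  obtain s H where H: "s \<ge> 0" "H facet_of P" "nrm H \<bullet> u > 0" "x + s *\<^sub>R u \<in> H"
    using exit_point[OF x(1) u] by blast
  have "- u \<noteq> 0" using u by simp
  then obtain r H' where H': "r \<ge> 0" "H' facet_of P" "nrm H' \<bullet> (- u) > 0" "x + r *\<^sub>R (- u) \<in> H'"
    using exit_point[OF x(1)] by blast
  have "w \<notin> H"
  proof
    assume "w \<in> H"
    then have Hu: "H \<in> ups" using H by (simp add: ups_def)
    have "\<tau> H x = x + s *\<^sub>R u" using \<tau>_line[OF ups_acts(1)[OF Hu], of x s] \<tau>_facet[OF ups_acts(1)[OF Hu] H(4)] by simp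
    then have "x \<in> Dom H" using x(1) H(4) by (simp add: Dom_def)
    then show False using x(2)[OF Hu] by blast
  qed
  \<comment> \<open>If the lower end lay on a moving facet, its mirror image would be the upper end
    and would lie on a facet in \<open>ups\<close>.\<close>
  moreover have "w \<notin> H'"
  proof
    assume "w \<in> H'"
    then have Ha: "H' \<in> acts" "H' \<notin> ups" using H' by (auto simp: ups_def acts_def)
    have Hu: "\<sigma> ` H' \<in> ups" by (rule \<sigma>_ups[OF Ha])
    define y where "y = x - r *\<^sub>R u"
    have y: "y \<in> H'" using H' by (simp add: y_def)
    have "\<sigma> y = x + (- r - \<mu> y) *\<^sub>R u" by (simp add: \<sigma>_def y_def algebra_simps)
    moreover have "\<tau> (\<sigma> ` H') (\<sigma> y) = \<sigma> y" by (rule \<tau>_facet[OF ups_acts(1)[OF Hu]]) (use y in simp)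
    ultimately have "\<tau> (\<sigma> ` H') x = \<sigma> y" using \<tau>_line[OF ups_acts(1)[OF Hu], of x "- r - \<mu> y"] by simp
    then have "x \<in> Dom (\<sigma> ` H')" using x(1) y by (simp add: Dom_def)
    then show False using x(2)[OF Hu] by blast
  qed
  ultimately show thesis using that H H' by simp
qed

text \<open>The normal of the facet that \<open>G\<close> becomes when \<open>w\<close> is moved to \<open>w + t u\<close>.\<close>

definition nrm_t where "nrm_t t G x = nrm G \<bullet> x - t * (nrm G \<bullet> u) / (1 + t * \<nu> G u) * \<nu> G x"

lemma lin_nrm_t: "G \<in> acts \<Longrightarrow> linear (nrm_t t G)"
proof -
  assume G: "G \<in> acts"
  have "linear (\<lambda>x. nrm G \<bullet> x - k * \<nu> G x)" for k
    by (intro linearI) (simp_all add: linear_add[OF lin_\<nu>[OF G]] linear_cmul[OF lin_\<nu>[OF G]] inner_add_right algebra_simps)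
  then show ?thesis unfolding nrm_t_def .
qed

text \<open>Says that the halfspaces of the tilted facets and of the facets missing \<open>w\<close>
  still contain all generators of \<open>Kt t\<close>. The positive denominator keeps the sign of
  the normal in direction \<open>u\<close>.\<close>

definition good where "good t \<longleftrightarrow> (\<forall>G\<in>acts. 1 + t * \<nu> G u > 0 \<and> (\<forall>q\<in>Bs - G. nrm_t t G q \<le> 1))
   \<and> (\<forall>G. G facet_of P \<longrightarrow> w \<notin> G \<longrightarrow> nrm G \<bullet> (w + t *\<^sub>R u) \<le> 1)"

text \<open>These are finitely many conditions, continuous in \<open>t\<close> near 0, that hold
  strictly at \<open>t = 0\<close>.\<close>

lemma good_near_0: "\<exists>t0>0. \<forall>t. \<bar>t\<bar> < t0 \<longrightarrow> good t"
proof -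
  have ev: "\<forall>\<^sub>F t in nhds 0. f t < c" if "isCont f 0" "f 0 < c" for f :: "real \<Rightarrow> real" and c
    using order_tendstoD(2)[OF that(1)[unfolded isCont_def tendsto_at_iff_tendsto_nhds] that(2)] .
  have "\<forall>\<^sub>F t in nhds 0. \<forall>G\<in>acts. 1 + t * \<nu> G u > 0 \<and> (\<forall>q\<in>Bs - G. nrm_t t G q \<le> 1)"
  proof (intro eventually_ball_finite finite_acts ballI eventually_conj)
    fix G assume G: "G \<in> acts"
    have "\<forall>\<^sub>F t in nhds 0. - (1 + t * \<nu> G u) < 0" by (rule ev) (auto intro!: continuous_intros)
    then show "\<forall>\<^sub>F t in nhds 0. 1 + t * \<nu> G u > 0" by eventually_elim simp
    show "finite (Bs - G)" using finite_vertices by (simp add: Bs_def)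
    fix q assume q: "q \<in> Bs - G"
    then have qP: "q \<in> P" using vertices_subset by (auto simp: Bs_def)
    have "nrm G \<bullet> q < 1" using P_nrm[OF acts_facet(1)[OF G] qP] in_facet_iff[OF acts_facet(1)[OF G] qP] q by auto
    then have "\<forall>\<^sub>F t in nhds 0. nrm_t t G q < 1"
      unfolding nrm_t_def by (intro ev) (auto intro!: continuous_intros)
    then show "\<forall>\<^sub>F t in nhds 0. nrm_t t G q \<le> 1" by eventually_elim simp
  qed
  moreover have "\<forall>\<^sub>F t in nhds 0. \<forall>G\<in>{G. G facet_of P}. w \<notin> G \<longrightarrow> nrm G \<bullet> (w + t *\<^sub>R u) \<le> 1"
  proof (intro eventually_ball_finite finite_facets ballI)
    fix G assume "G \<in> {G. G facet_of P}"
    then have G: "G facet_of P" by simp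
    have wP: "w \<in> P" using w vertices_subset by blast
    show "\<forall>\<^sub>F t in nhds 0. w \<notin> G \<longrightarrow> nrm G \<bullet> (w + t *\<^sub>R u) \<le> 1"
    proof (cases "w \<in> G")
      case False
      then have "nrm G \<bullet> w < 1" using P_nrm[OF G wP] in_facet_iff[OF G wP] by auto
      then have "\<forall>\<^sub>F t in nhds 0. nrm G \<bullet> (w + t *\<^sub>R u) < 1" by (intro ev) (auto intro!: continuous_intros)
      then show ?thesis by eventually_elim simp
    qed simp
  qed
  ultimately have "\<forall>\<^sub>F t in nhds 0. good t"
    by eventually_elim (auto simp: good_def)
  then show ?thesis by (auto simp: eventually_nhds_metric dist_norm)
qed

lemma nrm_t_w: "G \<in> acts \<Longrightarrow> good t \<Longrightarrow> nrm_t t G (w + t *\<^sub>R u) = 1"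
proof -
  assume G: "G \<in> acts" and t: "good t"
  have p: "1 + t * \<nu> G u > 0" using G t by (auto simp: good_def)
  have "\<nu> G (w + t *\<^sub>R u) = 1 + t * \<nu> G u"
    using \<nu>_vertex[OF G acts_vertices(5)[OF G]] by (simp add: linear_add[OF lin_\<nu>[OF G]] linear_cmul[OF lin_\<nu>[OF G]])
  moreover have "nrm G \<bullet> w = 1" by (rule facet_nrm[OF acts_facet(1)[OF G] acts_facet(2)[OF G]])
  ultimately show ?thesis using p by (simp add: nrm_t_def inner_add_right)
qed

lemma nrm_t_u: assumes G: "G \<in> acts" and t: "good t" shows "nrm_t t G u = (nrm G \<bullet> u) / (1 + t * \<nu> G u)" "1 + t * \<nu> G u > 0"
proof -
  show p: "1 + t * \<nu> G u > 0" using G t by (auto simp: good_def)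
  then show "nrm_t t G u = (nrm G \<bullet> u) / (1 + t * \<nu> G u)" by (simp add: nrm_t_def field_simps)
qed

lemma nrm_t_vertex: "G \<in> acts \<Longrightarrow> q \<in> vertices G \<Longrightarrow> q \<noteq> w \<Longrightarrow> nrm_t t G q = 1"
  using facet_nrm[OF acts_facet(1)] vertices_subset[of G] by (auto simp: nrm_t_def \<nu>_vertex)

lemma Kt_halfspaces:
  assumes t: "good t" and z: "z \<in> Kt t"
  shows "G \<in> acts \<Longrightarrow> nrm_t t G z \<le> 1" "G facet_of P \<Longrightarrow> w \<notin> G \<Longrightarrow> nrm G \<bullet> z \<le> 1"
proof -
  have BsP: "q \<in> P" if "q \<in> Bs" for q using that vertices_subset by (auto simp: Bs_def)
  show "nrm_t t G z \<le> 1" if G: "G \<in> acts"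
  proof -
    have "insert (w + t *\<^sub>R u) Bs \<subseteq> {z. nrm_t t G z \<le> 1}"
    proof safe
      show "nrm_t t G (w + t *\<^sub>R u) \<le> 1" using nrm_t_w[OF G t] by simp
      fix q assume q: "q \<in> Bs"
      show "nrm_t t G q \<le> 1"
      proof (cases "q \<in> G")
        case True
        then have "q \<in> vertices G" "q \<noteq> w" using q vertices_facet[OF acts_facet(1)[OF G]] by (auto simp: Bs_def)
        then show ?thesis using nrm_t_vertex[OF G] by simp
      next
        case False then show ?thesis using t G q by (auto simp: good_def)
      qed
    qed
    moreover have "convex {z. nrm_t t G z \<le> 1}"
      using convex_linear_vimage[OF lin_nrm_t[OF G, of t] convex_real_interval(2)[of 1]] by (simp add: vimage_def atMost_def)
    ultimately have "Kt t \<subseteq> {z. nrm_t t G z \<le> 1}" unfolding Kt_def by (rule hull_minimal)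
    then show ?thesis using z by blast
  qed
  show "nrm G \<bullet> z \<le> 1" if G: "G facet_of P" "w \<notin> G"
  proof -
    have "insert (w + t *\<^sub>R u) Bs \<subseteq> {z. nrm G \<bullet> z \<le> 1}"
      using t G P_nrm[OF G(1) BsP] by (auto simp: good_def)
    then have "Kt t \<subseteq> {z. nrm G \<bullet> z \<le> 1}" unfolding Kt_def by (intro hull_minimal convex_halfspace_le)
    then show ?thesis using z by blast
  qed
qed

text \<open>The convex combination representing \<open>y\<close> keeps its coefficients while
  \<open>w\<close> is replaced by its moved position.\<close>

lemma facet_moved:
  assumes G: "G \<in> acts" and y: "y \<in> G"
  shows "y + (t * \<nu> G y) *\<^sub>R u \<in> Kt t" and "good t \<Longrightarrow> nrm_t t G (y + (t * \<nu> G y) *\<^sub>R u) = 1"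
proof -
  note V = acts_vertices[OF G]
  obtain c where c: "\<And>v. v \<in> vertices G \<Longrightarrow> 0 \<le> c v" "sum c (vertices G) = 1" "(\<Sum>v\<in>vertices G. c v *\<^sub>R v) = y" "c w = \<nu> G y"
    using facet_combination[OF G y] by blast
  define m where "m v = (if v = w then w + t *\<^sub>R u else v)" for v
  have eq: "y + (t * \<nu> G y) *\<^sub>R u = (\<Sum>v\<in>vertices G. c v *\<^sub>R m v)"
  proof -
    have "(\<Sum>v\<in>vertices G. c v *\<^sub>R m v) = (\<Sum>v\<in>vertices G. c v *\<^sub>R v + (if v = w then (t * c w) *\<^sub>R u else 0))"
      by (intro sum.cong refl) (auto simp: m_def algebra_simps)
    also have "\<dots> = y + (t * c w) *\<^sub>R u" using V(1,5) c(3) by (simp add: sum.distrib)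
    finally show ?thesis by (simp add: c(4))
  qed
  have mK: "m v \<in> Kt t" if "v \<in> vertices G" for v
    unfolding Kt_def using that V(6) by (intro hull_inc) (auto simp: m_def Bs_def)
  show "y + (t * \<nu> G y) *\<^sub>R u \<in> Kt t"
    unfolding eq using V(1) c mK by (intro convex_sum) (auto simp: Kt_def)
  assume t: "good t"
  have "nrm_t t G (\<Sum>v\<in>vertices G. c v *\<^sub>R m v) = (\<Sum>v\<in>vertices G. c v * nrm_t t G (m v))"
    unfolding linear_sum[OF lin_nrm_t[OF G]] by (simp add: linear_cmul[OF lin_nrm_t[OF G]])
  also have "\<dots> = (\<Sum>v\<in>vertices G. c v)"
    using nrm_t_w[OF G t] nrm_t_vertex[OF G] by (intro sum.cong refl) (auto simp: m_def)
  finally show "nrm_t t G (y + (t * \<nu> G y) *\<^sub>R u) = 1" unfolding eq by (simp add: c(2))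
qed

lemma hull_Bs_Kt: "convex hull Bs \<subseteq> Kt t"
  unfolding Kt_def by (rule hull_mono) auto

text \<open>Both ends of the chord through \<open>x\<close> move by the same vector into
  \<open>Kt t\<close>; convexity gives the points between them.\<close>

lemma moved_in_Kt:
  assumes x: "x \<in> P"
  shows "x + (t * \<beta> x) *\<^sub>R u \<in> Kt t"
proof -
  have cK: "convex (Kt t)" by (simp add: Kt_def)
  show ?thesis
  proof (cases "\<exists>G\<in>ups. x \<in> Dom G")
    case True
    then obtain G where G: "G \<in> ups" "x \<in> Dom G" by blast
    note a = ups_acts(1)[OF G(1)]
    obtain s r where sr: "s \<ge> 0" "r \<ge> 0" "\<tau> G x = x + s *\<^sub>R u" "\<sigma> (\<tau> G x) = x - r *\<^sub>R u" "\<tau> G x \<in> G" "\<sigma> (\<tau> G x) \<in> \<sigma> ` G"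
      using chord_moving[OF G] by blast
    have \<beta>: "\<beta> x = \<nu> G (\<tau> G x)" by (rule \<beta>_eq[OF G])
    have 1: "\<tau> G x + (t * \<beta> x) *\<^sub>R u \<in> Kt t" unfolding \<beta> by (rule facet_moved(1)[OF a sr(5)])
    have 2: "\<sigma> (\<tau> G x) + (t * \<beta> x) *\<^sub>R u \<in> Kt t"
      using facet_moved(1)[OF \<sigma>_acts(1)[OF a] sr(6)] unfolding \<nu>_\<sigma>[OF a sr(5)] \<beta> .
    show ?thesis
    proof (rule convex_line_between[OF cK _ _ sr(1,2)])
      show "x + (t * \<beta> x) *\<^sub>R u + s *\<^sub>R u \<in> Kt t" using 1 unfolding sr(3) by (simp add: ac_simps)
      show "x + (t * \<beta> x) *\<^sub>R u - r *\<^sub>R u \<in> Kt t" using 2 unfolding sr(4) by (simp add: algebra_simps)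
    qed
  next
    case False
    then have \<beta>: "\<beta> x = 0" using \<beta>_zero by blast
    obtain s r H H' where h: "s \<ge> 0" "r \<ge> 0" "H facet_of P" "H' facet_of P" "w \<notin> H" "w \<notin> H'"
        "x + s *\<^sub>R u \<in> H" "x - r *\<^sub>R u \<in> H'"
      using chord_fixed[OF x] False by metis
    have "x + s *\<^sub>R u \<in> Kt t" "x - r *\<^sub>R u \<in> Kt t"
      using facet_in_hull_Bs[OF h(3,5)] facet_in_hull_Bs[OF h(4,6)] h(7,8) hull_Bs_Kt by blast+
    then have "x \<in> Kt t" using convex_line_between[OF cK _ _ h(1,2)] by blast
    then show ?thesis by (simp add: \<beta>)
  qed
qed

text \<open>The line through \<open>z\<close> meets \<open>P\<close> in a chord. The halfspaces at
  its two ends, tilted or unchanged, confine \<open>z\<close> to the translate of that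
  chord.\<close>

lemma Kt_moved:
  assumes t: "good t" and z: "z \<in> Kt t"
  shows "\<exists>x\<in>P. z = x + (t * \<beta> x) *\<^sub>R u"
proof -
  \<comment> \<open>The right-hand side is \<open>P\<close> plus the line spanned by
    \<open>u\<close>. It is convex and contains the generators of \<open>Kt t\<close>.\<close>
  have "Kt t \<subseteq> (\<Union>x\<in>P. \<Union>s\<in>range (\<lambda>s. s *\<^sub>R u). {x + s})"
    unfolding Kt_def
  proof (rule hull_minimal)
    have "w \<in> P" "Bs \<subseteq> P" using w vertices_subset by (auto simp: Bs_def)
    moreover have "q \<in> (\<Union>x\<in>P. \<Union>s\<in>range (\<lambda>s. s *\<^sub>R u). {x + s})" if "x \<in> P" "q = x + s *\<^sub>R u" for q x s
      using that by blast
    moreover have "q = q + 0 *\<^sub>R u" for q by simp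
    ultimately show "insert (w + t *\<^sub>R u) Bs \<subseteq> (\<Union>x\<in>P. \<Union>s\<in>range (\<lambda>s. s *\<^sub>R u). {x + s})"
      by (metis (no_types, lifting) insert_subset subset_iff)
    have "range (\<lambda>s. s *\<^sub>R u) = span {u}" by (simp add: span_singleton)
    then show "convex (\<Union>x\<in>P. \<Union>s\<in>range (\<lambda>s. s *\<^sub>R u). {x + s})"
      using convex_sums[OF P_basic(2) subspace_imp_convex[OF subspace_span[of "{u}"]]] by simp
  qed
  then have "z \<in> (\<Union>x\<in>P. \<Union>s\<in>range (\<lambda>s. s *\<^sub>R u). {x + s})" using z by (rule subsetD)
  then obtain x0 r0 where x0: "x0 \<in> P" "z = x0 + r0 *\<^sub>R u" by auto
  \<comment> \<open>Undoes the displacement of the chord through \<open>x0\<close>; it remains to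
    see that the result lies between the two ends of that chord.\<close>
  define x where "x = x0 + (r0 - t * \<beta> x0) *\<^sub>R u"
  have zx: "z = x + (t * \<beta> x0) *\<^sub>R u" by (simp add: x_def x0(2) algebra_simps)
  have "x \<in> P"
  proof (cases "\<exists>G\<in>ups. x0 \<in> Dom G")
    case True
    then obtain G where G: "G \<in> ups" "x0 \<in> Dom G" by blast
    note a = ups_acts[OF G(1)]
    obtain s r where sr: "s \<ge> 0" "r \<ge> 0" "\<tau> G x0 = x0 + s *\<^sub>R u" "\<sigma> (\<tau> G x0) = x0 - r *\<^sub>R u" "\<tau> G x0 \<in> G" "\<sigma> (\<tau> G x0) \<in> \<sigma> ` G"
      using chord_moving[OF G] by blast
    have \<beta>: "\<beta> x0 = \<nu> G (\<tau> G x0)" by (rule \<beta>_eq[OF G])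
    let ?d = "r0 - t * \<beta> x0"
    have up: "?d \<le> s"
    proof -
      have "z = (\<tau> G x0 + (t * \<nu> G (\<tau> G x0)) *\<^sub>R u) + (?d - s) *\<^sub>R u" by (simp add: x0(2) sr(3) \<beta> algebra_simps)
      then have "nrm_t t G z = 1 + (?d - s) * nrm_t t G u"
        using facet_moved(2)[OF a(1) sr(5) t] by (simp add: linear_add[OF lin_nrm_t[OF a(1)]] linear_cmul[OF lin_nrm_t[OF a(1)]])
      then have "(?d - s) * nrm_t t G u \<le> 0" using Kt_halfspaces(1)[OF t z a(1)] by simp
      moreover have "nrm_t t G u > 0" using nrm_t_u[OF a(1) t] a(2) by simp
      ultimately show ?thesis by (simp add: mult_le_0_iff)
    qed
    have dn: "- r \<le> ?d"
    proof -
      note b = \<sigma>_acts[OF a(1)]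
      have "z = (\<sigma> (\<tau> G x0) + (t * \<nu> (\<sigma> ` G) (\<sigma> (\<tau> G x0))) *\<^sub>R u) + (?d + r) *\<^sub>R u"
        unfolding \<nu>_\<sigma>[OF a(1) sr(5)] by (simp add: x0(2) sr(4) \<beta> algebra_simps)
      then have "nrm_t t (\<sigma> ` G) z = 1 + (?d + r) * nrm_t t (\<sigma> ` G) u"
        using facet_moved(2)[OF b(1) sr(6) t] by (simp add: linear_add[OF lin_nrm_t[OF b(1)]] linear_cmul[OF lin_nrm_t[OF b(1)]])
      then have "(?d + r) * nrm_t t (\<sigma> ` G) u \<le> 0" using Kt_halfspaces(1)[OF t z b(1)] by simp
      moreover have "nrm_t t (\<sigma> ` G) u < 0" using nrm_t_u[OF b(1) t] b(2) a(2) by (simp add: divide_less_0_iff)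
      ultimately show ?thesis by (simp add: mult_le_0_iff)
    qed
    show ?thesis
    proof (rule convex_line_between[OF P_basic(2)])
      have "\<tau> G x0 \<in> P" "\<sigma> (\<tau> G x0) \<in> P"
        using sr(5,6) facet_subset_P[OF acts_facet(1)[OF a(1)]] facet_subset_P[OF \<sigma>_facet[OF a(1)]] by auto
      moreover have "x + (s - ?d) *\<^sub>R u = \<tau> G x0" by (simp add: x_def sr(3) algebra_simps)
      moreover have "x - (?d + r) *\<^sub>R u = \<sigma> (\<tau> G x0)" unfolding sr(4) by (simp add: x_def algebra_simps)
      ultimately show "x + (s - ?d) *\<^sub>R u \<in> P" "x - (?d + r) *\<^sub>R u \<in> P" by simp_all
    qed (use up dn in auto)
  next
    case False
    then have \<beta>: "\<beta> x0 = 0" using \<beta>_zero by blast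
    obtain s r H H' where h: "s \<ge> 0" "r \<ge> 0" "H facet_of P" "H' facet_of P" "w \<notin> H" "w \<notin> H'"
        "nrm H \<bullet> u > 0" "nrm H' \<bullet> u < 0" "x0 + s *\<^sub>R u \<in> H" "x0 - r *\<^sub>R u \<in> H'"
      using chord_fixed[OF x0(1)] False by metis
    have up: "r0 \<le> s"
    proof -
      have "z = (x0 + s *\<^sub>R u) + (r0 - s) *\<^sub>R u" by (simp add: x0(2) algebra_simps)
      then have "nrm H \<bullet> z = 1 + (r0 - s) * (nrm H \<bullet> u)"
        using facet_nrm[OF h(3,9)] by (simp only: inner_add_right inner_scaleR_right)
      then have "(r0 - s) * (nrm H \<bullet> u) \<le> 0" using Kt_halfspaces(2)[OF t z h(3,5)] by simp
      then show ?thesis using h(7) by (simp add: mult_le_0_iff)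
    qed
    have dn: "- r \<le> r0"
    proof -
      have "z = (x0 - r *\<^sub>R u) + (r0 + r) *\<^sub>R u" by (simp add: x0(2) algebra_simps)
      then have "nrm H' \<bullet> z = 1 + (r0 + r) * (nrm H' \<bullet> u)"
        using facet_nrm[OF h(4,10)] by (simp only: inner_add_right inner_scaleR_right)
      then have "(r0 + r) * (nrm H' \<bullet> u) \<le> 0" using Kt_halfspaces(2)[OF t z h(4,6)] by simp
      then show ?thesis using h(8) by (simp add: mult_le_0_iff)
    qed
    show ?thesis
    proof (rule convex_line_between[OF P_basic(2)])
      have "x0 + s *\<^sub>R u \<in> P" "x0 - r *\<^sub>R u \<in> P" using h facet_subset_P by blast+
      then show "x + (s - r0) *\<^sub>R u \<in> P" "x - (r0 + r) *\<^sub>R u \<in> P" by (simp_all add: x_def \<beta> algebra_simps)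
    qed (use up dn in auto)
  qed
  moreover have "\<beta> x = \<beta> x0" unfolding x_def using \<beta>_line[OF x0(1)] \<open>x \<in> P\<close> by (simp add: x_def)
  ultimately show ?thesis using zx by (intro bexI[of _ x]) simp_all
qed

lemma Kt_eq: "good t \<Longrightarrow> Kt t = (\<lambda>x. x + (t * \<beta> x) *\<^sub>R u) ` P"
  using moved_in_Kt Kt_moved by blast

end

section \<open>The displacement is an affine function\<close>

context shear_vertex
begin

text \<open>The weight is constant along \<open>u\<close>, so its gradient is orthogonal to
  \<open>u\<close>. This makes the displacement a shear on each \<open>Dom G\<close>.\<close>

lemma weight_affine:
  assumes G: "G \<in> acts"
  shows "\<exists>\<gamma> k. \<gamma> \<bullet> u = 0 \<and> (\<forall>x. \<nu> G (\<tau> G x) = \<gamma> \<bullet> x + k)"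
proof -
  define a where "a = adjoint (\<nu> G) 1"
  have a: "\<nu> G x = a \<bullet> x" for x
    using adjoint_works[OF lin_\<nu>[OF G], of x 1] by (simp add: a_def inner_commute)
  define \<kappa> where "\<kappa> = nrm G \<bullet> u"
  have \<kappa>: "\<kappa> \<noteq> 0" using acts_facet(3)[OF G] by (simp add: \<kappa>_def)
  show ?thesis
  proof (intro exI conjI allI)
    show "(a - (a \<bullet> u / \<kappa>) *\<^sub>R nrm G) \<bullet> u = 0" using \<kappa> by (simp add: inner_diff_left \<kappa>_def)
    show "\<nu> G (\<tau> G x) = (a - (a \<bullet> u / \<kappa>) *\<^sub>R nrm G) \<bullet> x + a \<bullet> u / \<kappa>" for x
      using \<kappa> by (simp add: a \<tau>_def \<kappa>_def[symmetric] inner_add_right inner_diff_left field_simps)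
  qed
qed

lemma compact_Dom: assumes G: "G \<in> acts" shows "compact (Dom G)"
proof -
  have "G face_of P" by (rule facet_of_imp_face_of[OF acts_facet(1)[OF G]])
  then have "closed G" using face_of_imp_compact[OF P_basic(2,1)] compact_imp_closed by blast
  moreover have "continuous_on UNIV (\<tau> G)"
    unfolding \<tau>_def divide_inverse by (intro continuous_intros)
  ultimately have "closed (\<tau> G -` G)" by (rule closed_vimage)
  then have "compact (P \<inter> \<tau> G -` G)" using P_basic(1) by (rule compact_Int_closed[rotated])
  moreover have "Dom G = P \<inter> \<tau> G -` G" by (auto simp: Dom_def)
  ultimately show ?thesis by simp
qed

text \<open>If all facets at \<open>w\<close> were parallel to \<open>u\<close>, a short segment in
  direction \<open>u\<close> centred at \<open>w\<close> would lie in \<open>P\<close>, and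
  \<open>w\<close> would not be extreme.\<close>

lemma vertex_moves_up: "ups \<noteq> {}"
proof
  assume e: "ups = {}"
  have fl: "nrm G \<bullet> u = 0" if "G facet_of P" "w \<in> G" for G
  proof (rule ccontr)
    assume "nrm G \<bullet> u \<noteq> 0"
    then have "G \<in> acts" using that by (simp add: acts_def)
    then show False using \<sigma>_ups[of G] e by blast
  qed
  obtain t0 where t0: "t0 > 0" "\<And>t. \<bar>t\<bar> < t0 \<Longrightarrow> good t" using good_near_0 by blast
  have in_P: "w + t *\<^sub>R u \<in> P" if "\<bar>t\<bar> < t0" for t
  proof -
    have "nrm G \<bullet> (w + t *\<^sub>R u) \<le> 1" if G: "G facet_of P" for G
    proof (cases "w \<in> G")
      case True then show ?thesis using fl[OF G True] facet_nrm[OF G True] by (simp add: inner_add_right)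
    next
      case False then show ?thesis using t0(2)[OF \<open>\<bar>t\<bar> < t0\<close>] G by (auto simp: good_def)
    qed
    then show ?thesis using P_eq by blast
  qed
  define e where "e = t0 / 2"
  have e: "e > 0" "\<bar>e\<bar> < t0" "\<bar>- e\<bar> < t0" using t0(1) by (auto simp: e_def)
  have "w extreme_point_of P" using w by (simp add: vertices_def)
  moreover have "w + e *\<^sub>R u \<in> P" "w + (- e) *\<^sub>R u \<in> P" using in_P e by blast+
  moreover have "w \<in> open_segment (w + e *\<^sub>R u) (w + (- e) *\<^sub>R u)"
  proof -
    have "w + e *\<^sub>R u \<noteq> w + (- e) *\<^sub>R u"
    proof
      assume "w + e *\<^sub>R u = w + (- e) *\<^sub>R u"
      then have "(2 * e) *\<^sub>R u = 0" by (simp add: algebra_simps scaleR_2[symmetric])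
      then show False using e u by simp
    qed
    moreover have "w = (1 - 1/2) *\<^sub>R (w + e *\<^sub>R u) + (1/2) *\<^sub>R (w + (- e) *\<^sub>R u)"
      by (simp add: vec_eq_iff field_simps)
    ultimately show ?thesis unfolding in_segment(2) by (intro conjI exI[of _ "1/2"]) auto
  qed
  ultimately show False by (auto simp: extreme_point_of_def)
qed

lemma \<beta>_AE_affine: "\<exists>\<eta> k. AE x in lborel. x \<in> P \<longrightarrow> \<beta> x = \<eta> \<bullet> x + k"
proof -
  have "\<forall>G. \<exists>\<gamma> k. G \<in> acts \<longrightarrow> \<gamma> \<bullet> u = 0 \<and> (\<forall>x. \<nu> G (\<tau> G x) = \<gamma> \<bullet> x + k)"
    using weight_affine by blast
  then obtain \<gamma> k where \<gamma>: "\<And>G. G \<in> acts \<Longrightarrow> \<gamma> G \<bullet> u = 0" "\<And>G x. G \<in> acts \<Longrightarrow> \<nu> G (\<tau> G x) = \<gamma> G \<bullet> x + k G"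
    by metis
  let ?U = "\<Union>G\<in>ups. Dom G"
  \<comment> \<open>\<open>None\<close> stands for the part of \<open>P\<close> that stays at
    rest.\<close>
  define I where "I = insert None (Some ` ups)"
  define D where "D i = (case i of None \<Rightarrow> P - ?U | Some G \<Rightarrow> Dom G)" for i
  have finI: "finite I" using finite_acts(2) by (simp add: I_def)
  have UB: "Dom G \<in> sets borel" "Dom G \<subseteq> P" if "G \<in> ups" for G
    using compact_Dom[OF ups_acts(1)[OF that]] by (auto simp: Dom_def intro: borel_compact)
  have "?U \<in> sets borel" using finite_acts(2) UB(1) by (intro sets.finite_UN) auto
  then have DB: "D i \<in> sets borel" if "i \<in> I" for i
    using that P_basic(5) UB(1) by (auto simp: I_def D_def)
  have Db: "bounded (D i)" if "i \<in> I" for i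
  proof (rule bounded_subset[OF P_basic(6)])
    show "D i \<subseteq> P"
    proof (cases i)
      case None then show ?thesis by (auto simp: D_def)
    next
      case (Some G)
      then have "G \<in> ups" using that by (auto simp: I_def)
      with Some show ?thesis using UB(2) by (simp add: D_def)
    qed
  qed
  have DU: "(\<Union>i\<in>I. D i) = P" using UB(2) by (auto simp: I_def D_def)
  have bm: "\<beta> \<in> borel_measurable borel"
  proof (rule piecewise_measurable[OF finite_acts(2) UB(1), where g = "\<lambda>G x. \<gamma> G \<bullet> x + k G"])
    fix G x assume "G \<in> ups" "x \<in> Dom G"
    then show "\<beta> x = \<gamma> G \<bullet> x + k G" using \<beta>_eq \<gamma>(2) ups_acts(1) by simp
  next
    fix x assume "x \<notin> (\<Union>G\<in>ups. Dom G)"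
    then show "\<beta> x = 0" using \<beta>_zero by blast
  qed auto
  have integral: "(LINT x:(\<lambda>x. x + (t * \<beta> x) *\<^sub>R u) ` P|lborel. f x) = (LINT x:P|lborel. f (x + (t * \<beta> x) *\<^sub>R u))"
    if f: "continuous_on UNIV f" for t and f :: "real^'n \<Rightarrow> real"
  proof -
    \<comment> \<open>Two points with the same image lie on a common chord, where
      \<open>\<beta>\<close> is constant.\<close>
    have inj: "inj_on (\<lambda>x. x + (t * \<beta> x) *\<^sub>R u) (\<Union>i\<in>I. D i)"
      unfolding DU
    proof (rule inj_onI)
      fix x y assume x: "x \<in> P" and y: "y \<in> P" and e: "x + (t * \<beta> x) *\<^sub>R u = y + (t * \<beta> y) *\<^sub>R u"
      have yx: "y = x + (t * \<beta> x - t * \<beta> y) *\<^sub>R u" using e by (simp add: algebra_simps)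
      then have "\<beta> y = \<beta> x" using \<beta>_line[OF x, of "t * \<beta> x - t * \<beta> y"] y by simp
      then show "x = y" using e by simp
    qed
    define g where "g i = (case i of None \<Rightarrow> 0 | Some G \<Rightarrow> t *\<^sub>R \<gamma> G)" for i
    define c where "c i = (case i of None \<Rightarrow> 0 | Some G \<Rightarrow> t * k G)" for i
    have g0: "g i \<bullet> u = 0" if "i \<in> I" for i
      using that \<gamma>(1)[OF ups_acts(1)] by (auto simp: I_def g_def)
    have gx: "x + (t * \<beta> x) *\<^sub>R u = x + (g i \<bullet> x + c i) *\<^sub>R u" if "i \<in> I" "x \<in> D i" for i x
    proof (cases i)
      case None
      then have "\<beta> x = 0" using that(2) \<beta>_zero by (auto simp: D_def)
      then show ?thesis using None by (simp add: g_def c_def)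
    next
      case (Some G)
      then have G: "G \<in> ups" "x \<in> Dom G" using that by (auto simp: I_def D_def)
      then show ?thesis using \<beta>_eq[OF G] \<gamma>(2)[OF ups_acts(1)[OF G(1)]] Some by (simp add: g_def c_def algebra_simps)
    qed
    show ?thesis
      using piecewise_shear_integral[where I = I and D = D and g = g and c = c and \<phi> = "\<lambda>x. x + (t * \<beta> x) *\<^sub>R u", OF finI DB Db g0 gx inj f] unfolding DU by blast
  qed
  obtain t1 where t1: "t1 > 0" "\<And>t. \<bar>t\<bar> < t1 \<Longrightarrow> good t" using good_near_0 by blast
  obtain \<epsilon> where \<epsilon>: "\<epsilon> > 0" "\<And>K. convex_body K \<Longrightarrow> (\<forall>x\<in>K. \<exists>y\<in>P. dist x y \<le> \<epsilon>) \<Longrightarrow> (\<forall>y\<in>P. \<exists>x\<in>K. dist y x \<le> \<epsilon>) \<Longrightarrow> isotropic_constant K \<le> isotropic_constant P"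
    using maximal_near by blast
  \<comment> \<open>The second bound keeps the displacement, which is at most
    \<open>\<bar>t\<bar> * norm u\<close>, within the range where maximality applies.\<close>
  define t0 where "t0 = min t1 (\<epsilon> / norm u)"
  have t0: "t0 > 0" using t1 \<epsilon> u by (simp add: t0_def)
  have good: "good t" and tu: "\<bar>t\<bar> * norm u \<le> \<epsilon>" if "\<bar>t\<bar> < t0" for t
    using that t1 u by (auto simp: t0_def pos_less_divide_eq less_imp_le)
  have cK: "compact (Kt t)" for t
    unfolding Kt_def using finite_vertices by (intro finite_imp_compact_convex_hull) (simp add: Bs_def)
  have KP: "(LINT x:Kt t|lborel. f x) = (LINT x:P|lborel. f (x + (t * \<beta> x) *\<^sub>R u))"
    if "\<bar>t\<bar> < t0" "continuous_on UNIV f" for t and f :: "real^'n \<Rightarrow> real"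
    using integral[OF that(2)] Kt_eq[OF good[OF that(1)]] by simp
  show ?thesis
  proof (rule second_variation[OF P_basic(5,6,7) mean bm _ u t0, where K = Kt])
    show "\<bar>\<beta> x\<bar> \<le> 1" for x using \<beta>_range[of x] by simp
    show "Kt t \<in> sets borel" "bounded (Kt t)" for t using cK by (auto intro: borel_compact compact_imp_bounded)
    show "isotropic_constant (Kt t) \<le> isotropic_constant P" if t: "\<bar>t\<bar> < t0" for t
    proof (rule \<epsilon>(2))
      \<comment> \<open>The motion preserves volume, so \<open>Kt t\<close> cannot be flat.\<close>
      have "interior (Kt t) \<noteq> {}"
      proof
        assume "interior (Kt t) = {}"
        then have "negligible (Kt t)" using negligible_convex_interior[of "Kt t"] by (simp add: Kt_def)
        then have "measure lborel (Kt t) = 0"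
          using cK[of t] by (simp add: negligible_iff_null_sets null_sets_completion_iff borel_compact measure_eq_0_null_sets)
        moreover have "measure lborel (Kt t) = measure lborel P"
          using KP[OF t, of "\<lambda>_. 1"] by (simp add: set_integral_const_one)
        ultimately show False using P_basic(7) by simp
      qed
      then show "convex_body (Kt t)" using cK[of t] by (simp add: convex_body_def Kt_def)
      have d: "dist x (x + (t * \<beta> x) *\<^sub>R u) \<le> \<epsilon>" for x
      proof -
        have "dist x (x + (t * \<beta> x) *\<^sub>R u) = \<bar>t\<bar> * norm u * \<beta> x" using \<beta>_range[of x] by (simp add: dist_norm abs_mult)
        also have "\<dots> \<le> \<epsilon> * 1" using \<beta>_range[of x] tu[OF t] \<epsilon>(1) by (intro mult_mono) auto
        finally show ?thesis by simp
      qed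
      show "\<forall>x\<in>Kt t. \<exists>y\<in>P. dist x y \<le> \<epsilon>" unfolding Kt_eq[OF good[OF t]] using d by (auto simp: dist_commute)
      show "\<forall>y\<in>P. \<exists>x\<in>Kt t. dist y x \<le> \<epsilon>" unfolding Kt_eq[OF good[OF t]] using d by auto
    qed
  qed (rule KP)
qed

text \<open>\<open>Dom G\<close> contains \<open>G\<close> and its mirror image. A hyperplane
  through 0 cannot contain \<open>G\<close>, whose vertices span the space; any other hyperplane
  would give both facets the same normal, although the products of their normals with
  \<open>u\<close> have opposite signs.\<close>

lemma interior_Dom: assumes G: "G \<in> ups" shows "interior (Dom G) \<noteq> {}"
proof
  note a = ups_acts[OF G]
  assume e: "interior (Dom G) = {}"
  have lt: "convex (Dom G)"
    unfolding convex_alt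
  proof safe
    fix x y and s :: real assume x: "x \<in> Dom G" and y: "y \<in> Dom G" and s: "0 \<le> s" "s \<le> 1"
    have cG: "convex G" using face_of_imp_convex[OF facet_of_imp_face_of[OF acts_facet(1)[OF a(1)]]] .
    have k: "nrm G \<bullet> u \<noteq> 0" using a(2) by simp
    have "(1 - nrm G \<bullet> ((1 - s) *\<^sub>R x + s *\<^sub>R y)) / (nrm G \<bullet> u) = (1 - s) * ((1 - nrm G \<bullet> x) / (nrm G \<bullet> u)) + s * ((1 - nrm G \<bullet> y) / (nrm G \<bullet> u))"
      unfolding inner_add_right inner_scaleR_right using k by (simp add: field_simps)
    then have "\<tau> G ((1 - s) *\<^sub>R x + s *\<^sub>R y) = (1 - s) *\<^sub>R \<tau> G x + s *\<^sub>R \<tau> G y"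
      by (simp only: \<tau>_def scaleR_add_right scaleR_add_left scaleR_scaleR) (simp add: algebra_simps)
    also have "\<dots> \<in> G" using x y s by (intro convexD_alt[OF cG]) (auto simp: Dom_def)
    finally show "(1 - s) *\<^sub>R x + s *\<^sub>R y \<in> Dom G"
      using x y s convexD_alt[OF P_basic(2)] by (auto simp: Dom_def)
  qed
  obtain b d where b: "b \<noteq> 0" "Dom G \<subseteq> {x. b \<bullet> x = d}"
    using empty_interior_subset_hyperplane[OF lt e] by blast
  have GD: "G \<subseteq> Dom G"
    using \<tau>_facet[OF a(1)] facet_subset_P[OF acts_facet(1)[OF a(1)]] by (auto simp: Dom_def)
  have \<sigma>GD: "\<sigma> ` G \<subseteq> Dom G"
  proof safe
    fix y assume y: "y \<in> G"
    have "\<sigma> y = y + (- \<mu> y) *\<^sub>R u" by (simp add: \<sigma>_def)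
    then have "\<tau> G (\<sigma> y) = y" using \<tau>_line[OF a(1)] \<tau>_facet[OF a(1) y] by metis
    then show "\<sigma> y \<in> Dom G" using y facet_subset_P[OF \<sigma>_facet[OF a(1)]] by (auto simp: Dom_def)
  qed
  show False
  proof (cases "d = 0")
    case True
    have "b \<bullet> x = 0" for x
    proof -
      have "x \<in> span (vertices G)" using acts_vertices(4)[OF a(1)] by simp
      then show ?thesis
      proof (induction rule: span_induct_alt)
        case (step c x y)
        then have "x \<in> {x. b \<bullet> x = d}" using b(2) GD vertices_subset[of G] by blast
        then show ?case using step True by (simp add: inner_add_right)
      qed simp
    qed
    then have "b = 0" by (metis inner_eq_zero_iff)
    with b(1) show False by simp
  next
    case False
    have "(1 / d) *\<^sub>R b = nrm G"
      using GD b(2) False by (intro nrm_unique[OF acts_facet(1)[OF a(1)]]) auto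
    moreover have "(1 / d) *\<^sub>R b = nrm (\<sigma> ` G)"
      using \<sigma>GD b(2) False by (intro nrm_unique[OF \<sigma>_facet[OF a(1)]]) auto
    ultimately show False using \<sigma>_acts(2)[OF a(1)] a(2) by simp
  qed
qed

text \<open>The affine function that agrees with \<open>\<beta>\<close> almost everywhere coincides
  with the weight formula of every moving facet, hence is 1 at \<open>w\<close> and constant along
  \<open>u\<close>. Any other vertex in some \<open>Dom G\<close> is an end of its chord and has
  weight 0 there.\<close>

theorem other_vertices_coplanar: "\<exists>\<eta> k. \<eta> \<bullet> u = 0 \<and> \<eta> \<bullet> w + k = 1 \<and> (\<forall>q\<in>vertices P - {w}. \<eta> \<bullet> q + k = 0)"
proof -
  obtain \<eta> k where ae: "AE x in lborel. x \<in> P \<longrightarrow> \<beta> x = \<eta> \<bullet> x + k" using \<beta>_AE_affine by blast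
  have cont: "continuous_on UNIV (\<lambda>x. a \<bullet> x + c)" for a :: "real^'n" and c by (intro continuous_intros)
  have weight: "\<nu> G (\<tau> G x) = \<eta> \<bullet> x + k" if G: "G \<in> ups" for G x
  proof -
    obtain \<gamma> c where \<gamma>: "\<And>x. \<nu> G (\<tau> G x) = \<gamma> \<bullet> x + c" using weight_affine[OF ups_acts(1)[OF G]] by blast
    have "AE x in lborel. x \<in> interior (Dom G) \<longrightarrow> \<eta> \<bullet> x + k = \<gamma> \<bullet> x + c"
      using ae
    proof eventually_elim
      case (elim x)
      show ?case
      proof
        assume "x \<in> interior (Dom G)"
        then have x: "x \<in> Dom G" using interior_subset by blast
        then have "x \<in> P" by (simp add: Dom_def)
        then show "\<eta> \<bullet> x + k = \<gamma> \<bullet> x + c" using elim \<beta>_eq[OF G x] \<gamma> by simp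
      qed
    qed
    then have "\<And>x. x \<in> interior (Dom G) \<Longrightarrow> \<eta> \<bullet> x + k = \<gamma> \<bullet> x + c"
      by (rule continuous_AE_eq_on_open[OF open_interior cont cont])
    then have "\<eta> = \<gamma>" "k = c" using affine_eq_on_open[OF open_interior interior_Dom[OF G]] by blast+
    then show ?thesis using \<gamma> by simp
  qed
  obtain G0 where G0: "G0 \<in> ups" using vertex_moves_up by blast
  note a0 = ups_acts(1)[OF G0]
  have w1: "\<eta> \<bullet> w + k = 1"
    using weight[OF G0, of w] \<tau>_facet[OF a0 acts_facet(2)[OF a0]] \<nu>_vertex[OF a0 acts_vertices(5)[OF a0]] by simp
  have u0: "\<eta> \<bullet> u = 0"
  proof -
    have "\<eta> \<bullet> (w + 1 *\<^sub>R u) + k = \<eta> \<bullet> w + k"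
      unfolding weight[OF G0, symmetric] \<tau>_line[OF a0] ..
    then show ?thesis by (simp add: inner_add_right)
  qed
  have "\<eta> \<bullet> q + k = 0" if q: "q \<in> vertices P - {w}" for q
  proof (cases "\<exists>G\<in>ups. q \<in> Dom G")
    case True
    then obtain G where G: "G \<in> ups" "q \<in> Dom G" by blast
    note a = ups_acts(1)[OF G(1)]
    have ext: "q extreme_point_of P" and qw: "q \<noteq> w" and qP: "q \<in> P" using q vertices_subset by (auto simp: vertices_def)
    obtain s r where sr: "s \<ge> 0" "r \<ge> 0" "\<tau> G q = q + s *\<^sub>R u" "\<sigma> (\<tau> G q) = q - r *\<^sub>R u" "\<tau> G q \<in> G" "\<sigma> (\<tau> G q) \<in> \<sigma> ` G"
      using chord_moving[OF G] by blast
    have "\<nu> G (\<tau> G q) = 0"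
    proof (cases "s = 0")
      case True
      then have "\<tau> G q = q" "q \<in> G" using sr(3,5) by auto
      moreover have "q \<in> vertices G" using vertices_facet[OF acts_facet(1)[OF a]] q \<open>q \<in> G\<close> by blast
      ultimately show ?thesis using \<nu>_vertex[OF a] qw by simp
    next
      case s: False
      \<comment> \<open>Otherwise the extreme point \<open>q\<close> would be an inner point of its
        chord.\<close>
      have "r = 0"
      proof (rule ccontr)
        assume "r \<noteq> 0"
        then have pos: "s > 0" "r > 0" using s sr by auto
        have P1: "q + s *\<^sub>R u \<in> P" using sr(3,5) facet_subset_P[OF acts_facet(1)[OF a]] by auto
        have P2: "q - r *\<^sub>R u \<in> P" using sr(6) facet_subset_P[OF \<sigma>_facet[OF a]] unfolding sr(4) by auto
        have "q \<in> open_segment (q + s *\<^sub>R u) (q - r *\<^sub>R u)"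
          unfolding in_segment(2)
        proof (intro conjI exI[of _ "s / (s + r)"])
          show "q + s *\<^sub>R u \<noteq> q - r *\<^sub>R u"
          proof
            assume "q + s *\<^sub>R u = q - r *\<^sub>R u"
            then have "(s + r) *\<^sub>R u = 0" by (simp add: algebra_simps)
            then show False using pos u by simp
          qed
          have "(1 - s / (s + r)) *\<^sub>R (q + s *\<^sub>R u) + (s / (s + r)) *\<^sub>R (q - r *\<^sub>R u)
             = q + ((1 - s / (s + r)) * s - s / (s + r) * r) *\<^sub>R u"
            by (simp add: algebra_simps)
          also have "(1 - s / (s + r)) * s - s / (s + r) * r = 0" using pos by (simp add: field_simps)
          finally show "q = (1 - s / (s + r)) *\<^sub>R (q + s *\<^sub>R u) + (s / (s + r)) *\<^sub>R (q - r *\<^sub>R u)" by simp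
        qed (use pos in auto)
        then show False using ext P1 P2 by (auto simp: extreme_point_of_def)
      qed
      then have q\<sigma>: "q = \<sigma> (\<tau> G q)" using sr(4) by simp
      have "q \<in> \<sigma> ` G" using sr(6) q\<sigma> by simp
      then have "q \<in> vertices (\<sigma> ` G)" using vertices_facet[OF \<sigma>_facet[OF a]] q by blast
      then obtain y where y: "y \<in> vertices G" "q = \<sigma> y" by (auto simp: vertices_\<sigma>)
      then have "\<tau> G q = y" using q\<sigma> inj_\<sigma> by (auto simp: inj_def)
      moreover have "y \<noteq> w" using y(2) qw \<sigma>_simps(1) by auto
      ultimately show ?thesis using \<nu>_vertex[OF a y(1)] by simp
    qed
    then show ?thesis using weight[OF G(1), of q] by simp
  next
    case False
    \<comment> \<open>Here \<open>\<beta>\<close> vanishes on an open subset of \<open>P\<close>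
      near \<open>q\<close>, so the affine function is identically 0 and the claim holds. By
      \<open>w1\<close> this case cannot actually arise.\<close>
    let ?U = "\<Union>G\<in>ups. Dom G"
    have "closed ?U" using finite_acts(2) compact_Dom[OF ups_acts(1)] by (intro closed_UN) (auto intro: compact_imp_closed)
    then have op: "open (- ?U)" by (rule open_Compl)
    have "q \<in> closure (interior P)"
      using q vertices_subset[of P] convex_closure_interior[OF P_basic(2) interior] P_basic(3) by auto
    then have ne: "(- ?U) \<inter> interior P \<noteq> {}"
      using open_Int_closure_eq_empty[OF op, of "interior P"] False by blast
    have opn: "open ((- ?U) \<inter> interior P)" using op by (intro open_Int open_interior)
    have "AE x in lborel. x \<in> (- ?U) \<inter> interior P \<longrightarrow> \<eta> \<bullet> x + k = 0 \<bullet> x + 0"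
      using ae
    proof eventually_elim
      case (elim x)
      show ?case
      proof
        assume x: "x \<in> (- ?U) \<inter> interior P"
        then have "x \<in> P" using interior_subset by blast
        moreover have "\<beta> x = 0" using x \<beta>_zero by blast
        ultimately show "\<eta> \<bullet> x + k = 0 \<bullet> x + 0" using elim by simp
      qed
    qed
    then have "\<And>x. x \<in> (- ?U) \<inter> interior P \<Longrightarrow> \<eta> \<bullet> x + k = 0 \<bullet> x + 0"
      by (rule continuous_AE_eq_on_open[OF opn cont cont])
    then have "\<eta> = 0" "k = 0" using affine_eq_on_open[OF opn ne] by blast+
    then show ?thesis by simp
  qed
  with w1 u0 show ?thesis by blast
qed

end

section \<open>The theorem\<close>

context centered_maximizer
begin

lemma star_nonempty:
  assumes v: "v \<in> vertices P" shows "star v \<noteq> {}"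
proof
  assume "star v = {}"
  have "{v} face_of P" using v by (simp add: vertices_def face_of_singleton)
  moreover have "{v} \<noteq> P" using interior by auto
  ultimately have "{v} = \<Inter>{F. F facet_of P \<and> {v} \<subseteq> F}"
    by (intro face_of_polyhedron polytope_imp_polyhedron polytope) auto
  also have "{F. F facet_of P \<and> {v} \<subseteq> F} = {}" using \<open>star v = {}\<close> by (auto simp: star_def)
  finally have "(UNIV :: (real^'n) set) = {v}" by simp
  then have "interior P \<subseteq> interior {v}" by (intro interior_mono) auto
  then show False using interior by simp
qed

text \<open>The functionals found at the vertices \<open>w\<close> of \<open>F\<close> other than
  \<open>a\<close> are 1 at \<open>w\<close>, 0 at all other vertices and constant along
  \<open>u\<close>. They act as barycentric coordinates and force every vertex off \<open>F\<close>
  onto the line through \<open>a\<close> and \<open>b\<close>.\<close>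

lemma simplex_if_simplicial_vertex:
  assumes n: "CARD('n) \<ge> 2" and v: "simplicial_vertex v P"
  shows "int CARD('n) simplex P"
proof -
  have vP: "v \<in> vertices P" and simp: "\<And>F. F \<in> star v \<Longrightarrow> \<exists>k. k simplex F"
    using v by (auto simp: simplicial_vertex_def vertices_def star_def)
  obtain F where Fs: "F \<in> star v" using star_nonempty[OF vP] by blast
  then have F: "F facet_of P" and vF: "v \<in> F" by (auto simp: star_def)
  obtain k where k: "k simplex F" using simp[OF Fs] by blast
  note V = simplicial_vertices[OF F k]
  have vV: "v \<in> vertices F" using vertices_facet[OF F] vP vF by blast
  have "vertices F \<noteq> {v}" using V(2) n by auto
  then obtain a where a: "a \<in> vertices F" "a \<noteq> v" using vV by blast
  obtain G where G: "G facet_of P" "G \<noteq> F" "vertices F - {a} \<subseteq> G"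
    using adjacent_facet_exists[OF F k a(1)] a(2) vV by (metis singletonD)
  have Gs: "G \<in> star v" using G a vV by (auto simp: star_def)
  then obtain l where l: "l simplex G" using simp by blast
  obtain b where b: "b \<notin> vertices F" "vertices G = insert b (vertices F - {a})"
    "\<And>w. w \<in> vertices F - {a} \<Longrightarrow> Q w (a - b) = 0" "Q a a = Q b b"
    using adjacent_facets[OF F k G(1) l G(2)[symmetric] a(1) G(3)] by blast
  define u where "u = a - b"
  have u: "u \<noteq> 0" using a(1) b(1) by (auto simp: u_def)
  define \<mu> where "\<mu> x = 2 * Q u x / Q u u" for x
  have lin: "linear \<mu>" unfolding \<mu>_def by (rule linearI) (simp_all add: Q_simps add_divide_distrib algebra_simps)
  have \<mu>u: "\<mu> u = 2" using Q_pos[OF u] by (simp add: \<mu>_def)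
  have \<mu>w: "\<mu> w = 0" if "w \<in> vertices F - {a}" for w
    using b(3)[OF that] Q_sym[of w u] by (simp add: \<mu>_def u_def)
  have refl: "(\<lambda>x. x - \<mu> x *\<^sub>R u) = reflection u" by (simp add: fun_eq_iff reflection_def \<mu>_def)
  have sym: "(\<lambda>x. x - \<mu> x *\<^sub>R u) ` H facet_of P" if "H \<in> star v" for H
    unfolding refl
    using star_symmetric[OF simp vP Fs a Gs G(2,3) b(2,1,3,4) that] by (simp add: star_def u_def)
  have VFP: "vertices F \<subseteq> vertices P" using vertices_facet[OF F] by blast
  have vVa: "v \<in> vertices F - {a}" using vV a by blast
  have sv: "shear_vertex P B v u \<mu>"
  proof (rule shear_vertex.intro[OF centered_maximizer_axioms], rule shear_vertex_axioms.intro)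
    show "v \<in> vertices P" "u \<noteq> 0" "linear \<mu>" "\<mu> u = 2" "\<mu> v = 0" using vP u lin \<mu>u \<mu>w[OF vVa] by auto
    fix H assume "H facet_of P" "v \<in> H"
    then have "H \<in> star v" by (simp add: star_def)
    then show "(\<exists>k. k simplex H) \<and> (\<lambda>x. x - \<mu> x *\<^sub>R u) ` H facet_of P" using simp sym by blast
  qed
  obtain \<eta> c where \<eta>: "\<eta> \<bullet> u = 0" "\<eta> \<bullet> v + c = 1" "\<And>q. q \<in> vertices P - {v} \<Longrightarrow> \<eta> \<bullet> q + c = 0"
    using shear_vertex.other_vertices_coplanar[OF sv] by blast
  text \<open>\<open>P\<close> is thus a pyramid with apex \<open>v\<close>, and its base is parallel to \<open>u\<close>.\<close>
  have base: "v \<in> H" if H: "H facet_of P" "nrm H \<bullet> u \<noteq> 0" for H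
  proof (rule ccontr)
    assume vH: "v \<notin> H"
    have "H face_of P" by (rule facet_of_imp_face_of[OF H(1)])
    then have "compact H" "convex H" using face_of_imp_compact[OF P_basic(2,1)] face_of_imp_convex by auto
    then have HV: "H = convex hull (vertices H)" unfolding vertices_def by (rule Krein_Milman_Minkowski)
    have "vertices H \<subseteq> {x. \<eta> \<bullet> x = - c}"
    proof
      fix q assume "q \<in> vertices H"
      then have "q \<in> vertices P - {v}" using vertices_facet[OF H(1)] vH by blast
      from \<eta>(3)[OF this] show "q \<in> {x. \<eta> \<bullet> x = - c}" by simp
    qed
    then have "H \<subseteq> {x. \<eta> \<bullet> x = - c}" by (subst HV) (intro hull_minimal convex_hyperplane)
    then have "nrm H + (\<eta> + c *\<^sub>R nrm H) = nrm H"
      using facet_nrm[OF H(1)] by (intro nrm_unique[OF H(1)]) (auto simp: inner_add_left)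
    then have e: "\<eta> = - c *\<^sub>R nrm H" by (simp add: eq_neg_iff_add_eq_0)
    then have "c * (nrm H \<bullet> u) = 0" using \<eta>(1) by simp
    then have "c = 0" using H(2) by simp
    then show False using e \<eta>(2) by simp
  qed
  \<comment> \<open>By \<open>base\<close>, a facet not parallel to \<open>u\<close> passes through
    \<open>v\<close>, so its mirror image is a facet too. This is what the motion of
    \<open>w\<close> requires.\<close>
  have "\<exists>\<eta> c. \<eta> \<bullet> u = 0 \<and> \<eta> \<bullet> w + c = 1 \<and> (\<forall>q\<in>vertices P - {w}. \<eta> \<bullet> q + c = 0)" if w: "w \<in> vertices F - {a}" for w
  proof -
    have "shear_vertex P B w u \<mu>"
    proof (rule shear_vertex.intro[OF centered_maximizer_axioms], rule shear_vertex_axioms.intro)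
      show "w \<in> vertices P" "u \<noteq> 0" "linear \<mu>" "\<mu> u = 2" "\<mu> w = 0" using w VFP u lin \<mu>u \<mu>w[OF w] by auto
      fix H assume "H facet_of P" "nrm H \<bullet> u \<noteq> 0"
      then have "H \<in> star v" using base by (simp add: star_def)
      then show "(\<exists>k. k simplex H) \<and> (\<lambda>x. x - \<mu> x *\<^sub>R u) ` H facet_of P" using simp sym by blast
    qed
    then show ?thesis by (rule shear_vertex.other_vertices_coplanar)
  qed
  then obtain \<theta> d where \<theta>: "\<And>w. w \<in> vertices F - {a} \<Longrightarrow> \<theta> w \<bullet> u = 0" "\<And>w. w \<in> vertices F - {a} \<Longrightarrow> \<theta> w \<bullet> w + d w = 1"
    "\<And>w q. w \<in> vertices F - {a} \<Longrightarrow> q \<in> vertices P - {w} \<Longrightarrow> \<theta> w \<bullet> q + d w = 0"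
    by metis
  have bP: "b \<in> vertices P" using b(2) vertices_facet[OF G(1)] by blast
  have out: "nrm F \<bullet> q < 1" if q: "q \<in> vertices P" "q \<notin> vertices F" for q
  proof -
    have qP: "q \<in> P" using q(1) vertices_subset by blast
    have "q \<notin> F" using q vertices_facet[OF F] by blast
    then show ?thesis using P_nrm[OF F qP] in_facet_iff[OF F qP] by simp
  qed
  have nF: "nrm F \<bullet> w = 1" if "w \<in> vertices F" for w using that facet_nrm[OF F] vertices_subset by blast
  have only: "q = b" if q: "q \<in> vertices P" "q \<notin> vertices F" for q
  proof -
    \<comment> \<open>The distance, in units of \<open>u\<close>, by which \<open>q\<close> must be
      moved to reach the hyperplane of \<open>F\<close>. It is positive because \<open>b\<close> and
      \<open>q\<close> are both strictly below that hyperplane.\<close>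
    define \<delta> where "\<delta> = (1 - nrm F \<bullet> q) / (1 - nrm F \<bullet> b)"
    have \<delta>: "\<delta> > 0" using out[OF q] out[OF bP b(1)] by (simp add: \<delta>_def)
    define q' where "q' = q + \<delta> *\<^sub>R u"
    obtain Y where Y: "\<And>v. linear (Y v)" "\<And>x. (\<Sum>v\<in>vertices F. Y v x *\<^sub>R v) = x"
      "\<And>v w. v \<in> vertices F \<Longrightarrow> w \<in> vertices F \<Longrightarrow> Y v w = (if v = w then 1 else (0::real))"
      by (rule basis_coordinates[OF V(1,3,5)]) blast
    have "\<delta> * (1 - nrm F \<bullet> b) = 1 - nrm F \<bullet> q" using out[OF bP b(1)] by (simp add: \<delta>_def)
    then have "nrm F \<bullet> q' = 1" using nF[OF a(1)] by (simp add: q'_def u_def inner_add_right inner_diff_right)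
    then have Y1: "(\<Sum>x\<in>vertices F. Y x q') = 1"
      using convex_hull_basis(1)[where V = "vertices F" and y = Y, OF V(1) Y nF, of q'] by simp
    \<comment> \<open>The functional of \<open>w\<close> vanishes at \<open>q\<close>, hence also at
      \<open>q'\<close>. On points of the hyperplane of \<open>F\<close> it equals the coordinate at
      \<open>w\<close>.\<close>
    have Y0: "Y w q' = 0" if w: "w \<in> vertices F - {a}" for w
    proof -
      have "\<theta> w \<bullet> q' + d w = 0"
        using \<theta>(1)[OF w] \<theta>(3)[OF w, of q] q w by (simp add: q'_def inner_add_right) auto
      moreover have "\<theta> w \<bullet> q' = (\<Sum>x\<in>vertices F. Y x q' * (\<theta> w \<bullet> x))"
        by (subst Y(2)[of q', symmetric]) (simp only: inner_sum_right inner_scaleR_right)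
      moreover have "d w = (\<Sum>x\<in>vertices F. Y x q' * d w)" using Y1 by (simp add: sum_distrib_right[symmetric])
      ultimately have "(\<Sum>x\<in>vertices F. Y x q' * (\<theta> w \<bullet> x + d w)) = 0"
        by (simp add: distrib_left sum.distrib)
      moreover have "(\<Sum>x\<in>vertices F. Y x q' * (\<theta> w \<bullet> x + d w)) = (\<Sum>x\<in>vertices F. if x = w then Y w q' else 0)"
        using \<theta>(2)[OF w] \<theta>(3)[OF w] VFP by (intro sum.cong refl) auto
      ultimately show ?thesis using V(1) w by simp
    qed
    have "Y a q' = 1" using Y1 Y0 V(1) a(1) by (simp add: sum.remove)
    then have "q' = a"
      using Y(2)[of q'] Y0 V(1) a(1) by (simp add: sum.remove)
    then have qe: "q = a + \<delta> *\<^sub>R (b - a)" by (simp add: q'_def u_def algebra_simps)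
    have ext: "x extreme_point_of P" if "x \<in> vertices P" for x using that by (simp add: vertices_def)
    have inP: "q \<in> P" "b \<in> P" "a \<in> P" using q(1) bP a(1) VFP vertices_subset by blast+
    have ab: "a \<noteq> b" using u by (simp add: u_def)
    show "q = b"
    \<comment> \<open>\<open>q\<close> lies on the ray from \<open>a\<close> through
      \<open>b\<close>. Unless the two coincide, the nearer one is an inner point of a segment in
      \<open>P\<close> and so not extreme.\<close>
    proof (cases \<delta> "1 :: real" rule: linorder_cases)
      case less
      have "q \<in> open_segment a b" unfolding in_segment(2)
        using ab \<delta> less qe by (intro conjI exI[of _ \<delta>]) (auto simp: algebra_simps)
      then show ?thesis using ext[OF q(1)] inP by (auto simp: extreme_point_of_def)
    next
      case equal then show ?thesis using qe by simp
    next
      case greater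
      have "a \<noteq> q" using qe \<delta> ab by auto
      moreover have "b = (1 - 1 / \<delta>) *\<^sub>R a + (1 / \<delta>) *\<^sub>R q" using \<delta> by (simp add: qe algebra_simps)
      ultimately have "b \<in> open_segment a q" unfolding in_segment(2)
        using greater by (intro conjI exI[of _ "1 / \<delta>"]) auto
      then show ?thesis using ext[OF bP] inP by (auto simp: extreme_point_of_def)
    qed
  qed
  have VP: "vertices P = insert b (vertices F)" using only VFP bP by blast
  then have card: "card (vertices P) = CARD('n) + 1" using b(1) V(1,2) by simp
  have hull: "P = convex hull (vertices P)"
    unfolding vertices_def by (rule Krein_Milman_Minkowski[OF P_basic(1,2)])
  have "aff_dim (vertices P) = aff_dim P" by (subst (2) hull) (simp add: aff_dim_convex_hull)
  also have "\<dots> = int CARD('n)" using aff_dim_nonempty_interior[OF interior] by simp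
  finally have "\<not> affine_dependent (vertices P)"
    using card VP V(1) by (simp add: affine_independent_iff_card)
  then show ?thesis unfolding simplex_def using card hull by (intro exI[of _ "vertices P"]) auto
qed

end

text \<open>In dimension one a facet is a single point and has no ridge to cross, so this case is
  settled directly.\<close>

lemma convex_body_dim_1_simplex:
  fixes P :: "(real^'n) set"
  assumes P: "convex_body P" and n: "CARD('n) = 1"
  shows "1 simplex P"
proof -
  have "collinear P" unfolding collinear_aff_dim using aff_dim_le_DIM[of P] n by simp
  moreover have "P \<noteq> {}" using P interior_subset[of P] by (auto simp: convex_body_def)
  ultimately obtain a b where ab: "P = closed_segment a b"
    using P compact_convex_collinear_segment[of P] by (auto simp: convex_body_def)
  have "a \<noteq> b" using P ab by (auto simp: convex_body_def)
  then show ?thesis unfolding simplex_def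
    by (intro exI[of _ "{a, b}"]) (simp add: ab segment_convex_hull)
qed

section \<open>Translation invariance and reduction to centroid 0\<close>

lemma set_integral_translation:
  fixes f :: "real^'n \<Rightarrow> real"
  assumes "S \<in> sets borel" "f \<in> borel_measurable borel"
  shows "(LINT x:(+) c ` S|lborel. f x) = (LINT x:S|lborel. f (c + x))"
proof -
  note [measurable] = assms translation_borel(1)[OF assms(1)]
  have ind: "indicator ((+) c ` S) (c + x) = (indicator S x :: real)" for x by (auto simp: indicator_def)
  have "(LINT x:(+) c ` S|lborel. f x) = (\<integral>x. indicator ((+) c ` S) x * f x \<partial>distr lborel borel ((+) c))"
    by (simp add: lborel_distr_plus set_lebesgue_integral_def)
  also have "\<dots> = (\<integral>x. indicator ((+) c ` S) (c + x) * f (c + x) \<partial>lborel)"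
    by (subst integral_distr) simp_all
  finally show ?thesis by (simp add: ind set_lebesgue_integral_def)
qed

lemma covariance_matrix_translation:
  fixes K :: "(real^'n) set"
  assumes K: "K \<in> sets borel" "bounded K" "measure lborel K > 0"
  shows "covariance_matrix ((+) c ` K) = covariance_matrix K"
proof -
  let ?m = "measure lborel K"
  have K': "(+) c ` K \<in> sets borel" "bounded ((+) c ` K)" "measure lborel ((+) c ` K) = ?m"
    using translation_borel[OF K(1)] bounded_translation[OF K(2)] by auto
  have si: "set_integrable lborel K f" if "continuous_on UNIV f" for f :: "real^'n \<Rightarrow> real"
    using set_integrable_continuous_bounded[OF K(2,1) that] .
  have bm: "f \<in> borel_measurable borel" if "continuous_on UNIV f" for f :: "real^'n \<Rightarrow> real"
    using that by (rule borel_measurable_continuous_onI)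
  have const: "(LINT x:K|lborel. d) = ?m * d" for d :: real by (simp add: set_lebesgue_integral_def)
  have 1: "(LINT x:(+) c ` K|lborel. x$i) = ?m * c$i + (LINT x:K|lborel. x$i)" for i
  proof -
    have "(LINT x:(+) c ` K|lborel. x$i) = (LINT x:K|lborel. c$i + x$i)"
      by (subst set_integral_translation[OF K(1)]) (auto intro!: bm continuous_intros)
    also have "\<dots> = (LINT x:K|lborel. c$i) + (LINT x:K|lborel. x$i)"
      by (rule set_integral_add(2)) (intro si continuous_intros)+
    finally show ?thesis by (simp add: const)
  qed
  have 2: "(LINT x:(+) c ` K|lborel. x$i * x$j) = ?m * (c$i * c$j) + (c$i * (LINT x:K|lborel. x$j) + (c$j * (LINT x:K|lborel. x$i) + (LINT x:K|lborel. x$i * x$j)))" for i j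
  proof -
    have "(LINT x:(+) c ` K|lborel. x$i * x$j) = (LINT x:K|lborel. c$i * c$j + (c$i * x$j + (c$j * x$i + x$i * x$j)))"
      by (subst set_integral_translation[OF K(1)]) (auto intro!: bm continuous_intros simp: algebra_simps)
    also have "\<dots> = (LINT x:K|lborel. c$i * c$j) + ((LINT x:K|lborel. c$i * x$j) + ((LINT x:K|lborel. c$j * x$i) + (LINT x:K|lborel. x$i * x$j)))"
    proof -
      have s: "set_integrable lborel K (\<lambda>x. c$i * c$j)" "set_integrable lborel K (\<lambda>x. c$i * x$j)" "set_integrable lborel K (\<lambda>x. c$j * x$i)" "set_integrable lborel K (\<lambda>x. x$i * x$j)"
        by (intro si continuous_intros)+
      show ?thesis by (simp only: set_integral_add s)
    qed
    finally show ?thesis by (simp add: const)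
  qed
  have "covariance_matrix ((+) c ` K) $ i $ j = covariance_matrix K $ i $ j" for i j
  proof -
    have pos: "measure lborel ((+) c ` K) > 0" using K'(3) K(3) by simp
    show ?thesis
      unfolding covariance_matrix_entry[OF K] covariance_matrix_entry[OF K'(1,2) pos] K'(3) 1 2
      using K(3) by (simp add: field_simps)
  qed
  then show ?thesis by (simp add: vec_eq_iff)
qed

lemma isotropic_constant_translation:
  fixes K :: "(real^'n) set"
  assumes "K \<in> sets borel" "bounded K" "measure lborel K > 0"
  shows "isotropic_constant ((+) c ` K) = isotropic_constant K"
  unfolding isotropic_constant_def covariance_matrix_translation[OF assms] translation_borel(2)[OF assms(1)] ..

lemma hausdorff_distance_translation:
  fixes S T :: "'a::real_normed_vector set"
  shows "hausdorff_distance ((+) c ` S) ((+) c ` T) = hausdorff_distance S T"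
proof -
  have "infdist (c + x) ((+) c ` T) = infdist x T" for x and T :: "'a set"
    by (simp add: infdist_def image_image)
  then show ?thesis by (simp add: hausdorff_distance_def image_image)
qed

lemma simplex_translation:
  assumes "k simplex S" shows "k simplex ((+) c ` S)"
proof -
  obtain C where C: "\<not> affine_dependent C" "int (card C) = k + 1" "S = convex hull C"
    using assms by (auto simp: simplex_def)
  show ?thesis unfolding simplex_def
    using C affine_dependent_translation_eq[of C c] convex_hull_translation[of c C]
    by (intro exI[of _ "(+) c ` C"]) (auto simp: card_image)
qed

lemma convex_body_basic:
  fixes K :: "(real^'n) set"
  assumes "convex_body K"
  shows "K \<in> sets borel" "bounded K" "measure lborel K > 0" "convex_body ((+) c ` K)"
proof -
  have c: "compact K" "convex K" "interior K \<noteq> {}" using assms by (auto simp: convex_body_def)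
  show "K \<in> sets borel" "bounded K" using c by (auto intro: borel_compact compact_imp_bounded)
  have "\<not> negligible K" using c negligible_convex_interior by blast
  then have "emeasure lborel K \<noteq> 0"
    using \<open>K \<in> sets borel\<close> by (auto simp: negligible_iff_null_sets null_sets_completion_iff)
  then show "measure lborel K > 0"
    using emeasure_bounded_finite[OF \<open>bounded K\<close>] by (simp add: measure_def enn2real_positive_iff zero_less_iff_neq_zero)
  show "convex_body ((+) c ` K)"
    using c by (auto simp: convex_body_def interior_translation intro: compact_translation)
qed

theorem theorem1p2:
  fixes P :: "(real ^ 'n) set"
  assumes "polytope P"
    and "interior P \<noteq> {}"
    and "local_maximizer_in isotropic_constant {K. convex_body K} P"
    and "\<exists>v. simplicial_vertex v P"
  shows "int CARD('n) simplex P"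
proof (cases "CARD('n) = 1")
  case True
  have "convex_body P" using assms(3) by (simp add: local_maximizer_in_def)
  from convex_body_dim_1_simplex[OF this True] show ?thesis by (simp add: True)
next
  case False
  moreover have "CARD('n) > 0" by simp
  ultimately have n: "CARD('n) \<ge> 2" by linarith
  obtain v where v: "simplicial_vertex v P" using assms(4) by blast
  have cb: "convex_body P" using assms(3) by (simp add: local_maximizer_in_def)
  note P = convex_body_basic[OF cb]
  let ?m = "measure lborel P"
  define c where "c = (\<chi> i. - ((LINT x:P|lborel. x$i) / ?m))"
  define P' where "P' = (+) c ` P"
  have PP': "P = (+) (- c) ` P'" by (simp add: P'_def image_image)
  note P'b = convex_body_basic[OF P(4)[of c], folded P'_def]
  have mean: "(LINT x:P'|lborel. x$i) = 0" for i
  proof -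
    have cn: "continuous_on UNIV (\<lambda>x :: real^'n. x$i)" by (intro continuous_intros)
    have "(LINT x:P'|lborel. x$i) = (LINT x:P|lborel. c$i + x$i)"
      unfolding P'_def by (subst set_integral_translation[OF P(1) borel_measurable_continuous_onI[OF cn]]) simp
    also have "\<dots> = (LINT x:P|lborel. c$i) + (LINT x:P|lborel. x$i)"
      by (rule set_integral_add(2)) (intro set_integrable_continuous_bounded[OF P(2,1)] continuous_intros)+
    also have "(LINT x:P|lborel. c$i) = ?m * c$i" by (simp add: set_lebesgue_integral_def)
    finally show ?thesis using P(3) by (simp add: c_def)
  qed
  have "det (covariance_matrix P') > 0"
    by (rule symmetric_pos_def_det_pos) (rule covariance_matrix_pos_def[OF P'b(1-3) mean])
  then obtain B where B: "covariance_matrix P' ** B = mat 1" "B ** covariance_matrix P' = mat 1"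
    using invertible_det_nz[of "covariance_matrix P'"] by (auto simp: invertible_def)
  have "centered_maximizer P' B"
  proof
    obtain U where "finite U" "P = convex hull U" using assms(1) by (auto simp: polytope_def)
    then have "finite ((+) c ` U)" "P' = convex hull ((+) c ` U)" by (simp_all add: P'_def convex_hull_translation)
    then show "polytope P'" by (auto simp: polytope_def)
    show "interior P' \<noteq> {}" using assms(2) by (simp add: P'_def interior_translation)
    obtain \<epsilon> where \<epsilon>: "\<epsilon> > 0" "\<And>K. convex_body K \<Longrightarrow> hausdorff_distance K P < \<epsilon> \<Longrightarrow> isotropic_constant K \<le> isotropic_constant P"
      using assms(3) by (auto simp: local_maximizer_in_def)
    show "\<exists>\<epsilon>>0. \<forall>K. convex_body K \<longrightarrow> hausdorff_distance K P' < \<epsilon> \<longrightarrow> isotropic_constant K \<le> isotropic_constant P'"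
    proof (intro exI[of _ \<epsilon>] conjI allI impI \<epsilon>(1))
      fix K assume K: "convex_body K" "hausdorff_distance K P' < \<epsilon>"
      note Kb = convex_body_basic[OF K(1)]
      have "isotropic_constant K = isotropic_constant ((+) (- c) ` K)"
        by (rule isotropic_constant_translation[OF Kb(1-3), symmetric])
      also have "\<dots> \<le> isotropic_constant P"
      proof (rule \<epsilon>(2)[OF Kb(4)])
        show "hausdorff_distance ((+) (- c) ` K) P < \<epsilon>"
          using K(2) hausdorff_distance_translation[of "- c" K P'] unfolding PP'[symmetric] by simp
      qed
      also have "\<dots> = isotropic_constant P'"
        unfolding P'_def by (rule isotropic_constant_translation[OF P(1-3), symmetric])
      finally show "isotropic_constant K \<le> isotropic_constant P'" .
    qed
  qed (use mean B in auto)
  moreover have "simplicial_vertex (c + v) P'"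
    unfolding simplicial_vertex_def
  proof (intro conjI allI impI)
    show "(c + v) extreme_point_of P'" using v by (simp add: P'_def simplicial_vertex_def extreme_point_of_translation_eq)
    fix F assume F: "F facet_of P' \<and> c + v \<in> F"
    define F0 where "F0 = (+) (- c) ` F"
    have FF0: "F = (+) c ` F0" by (simp add: F0_def image_image)
    have "F0 facet_of P" using F unfolding FF0 P'_def by (simp add: facet_of_def aff_dim_translation_eq)
    moreover have "v \<in> F0" using F unfolding FF0 by auto
    ultimately obtain k where "k simplex F0" using v by (auto simp: simplicial_vertex_def)
    then show "\<exists>k. k simplex F" unfolding FF0 using simplex_translation by blast
  qed
  ultimately have "int CARD('n) simplex P'" by (rule centered_maximizer.simplex_if_simplicial_vertex[OF _ n])
  then show ?thesis by (subst PP') (rule simplex_translation)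
qed

end
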